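(* For any directed graph $G$ on $n$ vertices with positive real edge capacities, a designated source vertex $s$ and a designated sink vertex $t$, there is an algorithm that computes the set of all vital edges of $G$ using $\mathcal{O}(n)$ maximum $(s,t)$-flow computations.
   Context: An $(s,t)$-cut is a set $C\subset V$ with $s\in C$, $t\notin C$; its capacity is the sum of capacities of edges from $C$ to $V\setminus C$. An edge is vital if its removal strictly decreases the minimum capacity of an $(s,t)$-cut. *)

theory Defs
  imports Complex_Main
begin

section \<open>Networks, cuts, vital edges and flows\<close>

record network =
  nv :: nat
  src :: nat
  snk :: nat
  edges :: "(nat \<times> nat) set"
  cap :: "nat \<times> nat \<Rightarrow> real"

text \<open>The vertex set of a network is \<open>{..<nv G}\<close>; \<open>cap\<close> is relevant on \<open>edges\<close> only.\<close>

definition wf_network :: "network \<Rightarrow> bool" where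
  "wf_network G \<longleftrightarrow>
     src G < nv G \<and> snk G < nv G \<and> src G \<noteq> snk G \<and>
     edges G \<subseteq> {..<nv G} \<times> {..<nv G} \<and> (\<forall>e\<in>edges G. cap G e > 0)"

definition st_cuts :: "network \<Rightarrow> nat set set" where
  "st_cuts G = {C. C \<subseteq> {..<nv G} \<and> src G \<in> C \<and> snk G \<notin> C}"

definition cut_capacity :: "network \<Rightarrow> nat set \<Rightarrow> real" where
  "cut_capacity G C = (\<Sum>e\<in>{(u, v) \<in> edges G. u \<in> C \<and> v \<in> {..<nv G} - C}. cap G e)"

definition mincut_capacity :: "network \<Rightarrow> real" where
  "mincut_capacity G = Min (cut_capacity G ` st_cuts G)"

definition delete_edge :: "network \<Rightarrow> nat \<times> nat \<Rightarrow> network" where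
  "delete_edge G e = G\<lparr>edges := edges G - {e}\<rparr>"

definition vital_edges :: "network \<Rightarrow> (nat \<times> nat) set" where
  "vital_edges G = {e \<in> edges G. mincut_capacity (delete_edge G e) < mincut_capacity G}"

definition outflow :: "network \<Rightarrow> (nat \<times> nat \<Rightarrow> real) \<Rightarrow> nat \<Rightarrow> real" where
  "outflow G f u = (\<Sum>v | (u, v) \<in> edges G. f (u, v))"

definition inflow :: "network \<Rightarrow> (nat \<times> nat \<Rightarrow> real) \<Rightarrow> nat \<Rightarrow> real" where
  "inflow G f v = (\<Sum>u | (u, v) \<in> edges G. f (u, v))"

definition st_flow :: "network \<Rightarrow> (nat \<times> nat \<Rightarrow> real) \<Rightarrow> bool" where
  "st_flow G f \<longleftrightarrow>
     (\<forall>e\<in>edges G. 0 \<le> f e \<and> f e \<le> cap G e) \<and> (\<forall>e. e \<notin> edges G \<longrightarrow> f e = 0) \<and>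
     (\<forall>v<nv G. v \<noteq> src G \<and> v \<noteq> snk G \<longrightarrow> outflow G f v = inflow G f v)"

definition flow_value :: "network \<Rightarrow> (nat \<times> nat \<Rightarrow> real) \<Rightarrow> real" where
  "flow_value G f = outflow G f (src G) - inflow G f (src G)"

definition max_flow :: "network \<Rightarrow> (nat \<times> nat \<Rightarrow> real) \<Rightarrow> bool" where
  "max_flow G f \<longleftrightarrow> st_flow G f \<and> (\<forall>g. st_flow G g \<longrightarrow> flow_value G g \<le> flow_value G f)"

text \<open>A maximum flow routine may return any maximum flow of the network it is given.\<close>

definition max_flow_oracle :: "(network \<Rightarrow> nat \<times> nat \<Rightarrow> real) \<Rightarrow> bool" where
  "max_flow_oracle F \<longleftrightarrow> (\<forall>G. wf_network G \<longrightarrow> max_flow G (F G))"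

section \<open>A real RAM with a maximum flow instruction\<close>

text \<open>
  The machine has scalar variables and two-dimensional arrays over the natural numbers, and
  two-dimensional arrays over the reals.  Programs are finite syntactic objects, so that one
  program has to serve all inputs.  The instruction set is chosen so that charging one unit
  per executed assignment or test is realistic: natural numbers are only copied, incremented
  and compared (they stay polynomial in the running time), real numbers admit the field
  operations and comparison (no rounding), and 0 and 1 are the only real constants.
  Division by zero yields zero, as usual in HOL.
\<close>

type_synonym name = string

record state =
  nvar :: "name \<Rightarrow> nat"
  narr :: "name \<Rightarrow> nat \<Rightarrow> nat \<Rightarrow> nat"
  rarr :: "name \<Rightarrow> nat \<Rightarrow> nat \<Rightarrow> real"

datatype nexp = NConst nat | NVar name | NGet name nexp nexp | NSuc nexp

datatype rexp = RZero | ROne | RGet name nexp nexp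
  | RAdd rexp rexp | RSub rexp rexp | RMul rexp rexp | RDiv rexp rexp

datatype bexp = NLess nexp nexp | RLess rexp rexp | BNot bexp | BAnd bexp bexp

datatype com =
    Skip
  | NAssign name nexp
  | NSet name nexp nexp nexp
  | RSet name nexp nexp rexp
  | Seq com com
  | Cond bexp com com
  | While bexp com
  | MaxFlow name name

fun nval :: "state \<Rightarrow> nexp \<Rightarrow> nat" where
  "nval \<sigma> (NConst k) = k"
| "nval \<sigma> (NVar x) = nvar \<sigma> x"
| "nval \<sigma> (NGet x i j) = narr \<sigma> x (nval \<sigma> i) (nval \<sigma> j)"
| "nval \<sigma> (NSuc e) = Suc (nval \<sigma> e)"

fun rval :: "state \<Rightarrow> rexp \<Rightarrow> real" where
  "rval \<sigma> RZero = 0"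
| "rval \<sigma> ROne = 1"
| "rval \<sigma> (RGet x i j) = rarr \<sigma> x (nval \<sigma> i) (nval \<sigma> j)"
| "rval \<sigma> (RAdd a b) = rval \<sigma> a + rval \<sigma> b"
| "rval \<sigma> (RSub a b) = rval \<sigma> a - rval \<sigma> b"
| "rval \<sigma> (RMul a b) = rval \<sigma> a * rval \<sigma> b"
| "rval \<sigma> (RDiv a b) = rval \<sigma> a / rval \<sigma> b"

fun bval :: "state \<Rightarrow> bexp \<Rightarrow> bool" where
  "bval \<sigma> (NLess a b) \<longleftrightarrow> nval \<sigma> a < nval \<sigma> b"
| "bval \<sigma> (RLess a b) \<longleftrightarrow> rval \<sigma> a < rval \<sigma> b"
| "bval \<sigma> (BNot b) \<longleftrightarrow> \<not> bval \<sigma> b"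
| "bval \<sigma> (BAnd b c) \<longleftrightarrow> bval \<sigma> b \<and> bval \<sigma> c"

definition upd2 :: "(name \<Rightarrow> nat \<Rightarrow> nat \<Rightarrow> 'a) \<Rightarrow> name \<Rightarrow> nat \<Rightarrow> nat \<Rightarrow> 'a \<Rightarrow> name \<Rightarrow> nat \<Rightarrow> nat \<Rightarrow> 'a" where
  "upd2 A x i j a = A(x := (A x)(i := (A x i)(j := a)))"

text \<open>
  The network on which a maximum flow instruction is executed: the program supplies a
  capacity matrix, while vertex set, source and sink are those of the input network.
  Only the positive matrix entries with indices in the vertex set represent edges.
\<close>

definition query :: "network \<Rightarrow> (nat \<Rightarrow> nat \<Rightarrow> real) \<Rightarrow> network" where
  "query G a = G\<lparr>edges := {(u, v). u < nv G \<and> v < nv G \<and> a u v > 0}, cap := (\<lambda>(u, v). a u v)\<rparr>"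

text \<open>
  \<open>exec F G c \<sigma> k qs \<sigma>'\<close>: started in \<open>\<sigma>\<close>, the program \<open>c\<close> terminates in \<open>\<sigma>'\<close> after executing
  \<open>k\<close> elementary instructions, and \<open>qs\<close> lists the networks on which it invoked the maximum
  flow routine \<open>F\<close>.  The network \<open>G\<close> enters through \<open>query\<close> only.
\<close>

inductive exec ::
  "(network \<Rightarrow> nat \<times> nat \<Rightarrow> real) \<Rightarrow> network \<Rightarrow> com \<Rightarrow> state \<Rightarrow> nat \<Rightarrow> network list \<Rightarrow> state \<Rightarrow> bool"
  for F :: "network \<Rightarrow> nat \<times> nat \<Rightarrow> real" and G :: network
where
  exec_Skip: "exec F G Skip \<sigma> 1 [] \<sigma>"
| exec_NAssign: "exec F G (NAssign x e) \<sigma> 1 [] (\<sigma>\<lparr>nvar := (nvar \<sigma>)(x := nval \<sigma> e)\<rparr>)"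
| exec_NSet: "exec F G (NSet x i j e) \<sigma> 1 []
    (\<sigma>\<lparr>narr := upd2 (narr \<sigma>) x (nval \<sigma> i) (nval \<sigma> j) (nval \<sigma> e)\<rparr>)"
| exec_RSet: "exec F G (RSet x i j e) \<sigma> 1 []
    (\<sigma>\<lparr>rarr := upd2 (rarr \<sigma>) x (nval \<sigma> i) (nval \<sigma> j) (rval \<sigma> e)\<rparr>)"
| exec_Seq: "exec F G c \<sigma> k qs \<sigma>' \<Longrightarrow> exec F G d \<sigma>' l rs \<sigma>'' \<Longrightarrow>
    exec F G (Seq c d) \<sigma> (k + l) (qs @ rs) \<sigma>''"
| exec_CondTrue: "bval \<sigma> b \<Longrightarrow> exec F G c \<sigma> k qs \<sigma>' \<Longrightarrow> exec F G (Cond b c d) \<sigma> (Suc k) qs \<sigma>'"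
| exec_CondFalse: "\<not> bval \<sigma> b \<Longrightarrow> exec F G d \<sigma> k qs \<sigma>' \<Longrightarrow> exec F G (Cond b c d) \<sigma> (Suc k) qs \<sigma>'"
| exec_WhileFalse: "\<not> bval \<sigma> b \<Longrightarrow> exec F G (While b c) \<sigma> 1 [] \<sigma>"
| exec_WhileTrue: "bval \<sigma> b \<Longrightarrow> exec F G c \<sigma> k qs \<sigma>' \<Longrightarrow> exec F G (While b c) \<sigma>' l rs \<sigma>'' \<Longrightarrow>
    exec F G (While b c) \<sigma> (Suc (k + l)) (qs @ rs) \<sigma>''"
| exec_MaxFlow: "exec F G (MaxFlow a f) \<sigma> 1 [query G (rarr \<sigma> a)]
    (\<sigma>\<lparr>rarr := (rarr \<sigma>)(f := (\<lambda>u v. F (query G (rarr \<sigma> a)) (u, v)))\<rparr>)"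

text \<open>
  The input is the capacity matrix \<open>c\<close> (with entry 0 for absent edges) together with \<open>n\<close>, \<open>s\<close>
  and \<open>t\<close>; all other memory cells are 0.  The output is the 0/1 matrix \<open>vital\<close>.
\<close>

definition initial_state :: "network \<Rightarrow> state" where
  "initial_state G =
     \<lparr>nvar = (\<lambda>_. 0)(''n'' := nv G, ''s'' := src G, ''t'' := snk G),
      narr = (\<lambda>_ _ _. 0),
      rarr = (\<lambda>_ _ _. 0)(''c'' := (\<lambda>u v. if (u, v) \<in> edges G then cap G (u, v) else 0))\<rparr>"

definition output_edges :: "network \<Rightarrow> state \<Rightarrow> (nat \<times> nat) set" where
  "output_edges G \<sigma> = {(u, v). u < nv G \<and> v < nv G \<and> narr \<sigma> ''vital'' u v = 1}"

end

theory Submission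
  imports Defs "HOL-Combinatorics.Transposition"
begin

text \<open>
  Fix a maximum flow with skew-symmetric net flow \<open>\<phi>\<close>.  An edge \<open>(x, y)\<close> is vital iff every
  maximum net flow \<open>\<psi>\<close> has \<open>\<psi> y x < 0\<close>, so it suffices to compute, for all pairs, the maximum
  of \<open>\<psi> y x\<close> over the maximum net flows \<open>\<psi>\<close>.  If \<open>U\<close> bounds these flows from above, then, by the
  max-flow min-cut theorem in the residual network \<open>U - \<phi>\<close>, this maximum is the smaller one of
  \<open>U y x\<close> and of \<open>r S - U x y\<close>, where \<open>r S\<close> is the least residual capacity of a set \<open>S\<close> with
  \<open>x \<in> S\<close> and \<open>y \<notin> S\<close> (here \<open>S\<close> need not separate the source from the sink).

  Directed minimum cuts for all pairs are too many, but in the spirit of Gomory-Hu and Cheng-Hu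
  trees, \<open>n - 1\<close> pairs suffice to get, for every unordered pair, a set of least residual capacity
  that separates it in either direction.  Using these sets to lower \<open>U\<close> makes one of the entries
  at \<open>(x, y)\<close> and \<open>(y, x)\<close> exact, for each pair.  Repeating this with the new \<open>U\<close> makes both exact:
  if the entry at \<open>(x, y)\<close> is exact already, then a set containing \<open>y\<close> but not \<open>x\<close> has
  residual capacity at least \<open>U x y + U y x\<close>, so cuts in the wrong direction get in the way
  only if the entry at \<open>(y, x)\<close> needs no change.
\<close>

section \<open>Network flows as skew-symmetric matrices\<close>

text \<open>A set may be used as a cut even if it does not separate source and sink, because all
  maximum flows have the same divergence at every vertex and hence the same net flow across every
  set. Residual capacities are not symmetric, so uncrossing of minimum cuts is not at hand. The
  attachment argument avoids it: it holds for every positive set function, provided that separation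
  is read without direction. The price is that the set found for a pair may point the wrong way, and
  this is what the second round repairs. An attached vertex costs two flow computations, one per
  direction, so two rounds and the initial flow stay within 1 + 4 n. The flow instruction has fixed
  terminals, so its inputs are permuted residual networks; their arcs run along edges of
  \<open>G\<close> or against them, hence number at most twice the edges. The existence of maximum
  flows is taken from the oracle, also for auxiliary networks that occur only in the proof; max-flow
  min-cut then only has to extract a cut from a given maximum flow.\<close>

definition cmat :: "network \<Rightarrow> nat \<Rightarrow> nat \<Rightarrow> real" where
  "cmat G x y = (if (x, y) \<in> edges G then cap G (x, y) else 0)"

definition cutval :: "nat \<Rightarrow> (nat \<Rightarrow> nat \<Rightarrow> real) \<Rightarrow> nat set \<Rightarrow> real" where
  "cutval n r S = (\<Sum>x\<in>S. \<Sum>y\<in>{..<n} - S. r x y)"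

definition divg :: "nat \<Rightarrow> (nat \<Rightarrow> nat \<Rightarrow> real) \<Rightarrow> nat \<Rightarrow> real" where
  "divg n \<psi> x = (\<Sum>y<n. \<psi> x y)"

definition skew :: "(nat \<Rightarrow> nat \<Rightarrow> real) \<Rightarrow> bool" where
  "skew \<psi> \<longleftrightarrow> (\<forall>x y. \<psi> x y = - \<psi> y x)"

definition net :: "(nat \<times> nat \<Rightarrow> real) \<Rightarrow> nat \<Rightarrow> nat \<Rightarrow> real" where
  "net f x y = f (x, y) - f (y, x)"

lemma skew_net: "skew (net f)"
  by (simp add: skew_def net_def)

lemma skewD: "skew \<psi> \<Longrightarrow> \<psi> x y = - \<psi> y x"
  unfolding skew_def by blast

lemma skew_add: "skew \<psi> \<Longrightarrow> skew \<eta> \<Longrightarrow> skew (\<lambda>x y. \<psi> x y + \<eta> x y)"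
  unfolding skew_def by (metis minus_add_distrib)

lemma skew_scale: "skew \<psi> \<Longrightarrow> skew (\<lambda>x y. a * \<psi> x y)"
  unfolding skew_def by (metis mult_minus_right)

lemma divg_add: "divg n (\<lambda>x y. \<psi> x y + \<eta> x y) x = divg n \<psi> x + divg n \<eta> x"
  by (simp add: divg_def sum.distrib)

lemma divg_scale: "divg n (\<lambda>x y. a * \<psi> x y) x = a * divg n \<psi> x"
  by (simp add: divg_def sum_distrib_left)

lemma cutval_diff: "cutval n (\<lambda>x y. r x y - q x y) S = cutval n r S - cutval n q S"
  by (simp add: cutval_def sum_subtractf)

lemma cutval_mono:
  assumes "S \<subseteq> {..<n}" "\<And>x y. x < n \<Longrightarrow> y < n \<Longrightarrow> r x y \<le> q x y"
  shows "cutval n r S \<le> cutval n q S"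
  unfolding cutval_def using assms by (intro sum_mono) auto

lemma cutval_ge_arc:
  assumes "S \<subseteq> {..<n}" "\<And>x y. x < n \<Longrightarrow> y < n \<Longrightarrow> 0 \<le> r x y" "x \<in> S" "y < n" "y \<notin> S"
  shows "r x y \<le> cutval n r S"
proof -
  have fin: "finite S" using assms(1) finite_subset by blast
  have "r x y \<le> (\<Sum>y\<in>{..<n} - S. r x y)"
    using assms by (intro member_le_sum) auto
  also have "\<dots> \<le> cutval n r S"
    unfolding cutval_def
    using assms fin by (intro member_le_sum[of x S "\<lambda>x. \<Sum>y\<in>{..<n} - S. r x y"]) (auto intro!: sum_nonneg)
  finally show ?thesis .
qed

lemma cutval_nonneg:
  assumes "S \<subseteq> {..<n}" "\<And>x y. x < n \<Longrightarrow> y < n \<Longrightarrow> 0 \<le> r x y"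
  shows "0 \<le> cutval n r S"
  unfolding cutval_def using assms by (intro sum_nonneg) auto

text \<open>Arcs inside \<open>S\<close> cancel in pairs. The net flow across any set is thus
  determined by divergences, which makes residual cut capacities independent of the chosen maximum
  flow.\<close>

lemma cutval_skew:
  assumes "skew \<psi>" "S \<subseteq> {..<n}"
  shows "cutval n \<psi> S = (\<Sum>x\<in>S. divg n \<psi> x)"
proof -
  have fin: "finite S" using assms(2) finite_subset by blast
  have "(\<Sum>x\<in>S. \<Sum>y\<in>S. \<psi> x y) = (\<Sum>y\<in>S. \<Sum>x\<in>S. \<psi> x y)" by (rule sum.swap)
  also have "\<dots> = (\<Sum>y\<in>S. \<Sum>x\<in>S. - \<psi> y x)"
    by (intro sum.cong refl skewD[OF assms(1)])
  also have "\<dots> = - (\<Sum>x\<in>S. \<Sum>y\<in>S. \<psi> x y)" by (simp add: sum_negf)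
  finally have z: "(\<Sum>x\<in>S. \<Sum>y\<in>S. \<psi> x y) = 0" by simp
  have "divg n \<psi> x = (\<Sum>y\<in>{..<n} - S. \<psi> x y) + (\<Sum>y\<in>S. \<psi> x y)" for x
    unfolding divg_def using assms(2) by (intro sum.subset_diff) auto
  then show ?thesis by (simp add: sum.distrib z cutval_def)
qed

lemma sum_single_source_sink:
  assumes "S \<subseteq> {..<n::nat}" "s \<in> S" "t \<notin> S"
    and "\<And>v. v < n \<Longrightarrow> v \<noteq> s \<Longrightarrow> v \<noteq> t \<Longrightarrow> d v = (0::real)"
  shows "(\<Sum>v\<in>S. d v) = d s"
proof -
  have fin: "finite S" using assms(1) finite_subset by blast
  have "(\<Sum>v\<in>S. d v) = (\<Sum>v\<in>{s}. d v)"
    using assms fin by (intro sum.mono_neutral_right) (auto simp: subset_eq)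
  then show ?thesis by simp
qed

lemma cut_capacity_cutval:
  assumes "wf_network G" "C \<subseteq> {..<nv G}"
  shows "cut_capacity G C = cutval (nv G) (cmat G) C"
proof -
  have fin: "finite C" using assms(2) finite_subset by blast
  have "cutval (nv G) (cmat G) C = (\<Sum>e\<in>C \<times> ({..<nv G} - C). cmat G (fst e) (snd e))"
    unfolding cutval_def by (subst sum.cartesian_product) (simp add: case_prod_beta)
  also have "\<dots> = (\<Sum>e\<in>{(u, v) \<in> edges G. u \<in> C \<and> v \<in> {..<nv G} - C}. cmat G (fst e) (snd e))"
    using fin by (intro sum.mono_neutral_right) (auto simp: cmat_def)
  also have "\<dots> = cut_capacity G C"
    unfolding cut_capacity_def by (intro sum.cong) (auto simp: cmat_def)
  finally show ?thesis by simp
qed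

section \<open>Flows, net flows and the amount crossing a cut\<close>

definition net_flow :: "network \<Rightarrow> (nat \<Rightarrow> nat \<Rightarrow> real) \<Rightarrow> bool" where
  "net_flow G \<psi> \<longleftrightarrow> skew \<psi> \<and> (\<forall>x<nv G. \<forall>y<nv G. \<psi> x y \<le> cmat G x y) \<and>
     (\<forall>v<nv G. v \<noteq> src G \<and> v \<noteq> snk G \<longrightarrow> divg (nv G) \<psi> v = 0)"

lemma outflow_sum:
  assumes "wf_network G" "\<And>e. e \<notin> edges G \<Longrightarrow> f e = 0"
  shows "outflow G f u = (\<Sum>v<nv G. f (u, v))" "inflow G f u = (\<Sum>v<nv G. f (v, u))"
  unfolding outflow_def inflow_def using assms
  by (auto intro!: sum.mono_neutral_left simp: wf_network_def)

lemma divg_net: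
  assumes "wf_network G" "st_flow G f"
  shows "divg (nv G) (net f) u = outflow G f u - inflow G f u"
proof -
  have z: "\<And>e. e \<notin> edges G \<Longrightarrow> f e = 0" using assms(2) unfolding st_flow_def by blast
  show ?thesis by (simp add: divg_def net_def sum_subtractf outflow_sum[OF assms(1) z])
qed

lemma net_flow_net:
  assumes "wf_network G" "st_flow G f"
  shows "net_flow G (net f)"
  unfolding net_flow_def
proof (intro conjI allI impI)
  show "skew (net f)" by (rule skew_net)
  fix x y
  show "net f x y \<le> cmat G x y"
  proof -
    have "f (x, y) \<le> cmat G x y" using assms(2) by (simp add: st_flow_def cmat_def)
    moreover have "0 \<le> f (y, x)" using assms(2) by (cases "(y, x) \<in> edges G") (auto simp: st_flow_def)
    ultimately show ?thesis by (simp add: net_def)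
  qed
next
  fix v assume "v < nv G" "v \<noteq> src G \<and> v \<noteq> snk G"
  then show "divg (nv G) (net f) v = 0"
    using assms(2) by (simp add: divg_net[OF assms] st_flow_def)
qed

text \<open>Take the positive part of \<open>\<psi>\<close> on the edges. Of two antiparallel edges
  at most one then carries flow, and off the edges \<open>\<psi>\<close> is at most 0 because
  \<open>cmat\<close> vanishes there, so nothing is lost.\<close>

lemma st_flow_of_net_flow:
  assumes wf: "wf_network G" and nf: "net_flow G \<psi>"
  obtains g where "st_flow G g" "flow_value G g = divg (nv G) \<psi> (src G)"
proof -
  define g where "g e = (if e \<in> edges G then max 0 (\<psi> (fst e) (snd e)) else 0)" for e
  have sk: "skew \<psi>" and le: "\<And>x y. x < nv G \<Longrightarrow> y < nv G \<Longrightarrow> \<psi> x y \<le> cmat G x y"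
    using nf by (auto simp: net_flow_def)
  have gz: "\<And>e. e \<notin> edges G \<Longrightarrow> g e = 0" by (simp add: g_def)
  have gv: "g (x, y) = max 0 (\<psi> x y)" if "x < nv G" "y < nv G" for x y
    using le[OF that] by (auto simp: g_def cmat_def split: if_splits)
  have gd: "outflow G g u - inflow G g u = divg (nv G) \<psi> u" if u: "u < nv G" for u
  proof -
    have "outflow G g u - inflow G g u = (\<Sum>v<nv G. g (u, v) - g (v, u))"
      by (simp add: outflow_sum[OF wf gz] sum_subtractf)
    also have "\<dots> = (\<Sum>v<nv G. \<psi> u v)"
    proof (rule sum.cong)
      fix v assume "v \<in> {..<nv G}"
      then show "g (u, v) - g (v, u) = \<psi> u v"
        using gv[of u v] gv[of v u] u skewD[OF sk, of v u] by auto
    qed simp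
    finally show ?thesis by (simp add: divg_def)
  qed
  have "st_flow G g"
    unfolding st_flow_def
  proof (intro conjI ballI allI impI)
    fix e assume e: "e \<in> edges G"
    then show "0 \<le> g e" by (simp add: g_def)
    obtain x y where xy: "e = (x, y)" by (cases e)
    then have "x < nv G" "y < nv G" using e wf by (auto simp: wf_network_def)
    moreover have "0 < cap G e" using e wf by (auto simp: wf_network_def)
    ultimately show "g e \<le> cap G e" using gv[of x y] le[of x y] e xy by (simp add: cmat_def)
  next
    fix e assume "e \<notin> edges G" then show "g e = 0" by (rule gz)
  next
    fix v assume "v < nv G" "v \<noteq> src G \<and> v \<noteq> snk G"
    then show "outflow G g v = inflow G g v"
      using gd[of v] nf by (simp add: net_flow_def)
  qed
  moreover have "flow_value G g = divg (nv G) \<psi> (src G)"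
    using gd[of "src G"] wf by (simp add: flow_value_def wf_network_def)
  ultimately show thesis by (rule that)
qed

lemma max_flow_net_flow_le:
  assumes "wf_network G" "max_flow G f" "net_flow G \<psi>"
  shows "divg (nv G) \<psi> (src G) \<le> flow_value G f"
  by (metis assms max_flow_def st_flow_of_net_flow)

lemma net_flow_cutval:
  assumes wf: "wf_network G" and nf: "net_flow G \<psi>" and C: "C \<in> st_cuts G"
  shows "cutval (nv G) \<psi> C = divg (nv G) \<psi> (src G)"
proof -
  have "cutval (nv G) \<psi> C = (\<Sum>x\<in>C. divg (nv G) \<psi> x)"
    using nf C by (intro cutval_skew) (auto simp: net_flow_def st_cuts_def)
  also have "\<dots> = divg (nv G) \<psi> (src G)"
    using nf C by (intro sum_single_source_sink[where t = "snk G" and n = "nv G"])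
      (auto simp: net_flow_def st_cuts_def)
  finally show ?thesis .
qed

text \<open>The divergences of a skew matrix sum to 0, so source and sink balance. Consequently net
  flows of equal value have equal divergence everywhere.\<close>

lemma net_flow_divg:
  assumes wf: "wf_network G" and nf: "net_flow G \<psi>" and p: "p < nv G"
  shows "divg (nv G) \<psi> p = divg (nv G) \<psi> (src G) * (of_bool (p = src G) - of_bool (p = snk G))"
proof -
  have st: "src G < nv G" "snk G < nv G" "src G \<noteq> snk G" using wf by (auto simp: wf_network_def)
  have "(\<Sum>p<nv G. divg (nv G) \<psi> p) = cutval (nv G) \<psi> {..<nv G}"
    using nf by (simp add: cutval_skew net_flow_def)
  then have tot: "(\<Sum>p<nv G. divg (nv G) \<psi> p) = 0" by (simp add: cutval_def)
  have oth: "divg (nv G) \<psi> p = 0" if "p < nv G" "p \<noteq> src G" "p \<noteq> snk G" for p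
    using nf that by (simp add: net_flow_def)
  have "(\<Sum>p<nv G. divg (nv G) \<psi> p) = (\<Sum>p\<in>{src G, snk G}. divg (nv G) \<psi> p)"
    using st oth by (intro sum.mono_neutral_right) auto
  then have "divg (nv G) \<psi> (snk G) = - divg (nv G) \<psi> (src G)" using tot st by simp
  then show ?thesis using oth[OF p] st by (cases "p = src G"; cases "p = snk G") auto
qed

section \<open>Max-flow min-cut through sets closed under residual arcs\<close>

definition res_closed :: "network \<Rightarrow> (nat \<times> nat \<Rightarrow> real) \<Rightarrow> nat set \<Rightarrow> bool" where
  "res_closed G f T \<longleftrightarrow> (\<forall>x\<in>T. \<forall>y<nv G. net f x y < cmat G x y \<longrightarrow> y \<in> T)"

definition arc :: "nat \<Rightarrow> nat \<Rightarrow> nat \<Rightarrow> nat \<Rightarrow> real" where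
  "arc x y p q = of_bool (p = x \<and> q = y) - of_bool (p = y \<and> q = x)"

lemma skew_arc: "skew (arc x y)"
  unfolding skew_def arc_def by (simp add: conj_commute)

lemma divg_arc:
  assumes "x < n" "y < n"
  shows "divg n (arc x y) p = of_bool (p = x) - of_bool (p = y)"
proof -
  have "divg n (arc x y) p = (\<Sum>q<n. of_bool (p = x \<and> q = y)) - (\<Sum>q<n. of_bool (p = y \<and> q = x))"
    by (simp add: divg_def arc_def sum_subtractf)
  moreover have "(\<Sum>q<n. of_bool (p = x \<and> q = y)) = (of_bool (p = x) :: real)"
    using assms by (cases "p = x") (simp_all add: of_bool_def)
  moreover have "(\<Sum>q<n. of_bool (p = y \<and> q = x)) = (of_bool (p = y) :: real)"
    using assms by (cases "p = y") (simp_all add: of_bool_def)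
  ultimately show ?thesis by simp
qed

text \<open>The set \<open>T\<close> in the proof consists of the vertices to which some positive amount can be
  pushed.  It is closed under residual arcs because the average of a push and a single arc
  is again feasible; hence it contains \<open>S\<close>, and no augmenting path is ever handled.\<close>

lemma max_flow_least_closed:
  assumes wf: "wf_network G" and mf: "max_flow G f"
    and S: "S \<subseteq> {..<nv G}" "src G \<in> S" "res_closed G f S"
    and least: "\<And>T. T \<subseteq> {..<nv G} \<Longrightarrow> src G \<in> T \<Longrightarrow> res_closed G f T \<Longrightarrow> S \<subseteq> T"
  shows "snk G \<notin> S" and "cutval (nv G) (cmat G) S = flow_value G f"
proof -
  let ?n = "nv G" and ?s = "src G" and ?t = "snk G"
  have fl: "st_flow G f" using mf by (simp add: max_flow_def)
  have nf: "net_flow G (net f)" by (rule net_flow_net[OF wf fl])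
  have res0: "0 \<le> cmat G p q - net f p q" if "p < ?n" "q < ?n" for p q
    using nf that by (simp add: net_flow_def)
  define push where "push \<delta> \<eta> x \<longleftrightarrow> \<delta> > 0 \<and> skew \<eta> \<and>
      (\<forall>p<?n. \<forall>q<?n. \<eta> p q \<le> cmat G p q - net f p q) \<and>
      (\<forall>p<?n. divg ?n \<eta> p = \<delta> * (of_bool (p = ?s) - of_bool (p = x)))" for \<delta> \<eta> x
  define T where "T = {x. x < ?n \<and> (\<exists>\<delta> \<eta>. push \<delta> \<eta> x)}"
  have sT: "?s \<in> T"
  proof -
    have "push 1 (\<lambda>_ _. 0) ?s" using res0 by (simp add: push_def skew_def divg_def)
    then show ?thesis using wf by (auto simp: T_def wf_network_def)
  qed
  have "res_closed G f T"
    unfolding res_closed_def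
  proof (intro ballI allI impI)
    fix x y assume x: "x \<in> T" and y: "y < ?n" and r: "net f x y < cmat G x y"
    obtain \<delta> \<eta> where p: "push \<delta> \<eta> x" using x by (auto simp: T_def)
    have xn: "x < ?n" using x by (simp add: T_def)
    have d: "\<delta> > 0" using p by (simp add: push_def)
    define \<epsilon> where "\<epsilon> = min \<delta> (cmat G x y - net f x y)"
    have e: "\<epsilon> > 0" "\<epsilon> \<le> \<delta>" "\<epsilon> \<le> cmat G x y - net f x y" using d r by (auto simp: \<epsilon>_def)
    define \<eta>' where "\<eta>' = (\<lambda>p q. \<epsilon> / \<delta> / 2 * \<eta> p q + \<epsilon> / 2 * arc x y p q)"
    have "push (\<epsilon> / 2) \<eta>' y"
      unfolding push_def
    proof (intro conjI allI impI)
      show "0 < \<epsilon> / 2" using e by simp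
      show "skew \<eta>'"
        unfolding \<eta>'_def using p by (intro skew_add skew_scale skew_arc) (simp add: push_def)
      fix a assume a: "a < ?n"
      show "divg ?n \<eta>' a = \<epsilon> / 2 * (of_bool (a = ?s) - of_bool (a = y))"
      proof -
        have "divg ?n \<eta> a = \<delta> * (of_bool (a = ?s) - of_bool (a = x))"
          using p a by (simp add: push_def)
        then show ?thesis
          using d unfolding \<eta>'_def divg_add divg_scale divg_arc[OF xn y] by auto
      qed
      fix b assume b: "b < ?n"
      have "\<epsilon> / \<delta> * \<eta> a b \<le> cmat G a b - net f a b"
      proof (cases "\<eta> a b \<ge> 0")
        case True
        have "\<epsilon> / \<delta> * \<eta> a b \<le> 1 * \<eta> a b"
          using True d e by (intro mult_right_mono) auto
        then show ?thesis using p a b by (auto simp: push_def intro: order_trans)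
      next
        case False
        then have "\<epsilon> / \<delta> * \<eta> a b \<le> 0" using d e mult_nonneg_nonpos[of "\<epsilon> / \<delta>" "\<eta> a b"] by simp
        then show ?thesis using res0[OF a b] by linarith
      qed
      moreover have "\<epsilon> * arc x y a b \<le> cmat G a b - net f a b"
      proof (cases "a = x \<and> b = y")
        case True
        then have "\<epsilon> * arc x y a b \<le> \<epsilon> * 1"
          using e(1) by (intro mult_left_mono) (simp_all add: arc_def)
        then show ?thesis using True e(3) by simp
      next
        case False
        then have "arc x y a b \<le> 0" by (auto simp: arc_def)
        then have "\<epsilon> * arc x y a b \<le> \<epsilon> * 0"
          using e(1) by (intro mult_left_mono) simp_all
        then show ?thesis using res0[OF a b] by simp
      qed
      ultimately show "\<eta>' a b \<le> cmat G a b - net f a b"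
        by (simp add: \<eta>'_def)
    qed
    then show "y \<in> T" using y by (auto simp: T_def)
  qed
  then have ST: "S \<subseteq> T" using sT by (intro least) (auto simp: T_def)
  show tS: "?t \<notin> S"
  proof
    assume "?t \<in> S"
    then obtain \<delta> \<eta> where p: "push \<delta> \<eta> ?t" using ST by (auto simp: T_def)
    have "net_flow G (\<lambda>x y. net f x y + \<eta> x y)"
      unfolding net_flow_def
    proof (intro conjI allI impI)
      show "skew (\<lambda>x y. net f x y + \<eta> x y)" using p by (simp add: push_def skew_add skew_net)
      fix v assume v: "v < ?n"
      {
        fix w assume "w < ?n"
        then have "\<eta> v w \<le> cmat G v w - net f v w" using p v by (simp add: push_def)
        then show "net f v w + \<eta> v w \<le> cmat G v w" by simp
      }
      assume "v \<noteq> ?s \<and> v \<noteq> ?t"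
      then show "divg ?n (\<lambda>x y. net f x y + \<eta> x y) v = 0"
        using v p nf by (simp add: divg_add push_def net_flow_def)
    qed
    from max_flow_net_flow_le[OF wf mf this]
    have "divg ?n (net f) ?s + divg ?n \<eta> ?s \<le> flow_value G f" by (simp add: divg_add)
    moreover have "divg ?n \<eta> ?s > 0"
      using p wf by (simp add: push_def wf_network_def)
    moreover have "divg ?n (net f) ?s = flow_value G f"
      by (simp add: divg_net[OF wf fl] flow_value_def)
    ultimately show False by simp
  qed
  have "cutval ?n (cmat G) S = cutval ?n (net f) S"
    unfolding cutval_def
  proof (intro sum.cong refl)
    fix x y assume xy: "x \<in> S" "y \<in> {..<?n} - S"
    then have "\<not> net f x y < cmat G x y" using S by (auto simp: res_closed_def)
    then show "cmat G x y = net f x y" using res0[of x y] xy S by force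
  qed
  also have "\<dots> = divg ?n (net f) ?s"
    using net_flow_cutval[OF wf nf] S tS by (auto simp: st_cuts_def)
  also have "\<dots> = flow_value G f" by (simp add: divg_net[OF wf fl] flow_value_def)
  finally show "cutval ?n (cmat G) S = flow_value G f" .
qed

text \<open>The least closed set is what the source reaches in the residual network; as an
  intersection it needs no paths. It attains the flow value, and weak duality gives the
  inequality.\<close>

lemma max_flow_min_cut:
  assumes wf: "wf_network G" and mf: "max_flow G f"
  shows "\<exists>S\<in>st_cuts G. cutval (nv G) (cmat G) S = flow_value G f"
    and "C \<in> st_cuts G \<Longrightarrow> flow_value G f \<le> cutval (nv G) (cmat G) C"
proof -
  define S where "S = \<Inter> {T. T \<subseteq> {..<nv G} \<and> src G \<in> T \<and> res_closed G f T}"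
  have V: "{..<nv G} \<in> {T. T \<subseteq> {..<nv G} \<and> src G \<in> T \<and> res_closed G f T}"
    using wf by (auto simp: res_closed_def wf_network_def)
  have S: "S \<subseteq> {..<nv G}" "src G \<in> S" using V by (auto simp: S_def)
  have cl: "res_closed G f S" unfolding S_def res_closed_def by blast
  have least: "S \<subseteq> T" if "T \<subseteq> {..<nv G}" "src G \<in> T" "res_closed G f T" for T
    using that by (auto simp: S_def)
  show "\<exists>S\<in>st_cuts G. cutval (nv G) (cmat G) S = flow_value G f"
    using max_flow_least_closed[OF wf mf S cl least] S by (auto simp: st_cuts_def)
  assume C: "C \<in> st_cuts G"
  have fl: "st_flow G f" using mf by (simp add: max_flow_def)
  have nf: "net_flow G (net f)" by (rule net_flow_net[OF wf fl])
  have "flow_value G f = cutval (nv G) (net f) C"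
    by (simp add: net_flow_cutval[OF wf nf C] divg_net[OF wf fl] flow_value_def)
  also have "\<dots> \<le> cutval (nv G) (cmat G) C"
    using nf C by (intro cutval_mono) (auto simp: net_flow_def st_cuts_def)
  finally show "flow_value G f \<le> cutval (nv G) (cmat G) C" .
qed

lemma mincut_capacity_eq:
  assumes wf: "wf_network G" and mf: "max_flow G f"
  shows "mincut_capacity G = flow_value G f"
proof -
  have eq: "cut_capacity G ` st_cuts G = cutval (nv G) (cmat G) ` st_cuts G"
    by (rule image_cong[OF refl]) (rule cut_capacity_cutval[OF wf], simp add: st_cuts_def)
  have "finite (st_cuts G)"
    by (rule finite_subset[of _ "Pow {..<nv G}"]) (auto simp: st_cuts_def)
  then show ?thesis
    unfolding mincut_capacity_def eq
    using max_flow_min_cut[OF wf mf] by (intro Min_eqI) (auto simp: image_iff Bex_def)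
qed

section \<open>Maximum flows as net flows of prescribed divergence, and their extreme values on one
  arc\<close>

definition shifted :: "nat \<Rightarrow> (nat \<Rightarrow> nat \<Rightarrow> real) \<Rightarrow> (nat \<Rightarrow> nat \<Rightarrow> real) \<Rightarrow> (nat \<Rightarrow> nat \<Rightarrow> real) set" where
  "shifted n \<phi> U = {\<psi>. skew \<psi> \<and> (\<forall>x<n. \<forall>y<n. \<psi> x y \<le> U x y) \<and> (\<forall>x<n. divg n \<psi> x = divg n \<phi> x)}"

lemma shifted_cutval:
  assumes "\<psi> \<in> shifted n \<phi> U" "skew \<phi>" "S \<subseteq> {..<n}"
  shows "cutval n (\<lambda>x y. U x y - \<phi> x y) S = cutval n (\<lambda>x y. U x y - \<psi> x y) S"
proof -
  have "cutval n \<phi> S = cutval n \<psi> S"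
    using assms by (auto simp: cutval_skew shifted_def intro!: sum.cong)
  then show ?thesis by (simp add: cutval_diff)
qed

text \<open>Measure the cut in the residual network of \<open>\<psi>\<close> itself: the arc from
  \<open>x\<close> to \<open>y\<close> alone contributes \<open>U x y + \<psi> y x\<close>, and all
  other arcs contribute nonnegative amounts.\<close>

lemma shifted_cut_bound:
  assumes "\<psi> \<in> shifted n \<phi> U" "skew \<phi>" "S \<subseteq> {..<n}" "x \<in> S" "y < n" "y \<notin> S"
  shows "\<psi> y x \<le> cutval n (\<lambda>x y. U x y - \<phi> x y) S - U x y"
proof -
  have "U x y - \<psi> x y \<le> cutval n (\<lambda>x y. U x y - \<psi> x y) S"
    using assms by (intro cutval_ge_arc[where r = "\<lambda>x y. U x y - \<psi> x y"]) (auto simp: shifted_def)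
  moreover have "\<psi> x y = - \<psi> y x" using assms(1) skewD[of \<psi> x y] by (simp add: shifted_def)
  ultimately show ?thesis using shifted_cutval[OF assms(1-3)] by simp
qed

text \<open>Converse of \<open>shifted_cut_bound\<close>: a value that no cut forbids is reached.
  The entry at \<open>(y, x)\<close> is raised along a circulation: the missing amount goes from
  \<open>x\<close> to \<open>y\<close> on other residual arcs and returns on the arc
  \<open>(y, x)\<close>. The oracle only supplies a maximum flow of an auxiliary network.\<close>

lemma shifted_push:
  assumes F: "max_flow_oracle F" and \<phi>: "\<phi> \<in> shifted n \<phi> U" and x: "x < n" and y: "y < n" and ne: "x \<noteq> y"
    and up: "\<theta> \<le> U y x"
    and cuts: "\<And>S. S \<subseteq> {..<n} \<Longrightarrow> x \<in> S \<Longrightarrow> y \<notin> S \<Longrightarrow> \<theta> \<le> cutval n (\<lambda>x y. U x y - \<phi> x y) S - U x y"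
  shows "\<exists>\<psi>\<in>shifted n \<phi> U. \<theta> \<le> \<psi> y x"
proof (cases "\<theta> \<le> \<phi> y x")
  case True
  then show ?thesis using \<phi> by blast
next
  case False
  define \<delta> where "\<delta> = \<theta> - \<phi> y x"
  have d: "\<delta> > 0" using False by (simp add: \<delta>_def)
  have sk: "skew \<phi>" and le: "\<And>p q. p < n \<Longrightarrow> q < n \<Longrightarrow> \<phi> p q \<le> U p q"
    using \<phi> by (auto simp: shifted_def)
  \<comment> \<open>Both arcs of the pair are blocked, so the rerouted flow vanishes there and the
    entry at \<open>(y, x)\<close> will be exactly \<open>\<theta>\<close>.\<close>
  define r where "r p q = (if {p, q} = {x, y} then 0 else U p q - \<phi> p q)" for p q
  have r0: "0 \<le> r p q" "r p q \<le> U p q - \<phi> p q" if "p < n" "q < n" for p q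
    using le[OF that] by (auto simp: r_def)
  define N where "N = \<lparr>nv = n, src = x, snk = y, edges = {(p, q). p < n \<and> q < n \<and> r p q > 0},
    cap = (\<lambda>(p, q). r p q)\<rparr>"
  have N [simp]: "nv N = n" "src N = x" "snk N = y" by (simp_all add: N_def)
  have wf: "wf_network N" using x y ne by (auto simp: wf_network_def N_def)
  have mf: "max_flow N (F N)" using F wf by (simp add: max_flow_oracle_def)
  then have fl: "st_flow N (F N)" by (simp add: max_flow_def)
  have cm: "cmat N p q = r p q" if "p < n" "q < n" for p q
    using r0[OF that] that by (auto simp: cmat_def N_def)
  have nf: "net_flow N (net (F N))" by (rule net_flow_net[OF wf fl])
  define \<eta> where "\<eta> = net (F N)"
  define v where "v = divg n \<eta> x"
  have ske: "skew \<eta>" by (simp add: \<eta>_def skew_net)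
  have le_r: "\<eta> p q \<le> r p q" if "p < n" "q < n" for p q
  proof -
    have "\<eta> p q \<le> cmat N p q" using nf that by (simp add: net_flow_def \<eta>_def)
    then show ?thesis by (simp add: cm[OF that])
  qed
  have v: "v = flow_value N (F N)"
    using divg_net[OF wf fl, of x] by (simp add: v_def \<eta>_def flow_value_def)
  obtain S where S: "S \<in> st_cuts N" "cutval n (cmat N) S = v"
    using max_flow_min_cut(1)[OF wf mf] v by auto
  have S': "S \<subseteq> {..<n}" "x \<in> S" "y \<notin> S" using S(1) by (auto simp: st_cuts_def)
  \<comment> \<open>Of the blocked pair only \<open>(x, y)\<close> leaves \<open>S\<close>, so
    blocking lowers this cut by exactly the residual capacity of that arc.\<close>
  have "v = cutval n (\<lambda>p q. U p q - \<phi> p q - (U x y - \<phi> x y) * of_bool (p = x \<and> q = y)) S"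
    unfolding S(2)[symmetric] cutval_def
  proof (intro sum.cong refl)
    fix p q assume "p \<in> S" "q \<in> {..<n} - S"
    then show "cmat N p q = U p q - \<phi> p q - (U x y - \<phi> x y) * of_bool (p = x \<and> q = y)"
      using cm[of p q] S' by (auto simp: r_def doubleton_eq_iff)
  qed
  also have "\<dots> = cutval n (\<lambda>p q. U p q - \<phi> p q) S -
      cutval n (\<lambda>p q. (U x y - \<phi> x y) * of_bool (p = x \<and> q = y)) S"
    by (simp add: cutval_def sum_subtractf)
  also have "cutval n (\<lambda>p q. (U x y - \<phi> x y) * of_bool (p = x \<and> q = y)) S = U x y - \<phi> x y"
  proof -
    have fin: "finite S" using S'(1) finite_subset by blast
    have "(\<Sum>q\<in>{..<n} - S. (U x y - \<phi> x y) * of_bool (p = x \<and> q = y)) =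
        (if p = x then U x y - \<phi> x y else 0)" for p
      using y S' by (cases "p = x") (simp_all add: of_bool_def if_distrib cong: if_cong)
    then show ?thesis using S' fin by (simp add: cutval_def)
  qed
  finally have "v = cutval n (\<lambda>p q. U p q - \<phi> p q) S - U x y + \<phi> x y" by simp
  then have vd: "\<delta> \<le> v" using cuts[OF S'] skewD[OF sk, of x y] by (simp add: \<delta>_def)
  have dv: "divg n \<eta> p = v * (of_bool (p = x) - of_bool (p = y))" if "p < n" for p
    using net_flow_divg[OF wf nf, of p] that by (simp add: v_def \<eta>_def)
  \<comment> \<open>Scaled to value \<open>\<delta>\<close>, the flow from \<open>x\<close> to
    \<open>y\<close> and the return arc have opposite divergences. By
    \<open>\<delta> \<le> v\<close> the scaling factor is at most 1, which preserves
    feasibility.\<close>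
  define \<psi> where "\<psi> = (\<lambda>p q. \<phi> p q + (\<delta> / v * \<eta> p q + \<delta> * arc y x p q))"
  have eta0: "\<eta> x y = 0" "\<eta> y x = 0"
  proof -
    have "\<eta> x y \<le> 0" "\<eta> y x \<le> 0" using le_r[of x y] le_r[of y x] x y by (simp_all add: r_def insert_commute)
    then show "\<eta> x y = 0" "\<eta> y x = 0" using skewD[OF ske, of x y] by auto
  qed
  have "\<psi> \<in> shifted n \<phi> U"
    unfolding shifted_def
  proof (intro CollectI conjI allI impI)
    show "skew \<psi>" unfolding \<psi>_def by (intro skew_add skew_scale skew_arc sk ske)
    fix p assume p: "p < n"
    show "divg n \<psi> p = divg n \<phi> p"
      using d vd unfolding \<psi>_def divg_add divg_scale divg_arc[OF y x] dv[OF p] by auto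
    fix q assume q: "q < n"
    show "\<psi> p q \<le> U p q"
    proof (cases "{p, q} = {x, y}")
      case True
      then consider "p = x" "q = y" | "p = y" "q = x" by (auto simp: doubleton_eq_iff)
      then show ?thesis
      proof cases
        case 1
        then have "\<psi> p q = \<phi> x y - \<delta>" using ne eta0 by (simp add: \<psi>_def arc_def)
        then show ?thesis using le[of x y] x y d 1 by simp
      next
        case 2
        then have "\<psi> p q = \<theta>" using ne eta0 by (simp add: \<psi>_def arc_def \<delta>_def)
        then show ?thesis using up 2 by simp
      qed
    next
      case False
      then have a: "arc y x p q = 0" by (auto simp: arc_def)
      have "\<delta> / v * \<eta> p q \<le> U p q - \<phi> p q"
      proof (cases "\<eta> p q \<ge> 0")
        case True
        have "\<delta> / v * \<eta> p q \<le> 1 * \<eta> p q"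
          using True d vd by (intro mult_right_mono) auto
        then show ?thesis using le_r[OF p q] r0[OF p q] by simp
      next
        case False
        then have "\<delta> / v * \<eta> p q \<le> 0" using d vd mult_nonneg_nonpos[of "\<delta> / v" "\<eta> p q"] by simp
        then show ?thesis using r0[OF p q] by linarith
      qed
      then show ?thesis by (simp add: \<psi>_def a)
    qed
  qed
  moreover have "\<psi> y x = \<theta>" using ne eta0 by (simp add: \<psi>_def arc_def \<delta>_def)
  ultimately show ?thesis by (intro bexI[of _ \<psi>]) auto
qed

section \<open>Minimum cuts separating all pairs of vertices\<close>

definition sep :: "nat set \<Rightarrow> nat \<Rightarrow> nat \<Rightarrow> bool" where
  "sep S x y \<longleftrightarrow> (x \<in> S) \<noteq> (y \<in> S)"

text \<open>Stated for an arbitrary set function, larger being better, since the attachment argument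
  uses of \<open>w\<close> only that it is positive.\<close>

definition best :: "nat \<Rightarrow> (nat set \<Rightarrow> real) \<Rightarrow> nat set \<Rightarrow> nat \<Rightarrow> nat \<Rightarrow> bool" where
  "best n w S x y \<longleftrightarrow> S \<subseteq> {..<n} \<and> sep S x y \<and> (\<forall>T\<subseteq>{..<n}. sep T x y \<longrightarrow> w T \<le> w S)"

definition best_value :: "nat \<Rightarrow> (nat set \<Rightarrow> real) \<Rightarrow> nat set set \<Rightarrow> (nat \<Rightarrow> nat \<Rightarrow> real) \<Rightarrow> bool" where
  "best_value n w D B \<longleftrightarrow> (\<forall>x<n. \<forall>y<n. (\<forall>S\<in>D. sep S x y \<longrightarrow> w S \<le> B x y) \<and>
     (B x y = 0 \<or> (\<exists>S\<in>D. sep S x y \<and> w S = B x y)))"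

lemma bestD: "best n w S x y \<Longrightarrow> T \<subseteq> {..<n} \<Longrightarrow> sep T x y \<Longrightarrow> w T \<le> w S"
  by (simp add: best_def)

lemma sep_sym: "sep S x y \<longleftrightarrow> sep S y x"
  by (auto simp: sep_def)

lemma best_sym: "best n w S x y \<longleftrightarrow> best n w S y x"
  by (simp add: best_def sep_sym)

lemma best_exists:
  assumes "x < n" "x \<noteq> y"
  shows "\<exists>S. best n w S x y"
proof -
  define A where "A = {S. S \<subseteq> {..<n} \<and> sep S x y}"
  have "finite A" unfolding A_def by (rule finite_subset[of _ "Pow {..<n}"]) auto
  moreover have "{x} \<in> A" using assms by (auto simp: A_def sep_def)
  ultimately have "finite (w ` A)" "w ` A \<noteq> {}" by auto
  then have "Max (w ` A) \<in> w ` A" "\<And>T. T \<in> A \<Longrightarrow> w T \<le> Max (w ` A)" by auto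
  then obtain S where "S \<in> A" "\<And>T. T \<in> A \<Longrightarrow> w T \<le> w S" by force
  then have "best n w S x y" by (simp add: best_def A_def)
  then show ?thesis ..
qed

text \<open>A set separating \<open>x\<close> from \<open>y\<close> separates any third vertex from one of them, so optimal
  values form an ultrametric.  Hence one cut attaches the new vertex \<open>v\<close> to the family, provided
  it separates \<open>v\<close> from an earlier vertex \<open>u\<close> that the family separates from \<open>v\<close> least well.\<close>

lemma best_family_extend:
  assumes pos: "\<And>S. S \<subseteq> {..<n} \<Longrightarrow> 0 < w S"
    and D: "D \<subseteq> Pow {..<n}" "best_value n w D B"
    and old: "\<And>x y. x < v \<Longrightarrow> y < v \<Longrightarrow> x \<noteq> y \<Longrightarrow> \<exists>S\<in>D. best n w S x y"
    and u: "u < v" "\<And>x. x < v \<Longrightarrow> B v u \<le> B v x" and v: "v < n"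
    and D': "D \<subseteq> D'" and C: "C \<in> D'" "best n w C v u"
    and x: "x < v"
  shows "\<exists>S\<in>D'. best n w S v x"
proof (cases "x = u")
  case True
  then show ?thesis using C by blast
next
  case False
  obtain T where T: "best n w T v x" using best_exists[of v n x w] v x by auto
  obtain E where E: "E \<in> D" "best n w E u x" using old[of u x] False u x by auto
  have suff: "\<exists>S\<in>D'. best n w S v x" if "S \<in> D'" "S \<subseteq> {..<n}" "sep S v x" "w T \<le> w S" for S
    using that T unfolding best_def by (meson order_trans)
  have TS: "T \<subseteq> {..<n}" "sep T v x" using T by (auto simp: best_def)
  have CS: "C \<subseteq> {..<n}" "sep C v u" using C by (auto simp: best_def)
  have ES: "E \<subseteq> {..<n}" "sep E u x" using E by (auto simp: best_def)
  \<comment> \<open>If \<open>T\<close> beats the best set for \<open>u\<close> and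
    \<open>x\<close>, it keeps these two together and so separates \<open>v\<close> from
    \<open>u\<close>. Then \<open>C\<close> is at least as good as \<open>T\<close>, hence also
    keeps \<open>u\<close> and \<open>x\<close> together.\<close>
  have fin: "\<exists>S\<in>D'. best n w S v x" if "w E < w T"
  proof -
    have "\<not> sep T u x" using bestD[OF E(2) TS(1)] that by auto
    then have "sep T v u" using TS by (auto simp: sep_def)
    then have TC: "w T \<le> w C" by (rule bestD[OF C(2) TS(1)])
    then have "\<not> sep C u x" using bestD[OF E(2) CS(1)] that by auto
    then have "sep C v x" using CS by (auto simp: sep_def)
    then show ?thesis using suff[OF C(1) CS(1) _ TC] by blast
  qed
  show ?thesis
  proof (cases "sep E v x")
    case True
    then show ?thesis using suff[of E] fin E(1) D' ES(1) by (cases "w E < w T") auto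
  next
    case False
    then have "sep E v u" using ES by (auto simp: sep_def)
    then have "w E \<le> B v u" using D(2) E(1) v u(1) by (simp add: best_value_def)
    \<comment> \<open>Here the choice of \<open>u\<close> enters: as \<open>E\<close> separates
      \<open>v\<close> from \<open>u\<close>, the family must separate \<open>v\<close> from
      \<open>x\<close> at least as well as that.\<close>
    also have "B v u \<le> B v x" using u(2) x by simp
    finally have EB: "w E \<le> B v x" .
    then have "B v x \<noteq> 0" using pos[OF ES(1)] by simp
    moreover have "B v x = 0 \<or> (\<exists>S\<in>D. sep S v x \<and> w S = B v x)"
      using D(2) v x by (simp add: best_value_def)
    ultimately obtain S where S: "S \<in> D" "sep S v x" "w S = B v x" by auto
    show ?thesis
    proof (cases "w T \<le> w S")
      case True
      then show ?thesis using suff[of S] S D' D(1) by auto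
    next
      case False
      then show ?thesis using fin EB S by simp
    qed
  qed
qed

section \<open>Upper bounds for maximum flows and when they are attained\<close>

definition valid_bound :: "nat \<Rightarrow> (nat \<Rightarrow> nat \<Rightarrow> real) \<Rightarrow> (nat \<Rightarrow> nat \<Rightarrow> real) \<Rightarrow> (nat \<Rightarrow> nat \<Rightarrow> real) \<Rightarrow> bool" where
  "valid_bound n \<phi> c U \<longleftrightarrow> (\<forall>x<n. \<forall>y<n. U x y \<le> c x y) \<and>
     (\<forall>\<psi>\<in>shifted n \<phi> c. \<forall>x<n. \<forall>y<n. \<psi> x y \<le> U x y)"

text \<open>Lowering the bounds loses no maximum flow, so they can replace the capacities in the
  next round.\<close>

lemma valid_bound_shifted: "valid_bound n \<phi> c U \<Longrightarrow> shifted n \<phi> U = shifted n \<phi> c"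
  unfolding valid_bound_def shifted_def by (auto 0 3 intro: order_trans)

lemma valid_bound_refl: "valid_bound n \<phi> c c"
  by (simp add: valid_bound_def shifted_def)

text \<open>The guarantee of one round. All its cuts are measured by the bounds \<open>U\<close>
  from its start. The set found for a pair may point in either direction, and its bound is applied
  to every arc entering it.\<close>

definition tightens :: "nat \<Rightarrow> (nat \<Rightarrow> nat \<Rightarrow> real) \<Rightarrow> (nat \<Rightarrow> nat \<Rightarrow> real) \<Rightarrow> (nat \<Rightarrow> nat \<Rightarrow> real) \<Rightarrow> (nat \<Rightarrow> nat \<Rightarrow> real) \<Rightarrow> bool" where
  "tightens n \<phi> c U U' \<longleftrightarrow> valid_bound n \<phi> c U' \<and> (\<forall>x<n. \<forall>y<n. U' x y \<le> U x y) \<and>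
     (\<forall>x<n. \<forall>y<n. x \<noteq> y \<longrightarrow> (\<exists>S\<subseteq>{..<n}. sep S x y \<and>
        (\<forall>T\<subseteq>{..<n}. sep T x y \<longrightarrow>
           cutval n (\<lambda>x y. U x y - \<phi> x y) S \<le> cutval n (\<lambda>x y. U x y - \<phi> x y) T) \<and>
        (\<forall>a\<in>S. \<forall>b<n. b \<notin> S \<longrightarrow> U' b a \<le> cutval n (\<lambda>x y. U x y - \<phi> x y) S - U a b)))"

text \<open>For a valid bound, the entry is then the maximum over all maximum net flows; validity
  supplies the reverse inequality.\<close>

definition exact :: "nat \<Rightarrow> (nat \<Rightarrow> nat \<Rightarrow> real) \<Rightarrow> (nat \<Rightarrow> nat \<Rightarrow> real) \<Rightarrow> (nat \<Rightarrow> nat \<Rightarrow> real) \<Rightarrow> nat \<Rightarrow> nat \<Rightarrow> bool" where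
  "exact n \<phi> c U x y \<longleftrightarrow> (\<exists>\<psi>\<in>shifted n \<phi> c. U x y \<le> \<psi> x y)"

lemma exact_of_cuts:
  assumes F: "max_flow_oracle F" and \<phi>: "\<phi> \<in> shifted n \<phi> c" and U: "valid_bound n \<phi> c U"
    and xy: "x < n" "y < n" "x \<noteq> y" and up: "U' y x \<le> U y x"
    and cuts: "\<And>S. S \<subseteq> {..<n} \<Longrightarrow> x \<in> S \<Longrightarrow> y \<notin> S \<Longrightarrow>
      U' y x \<le> cutval n (\<lambda>x y. U x y - \<phi> x y) S - U x y"
  shows "exact n \<phi> c U' y x"
  unfolding exact_def
  using shifted_push[OF F, where \<theta> = "U' y x", of \<phi> n U x y] \<phi> valid_bound_shifted[OF U] xy up cuts
  by simp

text \<open>A cheapest separator is cheapest among the cuts of its own direction, so its bound there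
  is the strictest of all cut bounds. The rule exposes the set and its minimality because the second
  round needs them when the direction is wrong.\<close>

lemma tightens_exact_or:
  assumes F: "max_flow_oracle F" and \<phi>: "\<phi> \<in> shifted n \<phi> c" and U: "valid_bound n \<phi> c U"
    and T: "tightens n \<phi> c U U'" and xy: "x < n" "y < n" "x \<noteq> y"
  obtains S where "S \<subseteq> {..<n}" "x \<in> S" "y \<notin> S" "exact n \<phi> c U' y x"
      "\<And>T. T \<subseteq> {..<n} \<Longrightarrow> sep T x y \<Longrightarrow>
         cutval n (\<lambda>x y. U x y - \<phi> x y) S \<le> cutval n (\<lambda>x y. U x y - \<phi> x y) T"
    | S where "S \<subseteq> {..<n}" "y \<in> S" "x \<notin> S" "exact n \<phi> c U' x y"
      "\<And>T. T \<subseteq> {..<n} \<Longrightarrow> sep T x y \<Longrightarrow>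
         cutval n (\<lambda>x y. U x y - \<phi> x y) S \<le> cutval n (\<lambda>x y. U x y - \<phi> x y) T"
proof -
  let ?c = "cutval n (\<lambda>x y. U x y - \<phi> x y)"
  have le: "U' a b \<le> U a b" if "a < n" "b < n" for a b
    using T that by (simp add: tightens_def)
  have "\<exists>S\<subseteq>{..<n}. sep S x y \<and> (\<forall>T\<subseteq>{..<n}. sep T x y \<longrightarrow> ?c S \<le> ?c T) \<and>
      (\<forall>a\<in>S. \<forall>b<n. b \<notin> S \<longrightarrow> U' b a \<le> ?c S - U a b)"
    using T xy by (simp add: tightens_def)
  then obtain S where h: "S \<subseteq> {..<n} \<and> sep S x y \<and> (\<forall>T\<subseteq>{..<n}. sep T x y \<longrightarrow> ?c S \<le> ?c T) \<and>
      (\<forall>a\<in>S. \<forall>b<n. b \<notin> S \<longrightarrow> U' b a \<le> ?c S - U a b)" ..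
  then have S: "S \<subseteq> {..<n}" "sep S x y" by simp_all
  have min: "?c S \<le> ?c T" if "T \<subseteq> {..<n}" "sep T x y" for T
    using h that by simp
  have upd: "U' b a \<le> ?c S - U a b" if "a \<in> S" "b < n" "b \<notin> S" for a b
    using h that by simp
  have ex: "exact n \<phi> c U' b a"
    if ab: "a \<in> S" "b \<notin> S" "{a, b} = {x, y}" for a b
  proof (rule exact_of_cuts[OF F \<phi> U])
    show "a < n" "b < n" "a \<noteq> b" using that xy by (auto simp: doubleton_eq_iff)
    then show "U' b a \<le> U b a" by (simp add: le)
    fix T assume T: "T \<subseteq> {..<n}" "a \<in> T" "b \<notin> T"
    then have "sep T x y" using that(3) by (auto simp: sep_def doubleton_eq_iff)
    then show "U' b a \<le> ?c T - U a b" using min[OF T(1)] upd[OF ab(1) \<open>b < n\<close> ab(2)] by simp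
  qed
  show thesis
  proof (cases "x \<in> S")
    case True
    then have "y \<notin> S" using S(2) by (simp add: sep_def)
    then show thesis using that(1)[OF S(1) True _ ex[OF True] min] by simp
  next
    case False
    then have "y \<in> S" using S(2) by (simp add: sep_def)
    then show thesis using that(2)[OF S(1) _ False ex[OF _ False] min] by (simp add: insert_commute)
  qed
qed

text \<open>Suppose the first round is exact at \<open>(x, y)\<close>, witnessed by \<open>\<psi>\<close>, and the second round finds a
  minimum cut from \<open>y\<close> to \<open>x\<close>.  Its value is at least the residual capacity \<open>U y x + U x y\<close>
  of the arc \<open>(y, x)\<close> with respect to \<open>\<psi>\<close>, so no cut forces the entry of \<open>U\<close> at \<open>(y, x)\<close> to decrease.\<close>

lemma two_rounds_exact:
  assumes F: "max_flow_oracle F" and \<phi>: "\<phi> \<in> shifted n \<phi> c"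
    and T1: "tightens n \<phi> c c U" and T2: "tightens n \<phi> c U U'"
    and xy: "x < n" "y < n" "x \<noteq> y"
  shows "exact n \<phi> c U' y x"
proof -
  let ?c = "cutval n (\<lambda>x y. U x y - \<phi> x y)"
  have U: "valid_bound n \<phi> c U" using T1 by (simp add: tightens_def)
  have le: "U' a b \<le> U a b" if "a < n" "b < n" for a b
    using T2 that by (simp add: tightens_def)
  have sk: "skew \<phi>" using \<phi> by (simp add: shifted_def)
  have or: "exact n \<phi> c U y x \<or> exact n \<phi> c U x y"
    by (rule tightens_exact_or[OF F \<phi> valid_bound_refl T1 xy]) auto
  show ?thesis
  proof (cases "exact n \<phi> c U y x")
    case True
    then show ?thesis using le[of y x] xy by (auto simp: exact_def intro: order_trans)
  next
    case False
    then obtain \<psi> where p: "\<psi> \<in> shifted n \<phi> c" "U x y \<le> \<psi> x y" using or by (auto simp: exact_def)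
    have p': "\<psi> \<in> shifted n \<phi> U" using p valid_bound_shifted[OF U] by simp
    from T2 show ?thesis
    proof (cases rule: tightens_exact_or[OF F \<phi> U _ xy, consumes 1])
      case (1 S)
      then show ?thesis by simp
    next
      case (2 S)
      have "\<psi> x y \<le> ?c S - U y x"
        using shifted_cut_bound[OF p' sk 2(1), of y x] 2 xy by simp
      then have c: "U y x + U x y \<le> ?c S" using p by simp
      show ?thesis
      proof (rule exact_of_cuts[OF F \<phi> U xy])
        show "U' y x \<le> U y x" using le xy by simp
        fix T assume T: "T \<subseteq> {..<n}" "x \<in> T" "y \<notin> T"
        then have "?c S \<le> ?c T" using 2(5)[of T] by (simp add: sep_def)
        then show "U' y x \<le> ?c T - U x y" using c le[of y x] xy by simp
      qed
    qed
  qed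
qed

section \<open>Vital edges and the sign of exact bounds\<close>

lemma wf_delete_edge: "wf_network G \<Longrightarrow> wf_network (delete_edge G e)"
  by (auto simp: wf_network_def delete_edge_def)

lemma delete_edge_simps [simp]: "nv (delete_edge G e) = nv G" "src (delete_edge G e) = src G"
  "snk (delete_edge G e) = snk G"
  by (simp_all add: delete_edge_def)

lemma cmat_delete_edge: "cmat (delete_edge G e) x y = (if (x, y) = e then 0 else cmat G x y)"
  by (auto simp: cmat_def delete_edge_def)

lemma cmat_nonneg: "wf_network G \<Longrightarrow> 0 \<le> cmat G x y"
  by (auto simp: cmat_def wf_network_def less_imp_le)

lemma max_flow_shifted:
  assumes "wf_network G" "max_flow G f"
  shows "net f \<in> shifted (nv G) (net f) (cmat G)"
  using net_flow_net[of G f] assms by (simp add: shifted_def net_flow_def max_flow_def)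

text \<open>A maximum net flow with \<open>\<psi> x y \<le> 0\<close> needs no capacity on the edge
  and survives its deletion. Conversely, a maximum flow that avoids the edge has nonpositive net
  flow from \<open>x\<close> to \<open>y\<close>.\<close>

lemma vital_edge_iff:
  assumes F: "max_flow_oracle F" and wf: "wf_network G" and mf: "max_flow G f"
    and xy: "x < nv G" "y < nv G"
  shows "(x, y) \<in> vital_edges G \<longleftrightarrow> (\<forall>\<psi>\<in>shifted (nv G) (net f) (cmat G). \<psi> y x < 0)"
proof -
  let ?G = "delete_edge G (x, y)" and ?n = "nv G" and ?\<phi> = "net f"
  have wf': "wf_network ?G" using wf by (rule wf_delete_edge)
  have mf': "max_flow ?G (F ?G)" using F wf' by (simp add: max_flow_oracle_def)
  have fl: "st_flow G f" using mf by (simp add: max_flow_def)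
  have fl': "st_flow ?G (F ?G)" using mf' by (simp add: max_flow_def)
  have nf: "net_flow G ?\<phi>" by (rule net_flow_net[OF wf fl])
  have nf': "net_flow ?G (net (F ?G))" by (rule net_flow_net[OF wf' fl'])
  have m: "mincut_capacity G = flow_value G f" by (rule mincut_capacity_eq[OF wf mf])
  have m': "mincut_capacity ?G = flow_value ?G (F ?G)" by (rule mincut_capacity_eq[OF wf' mf'])
  have val: "divg ?n ?\<phi> (src G) = flow_value G f"
    by (simp add: divg_net[OF wf fl] flow_value_def)
  have val': "divg ?n (net (F ?G)) (src G) = flow_value ?G (F ?G)"
    using divg_net[OF wf' fl', of "src G"] by (simp add: flow_value_def)
  have s: "src G < ?n" using wf by (simp add: wf_network_def)
  have \<phi>: "?\<phi> \<in> shifted ?n ?\<phi> (cmat G)" by (rule max_flow_shifted[OF wf mf])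
  show ?thesis
  proof
    assume v: "(x, y) \<in> vital_edges G"
    show "\<forall>\<psi>\<in>shifted ?n ?\<phi> (cmat G). \<psi> y x < 0"
    proof (rule ballI, rule ccontr)
      fix \<psi> assume p: "\<psi> \<in> shifted ?n ?\<phi> (cmat G)" and "\<not> \<psi> y x < 0"
      then have le: "\<psi> x y \<le> 0" using skewD[of \<psi> x y] by (simp add: shifted_def)
      have "net_flow ?G \<psi>"
        using p nf le by (auto simp: net_flow_def shifted_def cmat_delete_edge)
      from max_flow_net_flow_le[OF wf' mf' this]
      have "divg ?n \<psi> (src G) \<le> mincut_capacity ?G" by (simp add: m')
      moreover have "divg ?n \<psi> (src G) = mincut_capacity G"
        using p s by (simp add: shifted_def val m)
      ultimately show False using v by (simp add: vital_edges_def)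
    qed
  next
    assume neg: "\<forall>\<psi>\<in>shifted ?n ?\<phi> (cmat G). \<psi> y x < 0"
    show "(x, y) \<in> vital_edges G"
    proof (rule ccontr)
      assume nv: "(x, y) \<notin> vital_edges G"
      have "?\<phi> y x < 0" using neg \<phi> by blast
      then have "0 < ?\<phi> x y" using skewD[OF skew_net, of f x y] by simp
      also have "\<dots> \<le> cmat G x y" using \<phi> xy by (simp add: shifted_def)
      finally have "(x, y) \<in> edges G" by (auto simp: cmat_def split: if_splits)
      then have ge: "flow_value G f \<le> divg ?n (net (F ?G)) (src G)"
        using nv by (simp add: vital_edges_def m m' val')
      have nfG: "net_flow G (net (F ?G))"
        using nf' cmat_nonneg[OF wf, of x y] unfolding net_flow_def
        by (auto simp: cmat_delete_edge split: if_splits intro: order_trans)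
      have eq: "divg ?n (net (F ?G)) (src G) = divg ?n ?\<phi> (src G)"
        using ge max_flow_net_flow_le[OF wf mf nfG] val by simp
      \<comment> \<open>Equal value forces equal divergence at every vertex, so the flow without the
        edge is maximum in \<open>G\<close> as well.\<close>
      have "net (F ?G) \<in> shifted ?n ?\<phi> (cmat G)"
        using nfG unfolding shifted_def
        by (auto simp: net_flow_divg[OF wf nfG] net_flow_divg[OF wf nf] eq) (auto simp: net_flow_def)
      then have "net (F ?G) y x < 0" using neg by blast
      moreover have "F ?G (x, y) = 0" using fl' by (simp add: st_flow_def delete_edge_def)
      moreover have "0 \<le> F ?G (y, x)"
        using fl' by (cases "(y, x) \<in> edges ?G") (auto simp: st_flow_def)
      ultimately show False by (simp add: net_def)
    qed
  qed
qed

lemma vital_edge_iff_bound: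
  assumes F: "max_flow_oracle F" and wf: "wf_network G" and mf: "max_flow G f"
    and T1: "tightens (nv G) (net f) (cmat G) (cmat G) U"
    and T2: "tightens (nv G) (net f) (cmat G) U U'"
    and xy: "x < nv G" "y < nv G"
  shows "(x, y) \<in> vital_edges G \<longleftrightarrow> U' y x < 0"
proof -
  have \<phi>: "net f \<in> shifted (nv G) (net f) (cmat G)" by (rule max_flow_shifted[OF wf mf])
  have ub: "\<psi> y x \<le> U' y x" if "\<psi> \<in> shifted (nv G) (net f) (cmat G)" for \<psi>
    using T2 that xy by (simp add: tightens_def valid_bound_def)
  show ?thesis
  proof (cases "x = y")
    case True
    then have "net f y x = 0" by (simp add: net_def)
    then show ?thesis using ub[OF \<phi>] \<phi> unfolding vital_edge_iff[OF F wf mf xy]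
      by (metis less_irrefl not_le)
  next
    case False
    then obtain \<psi> where "\<psi> \<in> shifted (nv G) (net f) (cmat G)" "U' y x \<le> \<psi> y x"
      using two_rounds_exact[OF F \<phi> T1 T2 xy] by (auto simp: exact_def)
    then show ?thesis using ub unfolding vital_edge_iff[OF F wf mf xy]
      by (meson le_less_trans)
  qed
qed

section \<open>Families of cuts and their traces in two matrices\<close>

lemma cutval_cong:
  assumes "S \<subseteq> {..<n}" "\<And>x y. x < n \<Longrightarrow> y < n \<Longrightarrow> r x y = q x y"
  shows "cutval n r S = cutval n q S"
  unfolding cutval_def using assms by (intro sum.cong refl) auto

lemma cutval_reindex:
  assumes bij: "bij_betw \<pi> {..<n} {..<n}" and X: "X \<subseteq> {..<n}"
  shows "cutval n (\<lambda>x y. r (\<pi> x) (\<pi> y)) X = cutval n r (\<pi> ` X)"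
proof -
  have inj: "inj_on \<pi> {..<n}" and img: "\<pi> ` {..<n} = {..<n}"
    using bij by (simp_all add: bij_betw_def)
  have compl: "{..<n} - \<pi> ` X = \<pi> ` ({..<n} - X)"
    using inj_on_image_set_diff[OF inj, of "{..<n}" X] X img by simp
  have "cutval n r (\<pi> ` X) = (\<Sum>x\<in>X. \<Sum>y\<in>\<pi> ` ({..<n} - X). r (\<pi> x) y)"
    unfolding cutval_def compl by (subst sum.reindex) (use inj_on_subset[OF inj X] in auto)
  also have "\<dots> = cutval n (\<lambda>x y. r (\<pi> x) (\<pi> y)) X"
    unfolding cutval_def by (subst sum.reindex) (use inj_on_subset[OF inj] in auto)
  finally show ?thesis by simp
qed

text \<open>A decreasing function of the cut value, so that the initial entry 0 of \<open>B\<close> in \<^const>\<open>best_value\<close>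
  can stand for a pair that no set has separated so far.\<close>

definition quality :: "nat \<Rightarrow> (nat \<Rightarrow> nat \<Rightarrow> real) \<Rightarrow> nat set \<Rightarrow> real" where
  "quality n r S = 1 / (1 + cutval n r S)"

text \<open>\<open>D\<close> is a ghost: the program does not keep the cuts found so far, only their
  traces \<open>U'\<close> and \<open>B\<close>. Residual capacities refer to \<open>U\<close>,
  frozen for the round.\<close>

definition family_bounds :: "nat \<Rightarrow> (nat \<Rightarrow> nat \<Rightarrow> real) \<Rightarrow> (nat \<Rightarrow> nat \<Rightarrow> real) \<Rightarrow> (nat \<Rightarrow> nat \<Rightarrow> real) \<Rightarrow>
    nat set set \<Rightarrow> (nat \<Rightarrow> nat \<Rightarrow> real) \<Rightarrow> (nat \<Rightarrow> nat \<Rightarrow> real) \<Rightarrow> bool" where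
  "family_bounds n \<phi> c U D U' B \<longleftrightarrow> D \<subseteq> Pow {..<n} \<and>
     best_value n (quality n (\<lambda>x y. U x y - \<phi> x y)) D B \<and> valid_bound n \<phi> c U' \<and>
     (\<forall>x<n. \<forall>y<n. U' x y \<le> U x y) \<and>
     (\<forall>S\<in>D. \<forall>a\<in>S. \<forall>b<n. b \<notin> S \<longrightarrow> U' b a \<le> cutval n (\<lambda>x y. U x y - \<phi> x y) S - U a b)"

text \<open>The equations for \<open>U2\<close> and \<open>B2\<close> are the effect of recording
  one more set. Validity persists by \<open>shifted_cut_bound\<close>, which holds for every set and
  not just for minimum cuts.\<close>

lemma family_bounds_insert:
  assumes fam: "family_bounds n \<phi> c U D U1 B1" and \<phi>: "\<phi> \<in> shifted n \<phi> c" and U: "valid_bound n \<phi> c U"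
    and S: "S \<subseteq> {..<n}"
  defines "w \<equiv> cutval n (\<lambda>x y. U x y - \<phi> x y) S"
  assumes U2: "\<And>x y. x < n \<Longrightarrow> y < n \<Longrightarrow>
      U2 x y = (if x \<notin> S \<and> y \<in> S then min (U1 x y) (w - U y x) else U1 x y)"
    and B2: "\<And>x y. x < n \<Longrightarrow> y < n \<Longrightarrow> B2 x y = (if sep S x y then max (B1 x y) (1 / (1 + w)) else B1 x y)"
  shows "family_bounds n \<phi> c U (insert S D) U2 B2"
proof -
  let ?r = "\<lambda>x y. U x y - \<phi> x y"
  let ?q = "quality n ?r"
  have sk: "skew \<phi>" using \<phi> by (simp add: shifted_def)
  have r0: "0 \<le> ?r x y" if "x < n" "y < n" for x y
    using U \<phi> that by (simp add: valid_bound_def)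
  have "0 \<le> w" unfolding w_def by (rule cutval_nonneg[OF S r0])
  then have qS: "?q S = 1 / (1 + w)" "0 < 1 / (1 + w)" by (simp_all add: quality_def w_def)
  have le: "U2 x y \<le> U1 x y" if "x < n" "y < n" for x y using U2[OF that] by simp
  have "best_value n ?q (insert S D) B2"
    unfolding best_value_def
  proof (intro allI impI conjI ballI)
    fix x y assume xy: "x < n" "y < n"
    have old: "\<And>T. T \<in> D \<Longrightarrow> sep T x y \<Longrightarrow> ?q T \<le> B1 x y"
        "B1 x y = 0 \<or> (\<exists>T\<in>D. sep T x y \<and> ?q T = B1 x y)"
      using fam xy by (auto simp: family_bounds_def best_value_def)
    {
      fix T assume "T \<in> insert S D" "sep T x y"
      then show "?q T \<le> B2 x y" using old(1)[of T] B2[OF xy] qS by (auto intro: max.coboundedI1)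
    }
    show "B2 x y = 0 \<or> (\<exists>T\<in>insert S D. sep T x y \<and> ?q T = B2 x y)"
    proof (cases "sep S x y \<and> B1 x y < 1 / (1 + w)")
      case True
      then have "B2 x y = ?q S" using B2[OF xy] qS by simp
      then show ?thesis using True by auto
    next
      case False
      then have "B2 x y = B1 x y" using B2[OF xy] by auto
      then show ?thesis using old(2) by auto
    qed
  qed
  moreover have "valid_bound n \<phi> c U2"
    unfolding valid_bound_def
  proof (intro conjI allI impI ballI)
    fix x y assume xy: "x < n" "y < n"
    have "U1 x y \<le> c x y" using fam xy by (simp add: family_bounds_def valid_bound_def)
    then show "U2 x y \<le> c x y" using le[OF xy] by simp
    fix \<psi> assume p: "\<psi> \<in> shifted n \<phi> c"
    have "\<psi> x y \<le> U1 x y" using fam xy p by (simp add: family_bounds_def valid_bound_def)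
    moreover have "\<psi> x y \<le> w - U y x" if "x \<notin> S" "y \<in> S"
      unfolding w_def using shifted_cut_bound[OF _ sk S that(2) xy(1) that(1)] p valid_bound_shifted[OF U] by simp
    ultimately show "\<psi> x y \<le> U2 x y" using U2[OF xy] by simp
  qed
  moreover have "U2 x y \<le> U x y" if "x < n" "y < n" for x y
    using fam le[OF that] that by (auto simp: family_bounds_def intro: order_trans)
  moreover have "U2 b a \<le> cutval n ?r T - U a b" if T: "T \<in> insert S D" and ab: "a \<in> T" "b < n" "b \<notin> T" for T a b
  proof -
    have "T \<subseteq> {..<n}" using T S fam by (auto simp: family_bounds_def)
    then have a: "a < n" using ab by auto
    show ?thesis
    proof (cases "T = S")
      case True
      then show ?thesis using U2[OF ab(2) a] ab by (simp add: w_def)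
    next
      case False
      then have "U1 b a \<le> cutval n ?r T - U a b" using fam T ab by (simp add: family_bounds_def)
      then show ?thesis using le[OF ab(2) a] by simp
    qed
  qed
  ultimately show ?thesis using fam S by (simp add: family_bounds_def)
qed

lemma quality_le_iff:
  assumes "\<And>x y. x < n \<Longrightarrow> y < n \<Longrightarrow> 0 \<le> r x y" "S \<subseteq> {..<n}" "T \<subseteq> {..<n}"
  shows "quality n r T \<le> quality n r S \<longleftrightarrow> cutval n r S \<le> cutval n r T"
proof -
  have "0 \<le> cutval n r S" "0 \<le> cutval n r T"
    by (rule cutval_nonneg[OF assms(2,1)], assumption+) (rule cutval_nonneg[OF assms(3,1)], assumption+)
  then show ?thesis by (simp add: quality_def inverse_eq_divide[symmetric])
qed

definition min_cut :: "nat \<Rightarrow> (nat \<Rightarrow> nat \<Rightarrow> real) \<Rightarrow> nat \<Rightarrow> nat \<Rightarrow> nat set \<Rightarrow> bool" where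
  "min_cut n r p q S \<longleftrightarrow> S \<subseteq> {..<n} \<and> p \<in> S \<and> q \<notin> S \<and>
     (\<forall>T\<subseteq>{..<n}. p \<in> T \<longrightarrow> q \<notin> T \<longrightarrow> cutval n r S \<le> cutval n r T)"

lemma min_cutD:
  assumes "min_cut n r p q S"
  shows "S \<subseteq> {..<n}" "p \<in> S" "q \<notin> S"
    and "T \<subseteq> {..<n} \<Longrightarrow> p \<in> T \<Longrightarrow> q \<notin> T \<Longrightarrow> cutval n r S \<le> cutval n r T"
  using assms by (simp_all add: min_cut_def)

text \<open>The cheaper of the two directed minimum cuts is optimal for the unordered pair. This is
  why a pair costs two flow computations.\<close>

lemma best_of_two:
  assumes r: "\<And>x y. x < n \<Longrightarrow> y < n \<Longrightarrow> 0 \<le> r x y"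
    and min: "min_cut n r x y S" "min_cut n r y x S'"
  shows "best n (quality n r) S x y \<or> best n (quality n r) S' x y"
proof -
  note S = min_cutD[OF min(1)] and S' = min_cutD[OF min(2)]
  show ?thesis
  proof (cases "cutval n r S \<le> cutval n r S'")
    case True
    have "cutval n r S \<le> cutval n r T" if "T \<subseteq> {..<n}" "sep T x y" for T
      using S(4)[of T] S'(4)[of T] that True by (cases "x \<in> T") (auto simp: sep_def)
    then have "best n (quality n r) S x y"
      using S(1-3) by (simp add: best_def sep_def quality_le_iff[OF r])
    then show ?thesis ..
  next
    case False
    have "cutval n r S' \<le> cutval n r T" if "T \<subseteq> {..<n}" "sep T x y" for T
      using S(4)[of T] S'(4)[of T] that False by (cases "x \<in> T") (auto simp: sep_def)
    then have "best n (quality n r) S' x y"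
      using S'(1-3) by (simp add: best_def sep_def quality_le_iff[OF r])
    then show ?thesis ..
  qed
qed

lemma family_bounds_tightens:
  assumes fam: "family_bounds n \<phi> c U D U' B" and \<phi>: "\<phi> \<in> shifted n \<phi> c" and U: "valid_bound n \<phi> c U"
    and all: "\<And>x y. x < n \<Longrightarrow> y < n \<Longrightarrow> x \<noteq> y \<Longrightarrow> \<exists>S\<in>D. best n (quality n (\<lambda>x y. U x y - \<phi> x y)) S x y"
  shows "tightens n \<phi> c U U'"
  unfolding tightens_def
proof (intro conjI allI impI)
  let ?r = "\<lambda>x y. U x y - \<phi> x y"
  have r0: "0 \<le> ?r x y" if "x < n" "y < n" for x y
    using U \<phi> that by (simp add: valid_bound_def)
  show "valid_bound n \<phi> c U'" using fam by (simp add: family_bounds_def)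
  fix x y assume xy: "x < n" "y < n"
  show "U' x y \<le> U x y" using fam xy by (simp add: family_bounds_def)
  assume "x \<noteq> y"
  then obtain S where S: "S \<in> D" "best n (quality n ?r) S x y" using all xy by blast
  have "S \<subseteq> {..<n}" "sep S x y" using S by (simp_all add: best_def)
  moreover have "cutval n ?r S \<le> cutval n ?r T" if "T \<subseteq> {..<n}" "sep T x y" for T
    using bestD[OF S(2) that] quality_le_iff[where r = ?r, OF r0 \<open>S \<subseteq> {..<n}\<close> that(1)] by simp
  moreover have "U' b a \<le> cutval n ?r S - U a b" if "a \<in> S" "b < n" "b \<notin> S" for a b
    using fam S(1) that by (simp add: family_bounds_def)
  ultimately show "\<exists>S\<subseteq>{..<n}. sep S x y \<and>
        (\<forall>T\<subseteq>{..<n}. sep T x y \<longrightarrow> cutval n ?r S \<le> cutval n ?r T) \<and>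
        (\<forall>a\<in>S. \<forall>b<n. b \<notin> S \<longrightarrow> U' b a \<le> cutval n ?r S - U a b)"
    by (intro exI[of _ S]) simp
qed

section \<open>Reasoning about the machine\<close>

text \<open>Scalars and both kinds of arrays are framed together, so a single set of names
  suffices.\<close>

fun mods :: "com \<Rightarrow> name set" where
  "mods Skip = {}"
| "mods (NAssign x e) = {x}"
| "mods (NSet x i j e) = {x}"
| "mods (RSet x i j e) = {x}"
| "mods (Seq c d) = mods c \<union> mods d"
| "mods (Cond b c d) = mods c \<union> mods d"
| "mods (While b c) = mods c"
| "mods (MaxFlow a f) = {f}"

definition agree :: "name set \<Rightarrow> state \<Rightarrow> state \<Rightarrow> bool" where
  "agree M \<sigma> \<sigma>' \<longleftrightarrow>
     (\<forall>x. x \<notin> M \<longrightarrow> nvar \<sigma>' x = nvar \<sigma> x \<and> narr \<sigma>' x = narr \<sigma> x \<and> rarr \<sigma>' x = rarr \<sigma> x)"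

lemma agree_refl [simp]: "agree M \<sigma> \<sigma>"
  by (simp add: agree_def)

lemma agree_mono: "agree M \<sigma> \<sigma>' \<Longrightarrow> M \<subseteq> M' \<Longrightarrow> agree M' \<sigma> \<sigma>'"
  by (auto simp: agree_def)

lemma exec_agree: "exec F G c \<sigma> k qs \<sigma>' \<Longrightarrow> agree (mods c) \<sigma> \<sigma>'"
  by (induction rule: exec.induct) (auto simp: agree_def upd2_def)

definition For :: "name \<Rightarrow> name \<Rightarrow> com \<Rightarrow> com" where
  "For x y c = Seq (NAssign x (NConst 0))
     (While (NLess (NVar x) (NVar y)) (Seq c (NAssign x (NSuc (NVar x)))))"

lemma mods_For [simp]: "mods (For x y c) = insert x (mods c)"
  by (auto simp: For_def)

text \<open>Code without loops and flow instructions gets an evaluator \<open>sem\<close> and a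
  syntactic bound \<open>cost\<close>, so innermost loop bodies can be verified by
  simplification.\<close>

fun loopfree :: "com \<Rightarrow> bool" where
  "loopfree (Seq c d) = (loopfree c \<and> loopfree d)"
| "loopfree (Cond b c d) = (loopfree c \<and> loopfree d)"
| "loopfree (While b c) = False"
| "loopfree (MaxFlow a f) = False"
| "loopfree _ = True"

fun sem :: "com \<Rightarrow> state \<Rightarrow> state" where
  "sem (NAssign x e) \<sigma> = \<sigma>\<lparr>nvar := (nvar \<sigma>)(x := nval \<sigma> e)\<rparr>"
| "sem (NSet x i j e) \<sigma> = \<sigma>\<lparr>narr := upd2 (narr \<sigma>) x (nval \<sigma> i) (nval \<sigma> j) (nval \<sigma> e)\<rparr>"
| "sem (RSet x i j e) \<sigma> = \<sigma>\<lparr>rarr := upd2 (rarr \<sigma>) x (nval \<sigma> i) (nval \<sigma> j) (rval \<sigma> e)\<rparr>"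
| "sem (Seq c d) \<sigma> = sem d (sem c \<sigma>)"
| "sem (Cond b c d) \<sigma> = (if bval \<sigma> b then sem c \<sigma> else sem d \<sigma>)"
| "sem _ \<sigma> = \<sigma>"

fun cost :: "com \<Rightarrow> nat" where
  "cost (Seq c d) = cost c + cost d"
| "cost (Cond b c d) = Suc (max (cost c) (cost d))"
| "cost _ = 1"

lemma exec_loopfree: "loopfree c \<Longrightarrow> \<exists>k\<le>cost c. exec F G c \<sigma> k [] (sem c \<sigma>)"
proof (induction c arbitrary: \<sigma>)
  case (Seq c d)
  then obtain k l where "k \<le> cost c" "exec F G c \<sigma> k [] (sem c \<sigma>)"
      "l \<le> cost d" "exec F G d (sem c \<sigma>) l [] (sem d (sem c \<sigma>))"
    by (metis loopfree.simps(1))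
  then show ?case using exec_Seq[of F G c \<sigma> k "[]" "sem c \<sigma>" d l "[]"]
    by (intro exI[of _ "k + l"]) auto
next
  case (Cond b c d)
  then obtain k l where *: "k \<le> cost c" "exec F G c \<sigma> k [] (sem c \<sigma>)"
      "l \<le> cost d" "exec F G d \<sigma> l [] (sem d \<sigma>)"
    by (metis loopfree.simps(2))
  show ?case
  proof (cases "bval \<sigma> b")
    case True
    then show ?thesis using * exec_CondTrue[OF True *(2), of d] by (intro exI[of _ "Suc k"]) auto
  next
    case False
    then show ?thesis using * exec_CondFalse[OF False *(4), of c] by (intro exI[of _ "Suc l"]) auto
  qed
qed (auto intro!: exI[of _ "Suc 0"] exec.intros[unfolded One_nat_def])

text \<open>Array memory indexed by position instead of by name: a loop body that writes several
  arrays at one position then changes a single value of this function.\<close>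

definition cells_at :: "state \<Rightarrow> nat \<times> nat \<Rightarrow> (name \<Rightarrow> nat) \<times> (name \<Rightarrow> real)" where
  "cells_at \<sigma> p = (\<lambda>a. narr \<sigma> a (fst p) (snd p), \<lambda>a. rarr \<sigma> a (fst p) (snd p))"

lemma cells_at_upd:
  "cells_at (\<sigma>\<lparr>rarr := upd2 (rarr \<sigma>) a i j w\<rparr>) = (cells_at \<sigma>)((i, j) := (fst (cells_at \<sigma> (i, j)), (snd (cells_at \<sigma> (i, j)))(a := w)))"
  "cells_at (\<sigma>\<lparr>narr := upd2 (narr \<sigma>) a i j m\<rparr>) = (cells_at \<sigma>)((i, j) := ((fst (cells_at \<sigma> (i, j)))(a := m), snd (cells_at \<sigma> (i, j))))"
  "cells_at (\<sigma>\<lparr>nvar := f\<rparr>) = cells_at \<sigma>"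
  by (auto simp: cells_at_def upd2_def fun_eq_iff)

lemma upd2_apply: "upd2 A x i j a y u v = (if y = x \<and> u = i \<and> v = j then a else A y u v)"
  by (simp add: upd2_def)

section \<open>Hoare-style rules that count time and flow computations\<close>

locale machine =
  fixes F :: "network \<Rightarrow> nat \<times> nat \<Rightarrow> real" and G :: network
  assumes flows: "max_flow_oracle F" and wf: "wf_network G"
begin

text \<open>Total correctness with budgets \<open>k\<close> for time and \<open>l\<close> for flow
  computations. The size bound on queries is built in; its factor 2 stems from residual arcs running
  along edges and against them.\<close>

definition runs :: "com \<Rightarrow> state \<Rightarrow> nat \<Rightarrow> nat \<Rightarrow> (state \<Rightarrow> bool) \<Rightarrow> bool" where
  "runs c \<sigma> k l Q \<longleftrightarrow> (\<exists>k' qs \<sigma>'. exec F G c \<sigma> k' qs \<sigma>' \<and> k' \<le> k \<and> length qs \<le> l \<and>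
     (\<forall>q\<in>set qs. card (edges q) \<le> 2 * (nv G + card (edges G))) \<and> Q \<sigma>')"

text \<open>The new postcondition may use that names outside \<open>mods c\<close> are unchanged, so
  specifications need not repeat the frame. \<open>runs_Seq\<close> offers the same.\<close>

lemma runs_mono:
  assumes "runs c \<sigma> k l Q" "k \<le> k'" "l \<le> l'"
    and "\<And>\<sigma>'. agree (mods c) \<sigma> \<sigma>' \<Longrightarrow> Q \<sigma>' \<Longrightarrow> Q' \<sigma>'"
  shows "runs c \<sigma> k' l' Q'"
  using assms exec_agree[of F G c \<sigma>] unfolding runs_def by (meson order_trans)

lemma runs_loopfree: "loopfree c \<Longrightarrow> cost c \<le> k \<Longrightarrow> Q (sem c \<sigma>) \<Longrightarrow> runs c \<sigma> k l Q"
  using exec_loopfree[of c F G \<sigma>] unfolding runs_def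
  by (metis empty_iff empty_set le_trans list.size(3) zero_le)

lemma runs_Seq:
  assumes "runs c \<sigma> k l R"
    and "\<And>\<sigma>'. agree (mods c) \<sigma> \<sigma>' \<Longrightarrow> R \<sigma>' \<Longrightarrow> runs d \<sigma>' k' l' Q"
  shows "runs (Seq c d) \<sigma> (k + k') (l + l') Q"
proof -
  obtain i qs \<sigma>' where 1: "exec F G c \<sigma> i qs \<sigma>'" "i \<le> k" "length qs \<le> l"
      "\<forall>q\<in>set qs. card (edges q) \<le> 2 * (nv G + card (edges G))" "R \<sigma>'"
    using assms(1) unfolding runs_def by blast
  obtain j rs \<sigma>'' where 2: "exec F G d \<sigma>' j rs \<sigma>''" "j \<le> k'" "length rs \<le> l'"
      "\<forall>q\<in>set rs. card (edges q) \<le> 2 * (nv G + card (edges G))" "Q \<sigma>''"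
    using assms(2)[OF exec_agree[OF 1(1)] 1(5)] unfolding runs_def by blast
  show ?thesis unfolding runs_def
    by (rule exI[of _ "i + j"], rule exI[of _ "qs @ rs"], rule exI[of _ \<sigma>''])
      (use 1 2 exec_Seq[OF 1(1) 2(1)] in auto)
qed

lemma runs_Cond:
  assumes "bval \<sigma> b \<Longrightarrow> runs c \<sigma> k l Q" "\<not> bval \<sigma> b \<Longrightarrow> runs d \<sigma> k l Q"
  shows "runs (Cond b c d) \<sigma> (Suc k) l Q"
  using assms unfolding runs_def
  by (cases "bval \<sigma> b") (meson Suc_le_mono exec_CondTrue exec_CondFalse)+

lemma runs_MaxFlow:
  assumes "card (edges (query G (rarr \<sigma> a))) \<le> 2 * (nv G + card (edges G))"
    and "Q (\<sigma>\<lparr>rarr := (rarr \<sigma>)(f := (\<lambda>u v. F (query G (rarr \<sigma> a)) (u, v)))\<rparr>)"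
  shows "runs (MaxFlow a f) \<sigma> 1 1 Q"
  unfolding runs_def using assms exec_MaxFlow[of F G a f \<sigma>]
  by (intro exI[of _ 1] exI[of _ "[query G (rarr \<sigma> a)]"] exI conjI) auto

text \<open>Each iteration pays 2 for test and increment; the other 2 are the initial assignment and
  the final test. By \<open>ins\<close> the invariant ignores the counter, so the increment
  preserves it.\<close>

lemma runs_For:
  assumes N: "nvar \<sigma> y = N" "x \<noteq> y" "x \<notin> mods c" "y \<notin> mods c"
    and ins: "\<And>i \<sigma>' j. I i (\<sigma>'\<lparr>nvar := (nvar \<sigma>')(x := j)\<rparr>) = I i \<sigma>'"
    and I0: "I 0 \<sigma>"
    and step: "\<And>i \<sigma>'. i < N \<Longrightarrow> agree (insert x (mods c)) \<sigma> \<sigma>' \<Longrightarrow> nvar \<sigma>' x = i \<Longrightarrow> I i \<sigma>' \<Longrightarrow>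
      runs c \<sigma>' k l (I (Suc i))"
  shows "runs (For x y c) \<sigma> (2 + N * (k + 2)) (N * l) (I N)"
proof -
  let ?b = "NLess (NVar x) (NVar y)" and ?c = "Seq c (NAssign x (NSuc (NVar x)))"
  have loop: "runs (While ?b ?c) \<sigma>' (1 + d * (k + 2)) (d * l) (I N)"
    if "d + i = N" "nvar \<sigma>' x = i" "I i \<sigma>'" "agree (insert x (mods c)) \<sigma> \<sigma>'" for d i \<sigma>'
    using that
  proof (induction d arbitrary: i \<sigma>')
    case 0
    then have "\<not> bval \<sigma>' ?b" using N by (simp add: agree_def)
    from exec_WhileFalse[OF this, of F G ?c] show ?case
      unfolding runs_def using 0 by (intro exI[of _ 1] exI[of _ "[]"] exI[of _ \<sigma>']) auto
  next
    case (Suc d)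
    have b: "bval \<sigma>' ?b" using N Suc.prems by (simp add: agree_def)
    have "runs c \<sigma>' k l (I (Suc i))" using Suc.prems by (intro step) auto
    then have "runs ?c \<sigma>' (k + 1) (l + 0) (\<lambda>\<tau>. nvar \<tau> x = Suc i \<and> I (Suc i) \<tau>)"
    proof (rule runs_Seq)
      fix \<tau> assume "agree (mods c) \<sigma>' \<tau>" "I (Suc i) \<tau>"
      moreover have "nvar \<tau> x = i" using calculation(1) Suc.prems N by (simp add: agree_def)
      ultimately show "runs (NAssign x (NSuc (NVar x))) \<tau> 1 0 (\<lambda>\<tau>. nvar \<tau> x = Suc i \<and> I (Suc i) \<tau>)"
        by (intro runs_loopfree) (simp_all add: ins)
    qed
    then obtain a qs \<tau> where 1: "exec F G ?c \<sigma>' a qs \<tau>" "a \<le> k + 1" "length qs \<le> l"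
        "\<forall>q\<in>set qs. card (edges q) \<le> 2 * (nv G + card (edges G))" "nvar \<tau> x = Suc i" "I (Suc i) \<tau>"
      unfolding runs_def by auto
    have "agree (insert x (mods c)) \<sigma>' \<tau>" using exec_agree[OF 1(1)] by (rule agree_mono) auto
    then have "agree (insert x (mods c)) \<sigma> \<tau>" using Suc.prems(4) by (simp add: agree_def)
    then have "runs (While ?b ?c) \<tau> (1 + d * (k + 2)) (d * l) (I N)"
      using Suc.prems(1) 1 by (intro Suc.IH[of "Suc i"]) auto
    then obtain a' rs \<tau>' where 2: "exec F G (While ?b ?c) \<tau> a' rs \<tau>'" "a' \<le> 1 + d * (k + 2)"
        "length rs \<le> d * l" "\<forall>q\<in>set rs. card (edges q) \<le> 2 * (nv G + card (edges G))" "I N \<tau>'"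
      unfolding runs_def by auto
    show ?case unfolding runs_def
      by (rule exI[of _ "Suc (a + a')"], rule exI[of _ "qs @ rs"], rule exI[of _ \<tau>'])
        (use 1 2 exec_WhileTrue[OF b 1(1) 2(1)] in auto)
  qed
  have "runs (NAssign x (NConst 0)) \<sigma> 1 0 (\<lambda>\<tau>. nvar \<tau> x = 0 \<and> I 0 \<tau>)"
    using I0 by (intro runs_loopfree) (simp_all add: ins)
  then have "runs (For x y c) \<sigma> (1 + (1 + N * (k + 2))) (0 + N * l) (I N)"
    unfolding For_def
  proof (rule runs_Seq)
    fix \<tau> assume "agree (mods (NAssign x (NConst 0))) \<sigma> \<tau>" "nvar \<tau> x = 0 \<and> I 0 \<tau>"
    then show "runs (While ?b ?c) \<tau> (1 + N * (k + 2)) (N * l) (I N)"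
      by (intro loop[of N 0]) (auto intro: agree_mono)
  qed
  then show ?thesis by simp
qed

text \<open>Each position is visited once and the body writes only there, so a visited cell still
  has its original contents and the double loop acts as a simultaneous update. Reads at other
  positions must concern arrays outside \<open>mods c\<close>.\<close>

lemma runs_grid:
  assumes N: "nvar \<sigma> n = N" and names: "distinct [x, y, n]" "{x, y, n} \<inter> mods c = {}" and lf: "loopfree c"
    and step: "\<And>i j \<sigma>'. i < N \<Longrightarrow> j < N \<Longrightarrow> agree (insert x (insert y (mods c))) \<sigma> \<sigma>' \<Longrightarrow>
      nvar \<sigma>' x = i \<Longrightarrow> nvar \<sigma>' y = j \<Longrightarrow> (\<And>a. rarr \<sigma>' a i j = rarr \<sigma> a i j) \<Longrightarrow>
      (\<And>a. narr \<sigma>' a i j = narr \<sigma> a i j) \<Longrightarrow>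
      cells_at (sem c \<sigma>') = (cells_at \<sigma>')((i, j) := (\<lambda>a. newn a i j, \<lambda>a. newr a i j))"
  shows "runs (For x n (For y n c)) \<sigma> (2 + N * (4 + N * (cost c + 2))) 0
    (\<lambda>\<sigma>'. \<forall>a u v. rarr \<sigma>' a u v = (if u < N \<and> v < N then newr a u v else rarr \<sigma> a u v) \<and>
      narr \<sigma>' a u v = (if u < N \<and> v < N then newn a u v else narr \<sigma> a u v))"
proof -
  \<comment> \<open>Row-major progress; the guard \<open>v < N\<close> makes the end of row
    \<open>i\<close> coincide with the start of row \<open>Suc i\<close>.\<close>
  define I where "I i j \<sigma>' \<longleftrightarrow> (\<forall>u v. cells_at \<sigma>' (u, v) =
    (if v < N \<and> (u < i \<or> u = i \<and> v < j) then (\<lambda>a. newn a u v, \<lambda>a. newr a u v) else cells_at \<sigma> (u, v)))"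
    for i j \<sigma>'
  have I_upd: "I i j (\<tau>\<lparr>nvar := f\<rparr>) = I i j \<tau>" for i j \<tau> f
    by (simp add: I_def cells_at_upd)
  have "runs (For x n (For y n c)) \<sigma> (2 + N * ((2 + N * (cost c + 2)) + 2)) (N * (N * 0)) (I N 0)"
  proof (rule runs_For[where I = "\<lambda>i. I i 0"])
    show "nvar \<sigma> n = N" "x \<noteq> n" "x \<notin> mods (For y n c)" "n \<notin> mods (For y n c)"
      using N names by auto
    show "I 0 0 \<sigma>" by (simp add: I_def)
    fix i \<sigma>' assume i: "i < N" and ag: "agree (insert x (mods (For y n c))) \<sigma> \<sigma>'"
      and x: "nvar \<sigma>' x = i" and I: "I i 0 \<sigma>'"
    have "runs (For y n c) \<sigma>' (2 + N * (cost c + 2)) (N * 0) (I i N)"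
    proof (rule runs_For)
      show "nvar \<sigma>' n = N" "y \<noteq> n" "y \<notin> mods c" "n \<notin> mods c"
        using N names ag by (auto simp: agree_def)
      show "I i 0 \<sigma>'" by (rule I)
      fix j \<tau> assume j: "j < N" and ag': "agree (insert y (mods c)) \<sigma>' \<tau>"
        and y: "nvar \<tau> y = j" and I': "I i j \<tau>"
      have c: "cells_at \<tau> (i, j) = cells_at \<sigma> (i, j)" using I' by (simp add: I_def)
      have "cells_at (sem c \<tau>) = (cells_at \<tau>)((i, j) := (\<lambda>a. newn a i j, \<lambda>a. newr a i j))"
      proof (rule step[OF i j])
        show "agree (insert x (insert y (mods c))) \<sigma> \<tau>" using ag ag' by (auto simp: agree_def)
        show "nvar \<tau> x = i" using x ag' names by (auto simp: agree_def)
        show "nvar \<tau> y = j" by (rule y)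
        show "rarr \<tau> a i j = rarr \<sigma> a i j" "narr \<tau> a i j = narr \<sigma> a i j" for a
          using c by (simp_all add: cells_at_def fun_eq_iff)
      qed
      then have "I i (Suc j) (sem c \<tau>)" using I' j by (auto simp: I_def less_Suc_eq)
      then show "runs c \<tau> (cost c) 0 (I i (Suc j))" using lf by (intro runs_loopfree) auto
    qed (simp add: I_upd)
    moreover have "I i N = I (Suc i) 0" by (rule ext) (simp add: I_def less_Suc_eq cong: conj_cong)
    ultimately show "runs (For y n c) \<sigma>' (2 + N * (cost c + 2)) (N * 0) (I (Suc i) 0)"
      by simp
  qed (simp add: I_upd)
  then show ?thesis
  proof (rule runs_mono)
    fix \<sigma>' assume "I N 0 \<sigma>'"
    then have cells: "cells_at \<sigma>' (u, v) = (if u < N \<and> v < N then (\<lambda>a. newn a u v, \<lambda>a. newr a u v) else cells_at \<sigma> (u, v))"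
      for u v by (auto simp: I_def)
    show "\<forall>a u v. rarr \<sigma>' a u v = (if u < N \<and> v < N then newr a u v else rarr \<sigma> a u v) \<and>
        narr \<sigma>' a u v = (if u < N \<and> v < N then newn a u v else narr \<sigma> a u v)"
    proof (intro allI)
      fix a u v
      show "rarr \<sigma>' a u v = (if u < N \<and> v < N then newr a u v else rarr \<sigma> a u v) \<and>
          narr \<sigma>' a u v = (if u < N \<and> v < N then newn a u v else narr \<sigma> a u v)"
        using cells[of u v] by (cases "u < N \<and> v < N") (auto simp: cells_at_def fun_eq_iff)
    qed
  qed (simp_all add: algebra_simps)
qed

end

section \<open>The program\<close>

abbreviation "zero \<equiv> NConst 0"

abbreviation nget :: "name \<Rightarrow> name \<Rightarrow> nexp" where
  "nget a x \<equiv> NGet a (NVar x) zero"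

abbreviation rget :: "name \<Rightarrow> name \<Rightarrow> name \<Rightarrow> rexp" where
  "rget a x y \<equiv> RGet a (NVar x) (NVar y)"

abbreviation nput :: "name \<Rightarrow> name \<Rightarrow> nexp \<Rightarrow> com" where
  "nput a x e \<equiv> NSet a (NVar x) zero e"

abbreviation rput :: "name \<Rightarrow> name \<Rightarrow> name \<Rightarrow> rexp \<Rightarrow> com" where
  "rput a x y e \<equiv> RSet a (NVar x) (NVar y) e"

text \<open>The maximum flow instruction always uses the source \<open>s\<close> and sink \<open>t\<close> of the input network.
  To compute a minimum cut from \<open>p\<close> to \<open>q\<close>, the vertices are renamed by a permutation \<open>P\<close> with
  \<open>P s = p\<close> and \<open>P t = q\<close>, a composition of two transpositions.  One-dimensional arrays occupy
  column 0.\<close>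

definition relabel :: com where
  "relabel = Seq (For ''x'' ''n'' (nput ''P'' ''x'' (NVar ''x'')))
     (Seq (nput ''P'' ''s'' (NVar ''p'')) (Seq (nput ''P'' ''p'' (NVar ''s''))
     (Seq (NAssign ''j'' (nget ''P'' ''q''))
     (Seq (nput ''P'' ''j'' (nget ''P'' ''t'')) (nput ''P'' ''t'' (NVar ''q''))))))"

definition solve :: com where
  "solve = Seq (For ''x'' ''n'' (For ''y'' ''n''
       (rput ''A'' ''x'' ''y'' (RGet ''R'' (nget ''P'' ''x'') (nget ''P'' ''y'')))))
     (MaxFlow ''A'' ''H'')"

text \<open>Search of the residual network: a vertex is marked 0 (not reached), 1 (reached) or 2 (scanned).
  Each of the \<open>n\<close> rounds scans one vertex marked 1, if there is one, in linear time.\<close>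

definition find_active :: com where
  "find_active = Seq (NAssign ''z'' (NVar ''n''))
     (For ''x'' ''n'' (Cond (BAnd (NLess zero (nget ''mark'' ''x'')) (NLess (nget ''mark'' ''x'') (NConst 2)))
       (NAssign ''z'' (NVar ''x'')) Skip))"

definition scan_active :: com where
  "scan_active = Seq (nput ''mark'' ''z'' (NConst 2))
     (For ''y'' ''n'' (Cond (BAnd (NLess (nget ''mark'' ''y'') (NConst 1))
         (RLess RZero (RAdd (RSub (rget ''A'' ''z'' ''y'') (rget ''H'' ''z'' ''y'')) (rget ''H'' ''y'' ''z''))))
       (nput ''mark'' ''y'' (NConst 1)) Skip))"

definition reach :: com where
  "reach = Seq (For ''x'' ''n'' (nput ''mark'' ''x'' zero)) (Seq (nput ''mark'' ''s'' (NConst 1))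
     (For ''i'' ''n'' (Seq find_active (Cond (NLess (NVar ''z'') (NVar ''n'')) scan_active Skip))))"

text \<open>The marks belong to renamed vertices; writing through \<open>P\<close> yields the image
  of the reached set, in the original names.\<close>

definition transfer :: com where
  "transfer = For ''x'' ''n'' (NSet ''S'' (nget ''P'' ''x'') zero (nget ''mark'' ''x''))"

definition weigh :: com where
  "weigh = Seq (RSet ''w'' zero zero RZero) (For ''x'' ''n'' (For ''y'' ''n''
     (Cond (BAnd (NLess zero (nget ''S'' ''x'')) (BNot (NLess zero (nget ''S'' ''y''))))
       (RSet ''w'' zero zero (RAdd (RGet ''w'' zero zero) (rget ''R'' ''x'' ''y''))) Skip)))"

definition raise_best :: com where
  "raise_best = (let e = RDiv ROne (RAdd ROne (RGet ''w'' zero zero)) in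
     Cond (RLess (rget ''B'' ''x'' ''y'') e) (rput ''B'' ''x'' ''y'' e) Skip)"

text \<open>The sum of \<open>R\<close> and \<open>phi\<close> recovers the bound at
  \<open>(y, x)\<close> from the start of the round; \<open>U\<close> may no longer hold it, being
  lowered in place.\<close>

definition lower_bound :: com where
  "lower_bound = (let e = RSub (RGet ''w'' zero zero) (RAdd (rget ''R'' ''y'' ''x'') (rget ''phi'' ''y'' ''x'')) in
     Cond (RLess e (rget ''U'' ''x'' ''y'')) (rput ''U'' ''x'' ''y'' e) Skip)"

definition update :: com where
  "update = For ''x'' ''n'' (For ''y'' ''n''
     (Cond (NLess zero (nget ''S'' ''x''))
       (Cond (NLess zero (nget ''S'' ''y'')) Skip raise_best)
       (Cond (NLess zero (nget ''S'' ''y'')) (Seq lower_bound raise_best) Skip)))"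

definition cutstep :: com where
  "cutstep = Seq relabel (Seq solve (Seq reach (Seq transfer (Seq weigh update))))"

text \<open>The new vertex \<open>v\<close> is attached to the vertex \<open>r < v\<close> that the cuts found so far
  separate from \<open>v\<close> least well; see \<open>best_family_extend\<close>.\<close>

definition choose_partner :: com where
  "choose_partner = Seq (NAssign ''r'' zero) (For ''x'' ''v''
     (Cond (RLess (rget ''B'' ''v'' ''x'') (rget ''B'' ''v'' ''r'')) (NAssign ''r'' (NVar ''x'')) Skip))"

definition attach :: com where
  "attach = Seq choose_partner
     (Seq (Seq (NAssign ''p'' (NVar ''v'')) (NAssign ''q'' (NVar ''r''))) (Seq cutstep
     (Seq (Seq (NAssign ''p'' (NVar ''r'')) (NAssign ''q'' (NVar ''v''))) cutstep)))"

text \<open>\<open>R\<close> is fixed for the whole round so that all its cuts are comparable, and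
  clearing \<open>B\<close> makes the family of cuts empty.\<close>

definition tighten :: com where
  "tighten = Seq (For ''x'' ''n'' (For ''y'' ''n''
       (Seq (rput ''R'' ''x'' ''y'' (RSub (rget ''U'' ''x'' ''y'') (rget ''phi'' ''x'' ''y'')))
         (rput ''B'' ''x'' ''y'' RZero))))
     (For ''v'' ''n'' (Cond (NLess zero (NVar ''v'')) attach Skip))"

definition init_bounds :: com where
  "init_bounds = Seq (MaxFlow ''c'' ''f'') (For ''x'' ''n'' (For ''y'' ''n''
     (Seq (rput ''U'' ''x'' ''y'' (rget ''c'' ''x'' ''y''))
       (rput ''phi'' ''x'' ''y'' (RSub (rget ''f'' ''x'' ''y'') (rget ''f'' ''y'' ''x''))))))"

definition report :: com where
  "report = For ''x'' ''n'' (For ''y'' ''n''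
     (Cond (RLess (rget ''U'' ''y'' ''x'') RZero) (NSet ''vital'' (NVar ''x'') (NVar ''y'') (NConst 1)) Skip))"

definition find_vital :: com where
  "find_vital = Seq init_bounds (Seq tighten (Seq tighten report))"

lemma mods_parts:
  "mods relabel = {''x'', ''P'', ''j''}"
  "mods solve = {''x'', ''y'', ''A'', ''H''}"
  "mods find_active = {''x'', ''z''}"
  "mods scan_active = {''y'', ''mark''}"
  "mods reach = {''x'', ''y'', ''i'', ''z'', ''mark''}"
  "mods transfer = {''x'', ''S''}"
  "mods weigh = {''x'', ''y'', ''w''}"
  "mods update = {''x'', ''y'', ''U'', ''B''}"
  by (auto simp: relabel_def solve_def find_active_def scan_active_def reach_def transfer_def weigh_def
      update_def raise_best_def lower_bound_def Let_def)

lemma mods_cutstep: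
  "mods cutstep = {''x'', ''y'', ''i'', ''j'', ''z'', ''P'', ''A'', ''H'', ''mark'', ''S'', ''w'', ''U'', ''B''}"
  by (auto simp: cutstep_def mods_parts)

lemma mods_attach: "mods attach = insert ''r'' (insert ''p'' (insert ''q'' (mods cutstep)))"
  by (auto simp: attach_def choose_partner_def mods_cutstep)

lemma mods_tighten: "mods tighten = insert ''R'' (insert ''v'' (mods attach))"
  by (auto simp: tighten_def mods_attach mods_cutstep)

section \<open>Correctness and running time\<close>

context machine
begin

definition ready :: "state \<Rightarrow> bool" where
  "ready \<sigma> \<longleftrightarrow> nvar \<sigma> ''n'' = nv G \<and> nvar \<sigma> ''s'' = src G \<and> nvar \<sigma> ''t'' = snk G"

lemma ready_agree: "ready \<sigma> \<Longrightarrow> agree M \<sigma> \<sigma>' \<Longrightarrow> M \<inter> {''n'', ''s'', ''t''} = {} \<Longrightarrow> ready \<sigma>'"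
  by (auto simp: ready_def agree_def)

lemma nv_ge2: "2 \<le> nv G" "src G < nv G" "snk G < nv G" "src G \<noteq> snk G"
  using wf by (auto simp: wf_network_def)

lemma runs_relabel:
  assumes rd: "ready \<sigma>" and pq: "nvar \<sigma> ''p'' = p" "nvar \<sigma> ''q'' = q" "p < nv G" "q < nv G" "p \<noteq> q"
  shows "runs relabel \<sigma> (7 * nv G) 0 (\<lambda>\<sigma>'. bij_betw (\<lambda>x. narr \<sigma>' ''P'' x 0) {..<nv G} {..<nv G} \<and>
    narr \<sigma>' ''P'' (src G) 0 = p \<and> narr \<sigma>' ''P'' (snk G) 0 = q)"
proof -
  have "runs relabel \<sigma> ((2 + nv G * (1 + 2)) + 5) (nv G * 0 + 0) (\<lambda>\<sigma>'. bij_betw (\<lambda>x. narr \<sigma>' ''P'' x 0) {..<nv G} {..<nv G} \<and>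
    narr \<sigma>' ''P'' (src G) 0 = p \<and> narr \<sigma>' ''P'' (snk G) 0 = q)"
    unfolding relabel_def
  proof (rule runs_Seq)
    show "runs (For ''x'' ''n'' (nput ''P'' ''x'' (NVar ''x''))) \<sigma> (2 + nv G * (1 + 2)) (nv G * 0)
        (\<lambda>\<sigma>'. \<forall>x<nv G. narr \<sigma>' ''P'' x 0 = x)"
      by (rule runs_For[where I = "\<lambda>i \<sigma>'. \<forall>x<i. narr \<sigma>' ''P'' x 0 = x"])
        (use rd in \<open>auto simp: ready_def upd2_apply less_Suc_eq intro!: runs_loopfree\<close>)
    fix \<sigma>' assume ag: "agree (mods (For ''x'' ''n'' (nput ''P'' ''x'' (NVar ''x'')))) \<sigma> \<sigma>'"
      and id: "\<forall>x<nv G. narr \<sigma>' ''P'' x 0 = x"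
    have v: "nvar \<sigma>' ''s'' = src G" "nvar \<sigma>' ''t'' = snk G" "nvar \<sigma>' ''p'' = p" "nvar \<sigma>' ''q'' = q"
      using ag rd pq by (auto simp: ready_def agree_def)
    let ?c = "Seq (nput ''P'' ''s'' (NVar ''p'')) (Seq (nput ''P'' ''p'' (NVar ''s''))
     (Seq (NAssign ''j'' (nget ''P'' ''q''))
     (Seq (nput ''P'' ''j'' (nget ''P'' ''t'')) (nput ''P'' ''t'' (NVar ''q'')))))"
    define \<tau> where "\<tau> = transpose (src G) p"
    \<comment> \<open>After the first swap \<open>P\<close> is a transposition, hence its own
      inverse, so reading \<open>P\<close> at \<open>q\<close> finds the place where
      \<open>q\<close> is stored. Exchanging this place with the sink leaves the source alone
      because \<open>p \<noteq> q\<close> and source and sink differ.\<close>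
    define \<pi> where "\<pi> = \<tau> \<circ> transpose (\<tau> q) (snk G)"
    have eq: "narr (sem ?c \<sigma>') ''P'' x 0 = \<pi> x" if "x < nv G" for x
      using id that v pq nv_ge2 by (auto simp: upd2_apply \<pi>_def \<tau>_def transpose_def)
    have "bij_betw \<pi> {..<nv G} {..<nv G}"
      unfolding \<pi>_def
    proof (rule bij_betw_trans)
      have "\<tau> q < nv G" using pq nv_ge2 by (simp add: \<tau>_def transpose_def)
      then show "bij_betw (transpose (\<tau> q) (snk G)) {..<nv G} {..<nv G}" using nv_ge2 by simp
      show "bij_betw \<tau> {..<nv G} {..<nv G}" using pq nv_ge2 by (simp add: \<tau>_def)
    qed
    then have bij: "bij_betw (\<lambda>x. narr (sem ?c \<sigma>') ''P'' x 0) {..<nv G} {..<nv G}"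
      by (subst bij_betw_cong[where g = \<pi>]) (simp_all only: eq lessThan_iff)
    have "\<pi> (src G) = p" "\<pi> (snk G) = q"
      using pq nv_ge2 by (auto simp: \<pi>_def \<tau>_def transpose_def)
    then have "narr (sem ?c \<sigma>') ''P'' (src G) 0 = p" "narr (sem ?c \<sigma>') ''P'' (snk G) 0 = q"
      using nv_ge2 eq by metis+
    with bij show "runs ?c \<sigma>' 5 0 (\<lambda>\<sigma>'. bij_betw (\<lambda>x. narr \<sigma>' ''P'' x 0) {..<nv G} {..<nv G} \<and>
        narr \<sigma>' ''P'' (src G) 0 = p \<and> narr \<sigma>' ''P'' (snk G) 0 = q)"
      by (intro runs_loopfree conjI) simp_all
  qed
  then show ?thesis by (rule runs_mono) (use nv_ge2 in auto)
qed

text \<open>Source and sink differ, so there are at least two vertices; this absorbs the lower-order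
  terms.\<close>

lemma grid_cost: "2 + nv G * (4 + nv G * k) \<le> (k + 3) * (nv G)\<^sup>2"
proof -
  have "2 * nv G \<le> (nv G)\<^sup>2" using nv_ge2 by (simp add: power2_eq_square)
  moreover have "2 + nv G * (4 + nv G * k) = 2 + 4 * nv G + k * (nv G)\<^sup>2"
    by (simp add: algebra_simps power2_eq_square)
  moreover have "(k + 3) * (nv G)\<^sup>2 = k * (nv G)\<^sup>2 + 3 * (nv G)\<^sup>2" by (simp add: algebra_simps)
  ultimately show ?thesis using nv_ge2(1) by linarith
qed

lemma runs_solve:
  assumes rd: "ready \<sigma>" and bij: "bij_betw (\<lambda>x. narr \<sigma> ''P'' x 0) {..<nv G} {..<nv G}"
    and arcs: "\<And>x y. x < nv G \<Longrightarrow> y < nv G \<Longrightarrow> 0 < rarr \<sigma> ''R'' x y \<Longrightarrow> (x, y) \<in> edges G \<or> (y, x) \<in> edges G"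
  shows "runs solve \<sigma> (7 * (nv G)\<^sup>2) 1 (\<lambda>\<sigma>'. (\<forall>x<nv G. \<forall>y<nv G. rarr \<sigma>' ''A'' x y =
      rarr \<sigma> ''R'' (narr \<sigma> ''P'' x 0) (narr \<sigma> ''P'' y 0)) \<and>
    rarr \<sigma>' ''H'' = (\<lambda>u v. F (query G (rarr \<sigma>' ''A'')) (u, v)))"
proof -
  let ?\<pi> = "\<lambda>x. narr \<sigma> ''P'' x 0"
  let ?c = "rput ''A'' ''x'' ''y'' (RGet ''R'' (nget ''P'' ''x'') (nget ''P'' ''y''))"
  have "runs (For ''x'' ''n'' (For ''y'' ''n'' ?c)) \<sigma> (2 + nv G * (4 + nv G * (cost ?c + 2))) 0
    (\<lambda>\<sigma>'. \<forall>a u v. rarr \<sigma>' a u v = (if u < nv G \<and> v < nv G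
        then (if a = ''A'' then rarr \<sigma> ''R'' (?\<pi> u) (?\<pi> v) else rarr \<sigma> a u v) else rarr \<sigma> a u v) \<and>
      narr \<sigma>' a u v = (if u < nv G \<and> v < nv G then narr \<sigma> a u v else narr \<sigma> a u v))"
  proof (rule runs_grid[where newn = "\<lambda>a u v. narr \<sigma> a u v" and
      newr = "\<lambda>a u v. if a = ''A'' then rarr \<sigma> ''R'' (?\<pi> u) (?\<pi> v) else rarr \<sigma> a u v"])
    show "nvar \<sigma> ''n'' = nv G" using rd by (simp add: ready_def)
    fix i j \<sigma>' assume ag: "agree (insert ''x'' (insert ''y'' (mods ?c))) \<sigma> \<sigma>'"
      and v: "nvar \<sigma>' ''x'' = i" "nvar \<sigma>' ''y'' = j"
      and same: "\<And>a. rarr \<sigma>' a i j = rarr \<sigma> a i j" "\<And>a. narr \<sigma>' a i j = narr \<sigma> a i j"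
    have "narr \<sigma>' ''P'' = narr \<sigma> ''P''" "rarr \<sigma>' ''R'' = rarr \<sigma> ''R''"
      using ag by (simp_all add: agree_def)
    then show "cells_at (sem ?c \<sigma>') = (cells_at \<sigma>')((i, j) := (\<lambda>a. narr \<sigma> a i j,
        \<lambda>a. if a = ''A'' then rarr \<sigma> ''R'' (?\<pi> i) (?\<pi> j) else rarr \<sigma> a i j))"
      using v same by (simp add: cells_at_upd) (auto simp: cells_at_def fun_eq_iff)
  qed auto
  then have "runs solve \<sigma> (2 + nv G * (4 + nv G * (cost ?c + 2)) + 1) (0 + 1)
     (\<lambda>\<sigma>'. (\<forall>x<nv G. \<forall>y<nv G. rarr \<sigma>' ''A'' x y = rarr \<sigma> ''R'' (?\<pi> x) (?\<pi> y)) \<and>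
       rarr \<sigma>' ''H'' = (\<lambda>u v. F (query G (rarr \<sigma>' ''A'')) (u, v)))"
    unfolding solve_def
  proof (rule runs_Seq, intro runs_MaxFlow)
    fix \<sigma>' assume "\<forall>a u v. rarr \<sigma>' a u v = (if u < nv G \<and> v < nv G
        then (if a = ''A'' then rarr \<sigma> ''R'' (?\<pi> u) (?\<pi> v) else rarr \<sigma> a u v) else rarr \<sigma> a u v) \<and>
      narr \<sigma>' a u v = (if u < nv G \<and> v < nv G then narr \<sigma> a u v else narr \<sigma> a u v)"
    then have A: "rarr \<sigma>' ''A'' u v = rarr \<sigma> ''R'' (?\<pi> u) (?\<pi> v)" if "u < nv G" "v < nv G" for u v
      using that by simp
    let ?E = "edges (query G (rarr \<sigma>' ''A''))" and ?f = "map_prod ?\<pi> ?\<pi>"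
    have pi: "?\<pi> x < nv G" if "x < nv G" for x using bij that by (auto dest: bij_betwE)
    have sub: "?E \<subseteq> {..<nv G} \<times> {..<nv G}" by (auto simp: query_def)
    \<comment> \<open>Undoing the renaming maps the queried arcs injectively to edges and reversed
      edges, whence the factor 2.\<close>
    have "?f ` ?E \<subseteq> edges G \<union> prod.swap ` edges G"
    proof (rule image_subsetI)
      fix e assume "e \<in> ?E"
      then obtain u v where e: "e = (u, v)" "u < nv G" "v < nv G" "0 < rarr \<sigma>' ''A'' u v"
        by (auto simp: query_def)
      then have "(?\<pi> u, ?\<pi> v) \<in> edges G \<or> (?\<pi> v, ?\<pi> u) \<in> edges G"
        using arcs[OF pi pi, of u v] A[of u v] by simp
      then show "?f e \<in> edges G \<union> prod.swap ` edges G"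
        by (auto simp: e(1) intro: image_eqI[of _ prod.swap "(?\<pi> v, ?\<pi> u)"])
    qed
    moreover have "inj_on ?f ?E"
      using map_prod_inj_on[OF bij_betw_imp_inj_on[OF bij] bij_betw_imp_inj_on[OF bij]] sub
      by (rule inj_on_subset)
    moreover have fin: "finite (edges G)"
      by (rule finite_subset[of _ "{..<nv G} \<times> {..<nv G}"]) (use wf in \<open>auto simp: wf_network_def\<close>)
    ultimately have "card ?E \<le> card (edges G \<union> prod.swap ` edges G)"
      by (intro card_inj_on_le[of ?f]) auto
    also have "\<dots> \<le> card (edges G) + card (edges G)"
      using card_Un_le[of "edges G" "prod.swap ` edges G"] card_image_le[OF fin, of prod.swap] by linarith
    finally show "card ?E \<le> 2 * (nv G + card (edges G))" by simp
    show "(\<forall>x<nv G. \<forall>y<nv G. rarr (\<sigma>'\<lparr>rarr := (rarr \<sigma>')(''H'' := (\<lambda>u v. F (query G (rarr \<sigma>' ''A'')) (u, v)))\<rparr>) ''A'' x y =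
        rarr \<sigma> ''R'' (?\<pi> x) (?\<pi> y)) \<and>
       rarr (\<sigma>'\<lparr>rarr := (rarr \<sigma>')(''H'' := (\<lambda>u v. F (query G (rarr \<sigma>' ''A'')) (u, v)))\<rparr>) ''H'' =
       (\<lambda>u v. F (query G (rarr (\<sigma>'\<lparr>rarr := (rarr \<sigma>')(''H'' := (\<lambda>u v. F (query G (rarr \<sigma>' ''A'')) (u, v)))\<rparr>) ''A'')) (u, v))"
      using A by simp
  qed
  then show ?thesis
  proof (rule runs_mono)
    have "1 \<le> (nv G)\<^sup>2" using nv_ge2 by simp
    then show "2 + nv G * (4 + nv G * (cost ?c + 2)) + 1 \<le> 7 * (nv G)\<^sup>2"
      using grid_cost[of "cost ?c + 2"] by simp
  qed auto
qed

section \<open>Search of the residual network\<close>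

definition residual :: "state \<Rightarrow> nat \<Rightarrow> nat \<Rightarrow> bool" where
  "residual \<sigma> x y \<longleftrightarrow> 0 < rarr \<sigma> ''A'' x y - rarr \<sigma> ''H'' x y + rarr \<sigma> ''H'' y x"

definition closed_under :: "(nat \<Rightarrow> nat \<Rightarrow> bool) \<Rightarrow> nat set \<Rightarrow> bool" where
  "closed_under e T \<longleftrightarrow> (\<forall>x\<in>T. \<forall>y<nv G. e x y \<longrightarrow> y \<in> T)"

lemma runs_find_active:
  assumes rd: "ready \<sigma>"
  shows "runs find_active \<sigma> (3 + nv G * 4) 0 (\<lambda>\<sigma>'. nvar \<sigma>' ''z'' < nv G \<and> narr \<sigma> ''mark'' (nvar \<sigma>' ''z'') 0 = 1 \<or>
    \<not> nvar \<sigma>' ''z'' < nv G \<and> (\<forall>x<nv G. narr \<sigma> ''mark'' x 0 \<noteq> 1))"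
proof -
  let ?m = "\<lambda>x. narr \<sigma> ''mark'' x 0"
  let ?c = "Cond (BAnd (NLess zero (nget ''mark'' ''x'')) (NLess (nget ''mark'' ''x'') (NConst 2)))
       (NAssign ''z'' (NVar ''x'')) Skip"
  let ?I = "\<lambda>i \<sigma>'. nvar \<sigma>' ''z'' < nv G \<and> ?m (nvar \<sigma>' ''z'') = 1 \<or>
    nvar \<sigma>' ''z'' = nv G \<and> (\<forall>x<i. ?m x \<noteq> 1)"
  have "runs find_active \<sigma> (1 + (2 + nv G * (2 + 2))) (0 + nv G * 0) (?I (nv G))"
    unfolding find_active_def
  proof (rule runs_Seq)
    show "runs (NAssign ''z'' (NVar ''n'')) \<sigma> 1 0 (\<lambda>\<sigma>'. nvar \<sigma>' ''z'' = nv G)"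
      using rd by (intro runs_loopfree) (simp_all add: ready_def)
    fix \<sigma>' assume ag: "agree (mods (NAssign ''z'' (NVar ''n''))) \<sigma> \<sigma>'" and z: "nvar \<sigma>' ''z'' = nv G"
    show "runs (For ''x'' ''n'' ?c) \<sigma>' (2 + nv G * (2 + 2)) (nv G * 0) (?I (nv G))"
    proof (rule runs_For[where I = ?I])
      show "nvar \<sigma>' ''n'' = nv G" using rd ag by (simp add: ready_def agree_def)
      fix i \<tau> assume i: "i < nv G" "nvar \<tau> ''x'' = i" and ag': "agree (insert ''x'' (mods ?c)) \<sigma>' \<tau>"
        and I: "?I i \<tau>"
      have "narr \<tau> ''mark'' = narr \<sigma> ''mark''" using ag ag' by (simp add: agree_def)
      then have "?I (Suc i) (sem ?c \<tau>)" using i I by (auto simp: less_Suc_eq)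
      then show "runs ?c \<tau> 2 0 (?I (Suc i))" by (intro runs_loopfree) simp_all
    qed (use z in auto)
  qed
  then show ?thesis by (rule runs_mono) auto
qed

lemma runs_scan_active:
  assumes rd: "ready \<sigma>" and z: "nvar \<sigma> ''z'' = z"
  shows "runs scan_active \<sigma> (3 + nv G * 4) 0 (\<lambda>\<sigma>'. \<forall>u<nv G. narr \<sigma>' ''mark'' u 0 =
    (if u = z then 2 else if narr \<sigma> ''mark'' u 0 = 0 \<and> residual \<sigma> z u then 1 else narr \<sigma> ''mark'' u 0))"
proof -
  let ?m = "\<lambda>x. narr \<sigma> ''mark'' x 0"
  let ?c = "Cond (BAnd (NLess (nget ''mark'' ''y'') (NConst 1))
         (RLess RZero (RAdd (RSub (rget ''A'' ''z'' ''y'') (rget ''H'' ''z'' ''y'')) (rget ''H'' ''y'' ''z''))))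
       (nput ''mark'' ''y'' (NConst 1)) Skip"
  let ?I = "\<lambda>i \<sigma>'. \<forall>u<nv G. narr \<sigma>' ''mark'' u 0 =
    (if u = z then 2 else if u < i \<and> ?m u = 0 \<and> residual \<sigma> z u then 1 else ?m u)"
  have "runs scan_active \<sigma> (1 + (2 + nv G * (2 + 2))) (0 + nv G * 0) (?I (nv G))"
    unfolding scan_active_def
  proof (rule runs_Seq)
    show "runs (nput ''mark'' ''z'' (NConst 2)) \<sigma> 1 0 (?I 0)"
      using z by (intro runs_loopfree) (simp_all add: upd2_apply)
    fix \<sigma>' assume ag: "agree (mods (nput ''mark'' ''z'' (NConst 2))) \<sigma> \<sigma>'" and I0: "?I 0 \<sigma>'"
    show "runs (For ''y'' ''n'' ?c) \<sigma>' (2 + nv G * (2 + 2)) (nv G * 0) (?I (nv G))"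
    proof (rule runs_For[where I = ?I])
      show "nvar \<sigma>' ''n'' = nv G" using rd ag by (simp add: ready_def agree_def)
      fix i \<tau> assume i: "i < nv G" "nvar \<tau> ''y'' = i" and ag': "agree (insert ''y'' (mods ?c)) \<sigma>' \<tau>"
        and I: "?I i \<tau>"
      have t: "nvar \<tau> ''z'' = z" "rarr \<tau> ''A'' = rarr \<sigma> ''A''" "rarr \<tau> ''H'' = rarr \<sigma> ''H''"
        using ag ag' z by (simp_all add: agree_def)
      have mi: "narr \<tau> ''mark'' i 0 = (if i = z then 2 else ?m i)" using I i by simp
      have b: "bval \<tau> (BAnd (NLess (nget ''mark'' ''y'') (NConst 1))
         (RLess RZero (RAdd (RSub (rget ''A'' ''z'' ''y'') (rget ''H'' ''z'' ''y'')) (rget ''H'' ''y'' ''z'')))) \<longleftrightarrow>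
         i \<noteq> z \<and> ?m i = 0 \<and> residual \<sigma> z i"
        using i t mi by (simp add: residual_def)
      have "?I (Suc i) (sem ?c \<tau>)"
        unfolding sem.simps b using i I by (auto simp: less_Suc_eq upd2_apply)
      then show "runs ?c \<tau> 2 0 (?I (Suc i))" by (intro runs_loopfree) simp_all
    qed (use I0 in auto)
  qed
  then show ?thesis by (rule runs_mono) auto
qed

text \<open>The clause on \<open>T\<close> says without paths that only reachable vertices are
  marked. The last clause counts progress: each round scans a vertex unless none is waiting, so
  after \<open>nv G\<close> rounds no mark 1 is left.\<close>

definition reach_inv :: "(nat \<Rightarrow> nat \<Rightarrow> bool) \<Rightarrow> nat \<Rightarrow> (nat \<Rightarrow> nat) \<Rightarrow> bool" where
  "reach_inv e i m \<longleftrightarrow> 0 < m (src G) \<and> (\<forall>x<nv G. m x \<le> 2) \<and>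
     (\<forall>x<nv G. m x = 2 \<longrightarrow> (\<forall>y<nv G. e x y \<longrightarrow> 0 < m y)) \<and>
     (\<forall>T. src G \<in> T \<longrightarrow> closed_under e T \<longrightarrow> (\<forall>x<nv G. 0 < m x \<longrightarrow> x \<in> T)) \<and>
     (i \<le> card {x. x < nv G \<and> m x = 2} \<or> (\<forall>x<nv G. m x \<noteq> 1))"

lemma reach_inv_step:
  assumes inv: "reach_inv e i m" and z: "z < nv G" "m z = 1"
    and m': "\<And>u. u < nv G \<Longrightarrow> m' u = (if u = z then 2 else if m u = 0 \<and> e z u then 1 else m u)"
  shows "reach_inv e (Suc i) m'"
proof -
  have s: "src G < nv G" by (rule nv_ge2)
  have pos: "0 < m' u \<longleftrightarrow> 0 < m u \<or> e z u" if "u < nv G" for u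
    using m'[OF that] z by auto
  have two: "m' u = 2 \<longleftrightarrow> u = z \<or> m u = 2" if "u < nv G" for u
    using m'[OF that] by auto
  have i: "i \<le> card {x. x < nv G \<and> m x = 2}" using inv z by (auto simp: reach_inv_def)
  have "{x. x < nv G \<and> m' x = 2} = insert z {x. x < nv G \<and> m x = 2}"
    using two z by auto
  then have "Suc i \<le> card {x. x < nv G \<and> m' x = 2}" using z i by simp
  moreover have "0 < m' (src G)" using inv pos[OF s] by (simp add: reach_inv_def)
  moreover have "m' x \<le> 2" if "x < nv G" for x
    using inv m'[OF that] that by (simp add: reach_inv_def)
  moreover have "0 < m' y" if "x < nv G" "m' x = 2" "y < nv G" "e x y" for x y
    using inv two[OF that(1)] pos[OF that(3)] that by (auto simp: reach_inv_def)
  moreover have "x \<in> T" if T: "src G \<in> T" "closed_under e T" and x: "x < nv G" "0 < m' x" for T x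
  proof -
    have old: "y \<in> T" if "y < nv G" "0 < m y" for y
      using inv T that unfolding reach_inv_def by blast
    then have "z \<in> T" using z by simp
    then show ?thesis using old[OF x(1)] pos[OF x(1)] x T(2) by (auto simp: closed_under_def)
  qed
  ultimately show ?thesis unfolding reach_inv_def by blast
qed

lemma runs_reach:
  assumes rd: "ready \<sigma>"
  shows "runs reach \<sigma> (16 * (nv G)\<^sup>2) 0 (\<lambda>\<sigma>'. src G \<in> {x. x < nv G \<and> 0 < narr \<sigma>' ''mark'' x 0} \<and>
    closed_under (residual \<sigma>) {x. x < nv G \<and> 0 < narr \<sigma>' ''mark'' x 0} \<and>
    (\<forall>T. src G \<in> T \<longrightarrow> closed_under (residual \<sigma>) T \<longrightarrow> {x. x < nv G \<and> 0 < narr \<sigma>' ''mark'' x 0} \<subseteq> T))"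
proof -
  let ?e = "residual \<sigma>"
  let ?m = "\<lambda>\<sigma>' x. narr \<sigma>' ''mark'' x 0"
  let ?J = "\<lambda>i \<sigma>'. reach_inv ?e i (?m \<sigma>')"
  let ?c = "Seq find_active (Cond (NLess (NVar ''z'') (NVar ''n'')) scan_active Skip)"
  have "runs reach \<sigma> ((2 + nv G * (1 + 2)) + (1 + (2 + nv G * ((3 + nv G * 4 + Suc (3 + nv G * 4)) + 2))))
      (nv G * 0 + (0 + nv G * (0 + 0))) (?J (nv G))"
    unfolding reach_def
  proof (rule runs_Seq)
    show "runs (For ''x'' ''n'' (nput ''mark'' ''x'' zero)) \<sigma> (2 + nv G * (1 + 2)) (nv G * 0)
        (\<lambda>\<sigma>'. \<forall>x<nv G. ?m \<sigma>' x = 0)"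
      by (rule runs_For[where I = "\<lambda>i \<sigma>'. \<forall>x<i. ?m \<sigma>' x = 0"])
        (use rd in \<open>auto simp: ready_def upd2_apply less_Suc_eq intro!: runs_loopfree\<close>)
    fix \<sigma>' assume ag: "agree (mods (For ''x'' ''n'' (nput ''mark'' ''x'' zero))) \<sigma> \<sigma>'"
      and zero: "\<forall>x<nv G. ?m \<sigma>' x = 0"
    have rd': "ready \<sigma>'" by (rule ready_agree[OF rd ag]) simp
    show "runs (Seq (nput ''mark'' ''s'' (NConst 1)) (For ''i'' ''n'' ?c)) \<sigma>'
        (1 + (2 + nv G * ((3 + nv G * 4 + Suc (3 + nv G * 4)) + 2))) (0 + nv G * (0 + 0)) (?J (nv G))"
    proof (rule runs_Seq)
      show "runs (nput ''mark'' ''s'' (NConst 1)) \<sigma>' 1 0 (\<lambda>\<tau>. \<forall>x<nv G. ?m \<tau> x = of_bool (x = src G))"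
        using rd' zero by (intro runs_loopfree) (simp_all add: upd2_apply ready_def)
      fix \<sigma>'' assume ag'': "agree (mods (nput ''mark'' ''s'' (NConst 1))) \<sigma>' \<sigma>''"
        and m: "\<forall>x<nv G. ?m \<sigma>'' x = of_bool (x = src G)"
      have rd'': "ready \<sigma>''" by (rule ready_agree[OF rd' ag'']) simp
      show "runs (For ''i'' ''n'' ?c) \<sigma>'' (2 + nv G * ((3 + nv G * 4 + Suc (3 + nv G * 4)) + 2)) (nv G * (0 + 0)) (?J (nv G))"
      proof (rule runs_For[where I = ?J])
        show "nvar \<sigma>'' ''n'' = nv G" using rd'' by (simp add: ready_def)
        show "?J 0 \<sigma>''" using m nv_ge2 by (auto simp: reach_inv_def)
        fix i \<tau> assume ag: "agree (insert ''i'' (mods ?c)) \<sigma>'' \<tau>" and J: "?J i \<tau>"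
        have rdt: "ready \<tau>" by (rule ready_agree[OF rd'' ag]) (simp add: mods_parts)
        have "rarr \<tau> ''A'' = rarr \<sigma> ''A''" "rarr \<tau> ''H'' = rarr \<sigma> ''H''"
          using ag ag'' \<open>agree (mods (For ''x'' ''n'' (nput ''mark'' ''x'' zero))) \<sigma> \<sigma>'\<close>
          by (simp_all add: agree_def mods_parts)
        then have e: "residual \<tau> = ?e" by (simp add: residual_def fun_eq_iff)
        show "runs ?c \<tau> (3 + nv G * 4 + Suc (3 + nv G * 4)) (0 + 0) (?J (Suc i))"
        proof (rule runs_Seq[OF runs_find_active[OF rdt]], rule runs_Cond)
          fix \<tau>' assume ag': "agree (mods find_active) \<tau> \<tau>'"
            and post: "nvar \<tau>' ''z'' < nv G \<and> narr \<tau> ''mark'' (nvar \<tau>' ''z'') 0 = 1 \<or>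
              \<not> nvar \<tau>' ''z'' < nv G \<and> (\<forall>x<nv G. narr \<tau> ''mark'' x 0 \<noteq> 1)"
          have rdt': "ready \<tau>'" by (rule ready_agree[OF rdt ag']) (simp add: mods_parts)
          have same: "narr \<tau>' ''mark'' = narr \<tau> ''mark''" "residual \<tau>' = ?e"
            using ag' e by (simp_all add: agree_def mods_parts residual_def fun_eq_iff)
          {
            assume "bval \<tau>' (NLess (NVar ''z'') (NVar ''n''))"
            then have z: "nvar \<tau>' ''z'' < nv G" "?m \<tau>' (nvar \<tau>' ''z'') = 1"
              using rdt' post same by (auto simp: ready_def)
            have J': "?J i \<tau>'" using J same by simp
            show "runs scan_active \<tau>' (3 + nv G * 4) 0 (?J (Suc i))"
              using runs_scan_active[OF rdt' refl]
              by (rule runs_mono) (auto simp: same(2) intro!: reach_inv_step[OF J' z])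
          next
            assume "\<not> bval \<tau>' (NLess (NVar ''z'') (NVar ''n''))"
            then have "\<forall>x<nv G. ?m \<tau> x \<noteq> 1" using rdt' post by (auto simp: ready_def)
            then have "?J (Suc i) \<tau>'" using J same by (simp add: reach_inv_def)
            then show "runs Skip \<tau>' (3 + nv G * 4) 0 (?J (Suc i))" by (intro runs_loopfree) simp_all
          }
        qed
      qed (simp_all add: mods_parts)
    qed
  qed
  then show ?thesis
  proof (rule runs_mono)
    have "2 * nv G \<le> (nv G)\<^sup>2" using nv_ge2 by (simp add: power2_eq_square)
    moreover have "2 + nv G * (1 + 2) + (1 + (2 + nv G * ((3 + nv G * 4 + Suc (3 + nv G * 4)) + 2))) =
        5 + 12 * nv G + 8 * (nv G)\<^sup>2" by (simp add: algebra_simps power2_eq_square)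
    ultimately show "2 + nv G * (1 + 2) + (1 + (2 + nv G * ((3 + nv G * 4 + Suc (3 + nv G * 4)) + 2))) \<le> 16 * (nv G)\<^sup>2"
      using nv_ge2(1) by linarith
    fix \<sigma>' assume J: "?J (nv G) \<sigma>'"
    let ?m = "\<lambda>x. narr \<sigma>' ''mark'' x 0"
    have src: "0 < ?m (src G)" and le2: "\<And>x. x < nv G \<Longrightarrow> ?m x \<le> 2"
      and cl: "\<And>x y. x < nv G \<Longrightarrow> ?m x = 2 \<Longrightarrow> y < nv G \<Longrightarrow> ?e x y \<Longrightarrow> 0 < ?m y"
      and least: "\<And>T x. src G \<in> T \<Longrightarrow> closed_under ?e T \<Longrightarrow> x < nv G \<Longrightarrow> 0 < ?m x \<Longrightarrow> x \<in> T"
      and count: "nv G \<le> card {x. x < nv G \<and> ?m x = 2} \<or> (\<forall>x<nv G. ?m x \<noteq> 1)"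
      using J unfolding reach_inv_def by blast+
    have not1: "?m x \<noteq> 1" if x: "x < nv G" for x
    proof
      assume one: "?m x = 1"
      have "{x. x < nv G \<and> ?m x = 2} \<subseteq> {..<nv G} - {x}" using one by auto
      then have "card {x. x < nv G \<and> ?m x = 2} \<le> card ({..<nv G} - {x})" by (intro card_mono) simp_all
      also have "\<dots> < nv G" using x by simp
      finally show False using count one x by simp
    qed
    have two: "?m x = 2" if "x < nv G" "0 < ?m x" for x
      using not1[OF that(1)] le2[OF that(1)] that by linarith
    have "src G \<in> {x. x < nv G \<and> 0 < ?m x}" using src nv_ge2 by simp
    moreover have "closed_under ?e {x. x < nv G \<and> 0 < ?m x}"
      unfolding closed_under_def
    proof (intro ballI allI impI)
      fix x y assume x: "x \<in> {x. x < nv G \<and> 0 < ?m x}" and y: "y < nv G" "?e x y"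
      then have "x < nv G" "?m x = 2" using two by simp_all
      then show "y \<in> {x. x < nv G \<and> 0 < ?m x}" using cl[of x y] y by simp
    qed
    moreover have "{x. x < nv G \<and> 0 < ?m x} \<subseteq> T" if "src G \<in> T" "closed_under ?e T" for T
      using least[OF that] by auto
    ultimately show "src G \<in> {x. x < nv G \<and> 0 < ?m x} \<and> closed_under ?e {x. x < nv G \<and> 0 < ?m x} \<and>
      (\<forall>T. src G \<in> T \<longrightarrow> closed_under ?e T \<longrightarrow> {x. x < nv G \<and> 0 < ?m x} \<subseteq> T)" by blast
  qed simp
qed

lemma runs_transfer:
  assumes rd: "ready \<sigma>" and inj: "inj_on (\<lambda>x. narr \<sigma> ''P'' x 0) {..<nv G}"
  shows "runs transfer \<sigma> (2 + nv G * 3) 0 (\<lambda>\<sigma>'. \<forall>x<nv G. narr \<sigma>' ''S'' (narr \<sigma> ''P'' x 0) 0 = narr \<sigma> ''mark'' x 0)"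
proof -
  let ?c = "NSet ''S'' (nget ''P'' ''x'') zero (nget ''mark'' ''x'')"
  let ?I = "\<lambda>i \<sigma>'. \<forall>x<i. narr \<sigma>' ''S'' (narr \<sigma> ''P'' x 0) 0 = narr \<sigma> ''mark'' x 0"
  have "runs transfer \<sigma> (2 + nv G * (1 + 2)) (nv G * 0) (?I (nv G))"
    unfolding transfer_def
  proof (rule runs_For[where I = ?I])
    show "nvar \<sigma> ''n'' = nv G" using rd by (simp add: ready_def)
    fix i \<tau> assume i: "i < nv G" "nvar \<tau> ''x'' = i" and ag: "agree (insert ''x'' (mods ?c)) \<sigma> \<tau>"
      and I: "?I i \<tau>"
    have "narr \<tau> ''P'' = narr \<sigma> ''P''" "narr \<tau> ''mark'' = narr \<sigma> ''mark''"
      using ag by (simp_all add: agree_def)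
    \<comment> \<open>Injectivity of the renaming keeps this write from destroying an earlier
      one.\<close>
    moreover have "narr \<sigma> ''P'' x 0 \<noteq> narr \<sigma> ''P'' i 0" if "x < i" for x
      using inj_onD[OF inj, of x i] i that by auto
    ultimately have "?I (Suc i) (sem ?c \<tau>)"
      using i I by (simp add: less_Suc_eq upd2_apply)
    then show "runs ?c \<tau> 1 0 (?I (Suc i))" by (intro runs_loopfree) simp_all
  qed auto
  then show ?thesis by (rule runs_mono) auto
qed

lemma runs_weigh:
  assumes rd: "ready \<sigma>"
  shows "runs weigh \<sigma> (8 * (nv G)\<^sup>2) 0
    (\<lambda>\<sigma>'. rarr \<sigma>' ''w'' 0 0 = cutval (nv G) (rarr \<sigma> ''R'') {x. x < nv G \<and> 0 < narr \<sigma> ''S'' x 0})"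
proof -
  let ?S = "{x. x < nv G \<and> 0 < narr \<sigma> ''S'' x 0}"
  define g where "g x y = (if x \<in> ?S \<and> y \<notin> ?S then rarr \<sigma> ''R'' x y else 0)" for x y
  let ?c = "Cond (BAnd (NLess zero (nget ''S'' ''x'')) (BNot (NLess zero (nget ''S'' ''y''))))
       (RSet ''w'' zero zero (RAdd (RGet ''w'' zero zero) (rget ''R'' ''x'' ''y''))) Skip"
  let ?w = "\<lambda>\<tau>. rarr \<tau> ''w'' 0 0"
  let ?I = "\<lambda>i \<tau>. ?w \<tau> = (\<Sum>x<i. \<Sum>y<nv G. g x y)"
  have "runs weigh \<sigma> (1 + (2 + nv G * ((2 + nv G * (2 + 2)) + 2))) (0 + nv G * (nv G * 0)) (?I (nv G))"
    unfolding weigh_def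
  proof (rule runs_Seq)
    show "runs (RSet ''w'' zero zero RZero) \<sigma> 1 0 (\<lambda>\<tau>. ?w \<tau> = 0)"
      by (intro runs_loopfree) (simp_all add: upd2_apply)
    fix \<sigma>' assume ag: "agree (mods (RSet ''w'' zero zero RZero)) \<sigma> \<sigma>'" and w0: "?w \<sigma>' = 0"
    show "runs (For ''x'' ''n'' (For ''y'' ''n'' ?c)) \<sigma>' (2 + nv G * ((2 + nv G * (2 + 2)) + 2)) (nv G * (nv G * 0)) (?I (nv G))"
    proof (rule runs_For[where I = ?I])
      show "nvar \<sigma>' ''n'' = nv G" using rd ag by (simp add: ready_def agree_def)
      fix i \<tau> assume i: "i < nv G" "nvar \<tau> ''x'' = i" and ag1: "agree (insert ''x'' (mods (For ''y'' ''n'' ?c))) \<sigma>' \<tau>"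
        and I: "?I i \<tau>"
      let ?K = "\<lambda>j \<tau>. ?w \<tau> = (\<Sum>x<i. \<Sum>y<nv G. g x y) + (\<Sum>y<j. g i y)"
      have "runs (For ''y'' ''n'' ?c) \<tau> (2 + nv G * (2 + 2)) (nv G * 0) (?K (nv G))"
      proof (rule runs_For[where I = ?K])
        show "nvar \<tau> ''n'' = nv G" using rd ag ag1 by (simp add: ready_def agree_def)
        fix j \<rho> assume j: "j < nv G" "nvar \<rho> ''y'' = j" and ag2: "agree (insert ''y'' (mods ?c)) \<tau> \<rho>"
          and K: "?K j \<rho>"
        have "narr \<rho> ''S'' = narr \<sigma> ''S''" "rarr \<rho> ''R'' = rarr \<sigma> ''R''" "nvar \<rho> ''x'' = i"
          using ag ag1 ag2 i by (simp_all add: agree_def)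
        then have "?K (Suc j) (sem ?c \<rho>)"
          using i j K by (simp add: upd2_apply g_def)
        then show "runs ?c \<rho> 2 0 (?K (Suc j))" by (intro runs_loopfree) simp_all
      qed (use I in auto)
      then show "runs (For ''y'' ''n'' ?c) \<tau> (2 + nv G * (2 + 2)) (nv G * 0) (?I (Suc i))"
        by (simp add: add.commute)
    qed (use w0 in auto)
  qed
  then show ?thesis
  proof (rule runs_mono)
    have "2 * nv G \<le> (nv G)\<^sup>2" using nv_ge2 by (simp add: power2_eq_square)
    moreover have "1 + (2 + nv G * ((2 + nv G * (2 + 2)) + 2)) = 3 + 4 * nv G + 4 * (nv G)\<^sup>2"
      by (simp add: algebra_simps power2_eq_square)
    ultimately show "1 + (2 + nv G * ((2 + nv G * (2 + 2)) + 2)) \<le> 8 * (nv G)\<^sup>2"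
      using nv_ge2(1) by linarith
    fix \<sigma>' assume "?I (nv G) \<sigma>'"
    also have "(\<Sum>x<nv G. \<Sum>y<nv G. g x y) = (\<Sum>x\<in>?S. \<Sum>y<nv G. g x y)"
      by (intro sum.mono_neutral_right) (auto simp: g_def)
    also have "\<dots> = cutval (nv G) (rarr \<sigma> ''R'') ?S"
      unfolding cutval_def by (intro sum.cong sum.mono_neutral_cong_right) (auto simp: g_def)
    finally show "?w \<sigma>' = cutval (nv G) (rarr \<sigma> ''R'') ?S" .
  qed simp
qed

lemma runs_update:
  assumes rd: "ready \<sigma>"
  defines "S \<equiv> {x. x < nv G \<and> 0 < narr \<sigma> ''S'' x 0}" and "w \<equiv> rarr \<sigma> ''w'' 0 0"
  shows "runs update \<sigma> (11 * (nv G)\<^sup>2) 0 (\<lambda>\<sigma>'. \<forall>x<nv G. \<forall>y<nv G.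
    rarr \<sigma>' ''U'' x y = (if x \<notin> S \<and> y \<in> S then min (rarr \<sigma> ''U'' x y) (w - (rarr \<sigma> ''R'' y x + rarr \<sigma> ''phi'' y x))
      else rarr \<sigma> ''U'' x y) \<and>
    rarr \<sigma>' ''B'' x y = (if sep S x y then max (rarr \<sigma> ''B'' x y) (1 / (1 + w)) else rarr \<sigma> ''B'' x y))"
proof -
  let ?c = "Cond (NLess zero (nget ''S'' ''x''))
       (Cond (NLess zero (nget ''S'' ''y'')) Skip raise_best)
       (Cond (NLess zero (nget ''S'' ''y'')) (Seq lower_bound raise_best) Skip)"
  define u where "u x y = (if x \<notin> S \<and> y \<in> S then min (rarr \<sigma> ''U'' x y) (w - (rarr \<sigma> ''R'' y x + rarr \<sigma> ''phi'' y x))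
      else rarr \<sigma> ''U'' x y)" for x y
  define b where "b x y = (if sep S x y then max (rarr \<sigma> ''B'' x y) (1 / (1 + w)) else rarr \<sigma> ''B'' x y)" for x y
  let ?new = "\<lambda>a x y. if a = ''U'' then u x y else if a = ''B'' then b x y else rarr \<sigma> a x y"
  have m: "mods raise_best = {''B''}" "mods lower_bound = {''U''}"
    by (auto simp: raise_best_def lower_bound_def Let_def)
  have "runs update \<sigma> (2 + nv G * (4 + nv G * (cost ?c + 2))) 0
    (\<lambda>\<sigma>'. \<forall>a u v. rarr \<sigma>' a u v = (if u < nv G \<and> v < nv G then ?new a u v else rarr \<sigma> a u v) \<and>
      narr \<sigma>' a u v = (if u < nv G \<and> v < nv G then narr \<sigma> a u v else narr \<sigma> a u v))"
    unfolding update_def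
  proof (rule runs_grid[where newn = "\<lambda>a u v. narr \<sigma> a u v" and newr = ?new])
    show "nvar \<sigma> ''n'' = nv G" using rd by (simp add: ready_def)
    show "{''x'', ''y'', ''n''} \<inter> mods ?c = {}" by (simp add: m)
    show "loopfree ?c" by (simp add: raise_best_def lower_bound_def Let_def)
    fix i j \<tau> assume ij: "i < nv G" "j < nv G" and ag: "agree (insert ''x'' (insert ''y'' (mods ?c))) \<sigma> \<tau>"
      and v: "nvar \<tau> ''x'' = i" "nvar \<tau> ''y'' = j"
      and same: "\<And>a. rarr \<tau> a i j = rarr \<sigma> a i j" "\<And>a. narr \<tau> a i j = narr \<sigma> a i j"
    have k: "narr \<tau> ''S'' = narr \<sigma> ''S''" "rarr \<tau> ''w'' = rarr \<sigma> ''w''" "rarr \<tau> ''R'' = rarr \<sigma> ''R''"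
        "rarr \<tau> ''phi'' = rarr \<sigma> ''phi''"
      using ag by (simp_all add: agree_def m)
    have S: "x \<in> S \<longleftrightarrow> 0 < narr \<sigma> ''S'' x 0" if "x < nv G" for x
      using that by (simp add: S_def)
    show "cells_at (sem ?c \<tau>) = (cells_at \<tau>)((i, j) := (\<lambda>a. narr \<sigma> a i j, \<lambda>a. ?new a i j))"
      using v k same S[OF ij(1)] S[OF ij(2)]
      by (auto simp: raise_best_def lower_bound_def Let_def cells_at_upd cells_at_def fun_eq_iff u_def b_def
        sep_def upd2_apply w_def)
  qed simp
  then show ?thesis
  proof (rule runs_mono)
    have "cost ?c + 2 \<le> 8" by (simp add: raise_best_def lower_bound_def Let_def)
    then have "(cost ?c + 2 + 3) * (nv G)\<^sup>2 \<le> 11 * (nv G)\<^sup>2" by (intro mult_right_mono) auto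
    then show "2 + nv G * (4 + nv G * (cost ?c + 2)) \<le> 11 * (nv G)\<^sup>2"
      using grid_cost[of "cost ?c + 2"] by linarith
  qed (simp_all add: u_def b_def)
qed

section \<open>From the reached set to a minimum cut between two given vertices\<close>

lemma query_simps [simp]: "nv (query G a) = nv G" "src (query G a) = src G" "snk (query G a) = snk G"
  by (simp_all add: query_def)

lemma wf_query: "wf_network (query G a)"
  using wf by (auto simp: wf_network_def query_def)

text \<open>As the least residual-closed set, \<open>M\<close> is a minimum source-sink cut of the
  renamed network. Renaming preserves cut values, so the image of \<open>M\<close> is compared with
  \<open>T\<close> through the preimage of \<open>T\<close>.\<close>

lemma relabelled_min_cut:
  assumes bij: "bij_betw \<pi> {..<nv G} {..<nv G}" and pq: "\<pi> (src G) = p" "\<pi> (snk G) = q"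
    and r0: "\<And>x y. x < nv G \<Longrightarrow> y < nv G \<Longrightarrow> 0 \<le> r x y"
    and a: "\<And>x y. x < nv G \<Longrightarrow> y < nv G \<Longrightarrow> a x y = r (\<pi> x) (\<pi> y)"
    and e: "\<And>x y. e x y \<longleftrightarrow> 0 < a x y - F (query G a) (x, y) + F (query G a) (y, x)"
    and M: "M \<subseteq> {..<nv G}" "src G \<in> M" "closed_under e M"
      "\<And>T. src G \<in> T \<Longrightarrow> closed_under e T \<Longrightarrow> M \<subseteq> T"
  shows "\<pi> ` M \<subseteq> {..<nv G}" "p \<in> \<pi> ` M" "q \<notin> \<pi> ` M"
    and "T \<subseteq> {..<nv G} \<Longrightarrow> p \<in> T \<Longrightarrow> q \<notin> T \<Longrightarrow> cutval (nv G) r (\<pi> ` M) \<le> cutval (nv G) r T"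
proof -
  let ?N = "query G a"
  have pi: "\<pi> x < nv G" if "x < nv G" for x using bij that by (auto dest: bij_betwE)
  have inj: "inj_on \<pi> {..<nv G}" and img: "\<pi> ` {..<nv G} = {..<nv G}"
    using bij by (simp_all add: bij_betw_def)
  have mf: "max_flow ?N (F ?N)" using flows wf_query by (simp add: max_flow_oracle_def)
  \<comment> \<open>\<open>query\<close> drops nonpositive entries; by \<open>r0\<close> these are
    zeros, so the capacities are unaffected.\<close>
  have cm: "cmat ?N x y = a x y" if "x < nv G" "y < nv G" for x y
    using r0[OF pi[OF that(1)] pi[OF that(2)]] a[OF that] that by (auto simp: cmat_def query_def)
  have cl: "res_closed ?N (F ?N) T \<longleftrightarrow> closed_under e T" if T: "T \<subseteq> {..<nv G}" for T
  proof -
    have "net (F ?N) x y < cmat ?N x y \<longleftrightarrow> e x y" if "x \<in> T" "y < nv G" for x y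
      using cm[of x y] T that by (auto simp: e net_def)
    then show ?thesis by (auto simp: res_closed_def closed_under_def)
  qed
  have val: "cutval (nv G) (cmat ?N) X = cutval (nv G) r (\<pi> ` X)" if X: "X \<subseteq> {..<nv G}" for X
  proof -
    have "cutval (nv G) (cmat ?N) X = cutval (nv G) (\<lambda>x y. r (\<pi> x) (\<pi> y)) X"
      by (rule cutval_cong[OF X]) (simp add: cm a)
    then show ?thesis by (simp add: cutval_reindex[OF bij X])
  qed
  have cut: "snk G \<notin> M" "cutval (nv G) (cmat ?N) M = flow_value ?N (F ?N)"
    using max_flow_least_closed[OF wf_query mf, of M] M cl by simp_all
  show "\<pi> ` M \<subseteq> {..<nv G}" using M(1) pi by auto
  show "p \<in> \<pi> ` M" using M(2) pq by auto
  show "q \<notin> \<pi> ` M"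
  proof
    assume "q \<in> \<pi> ` M"
    then obtain x where "x \<in> M" "\<pi> x = \<pi> (snk G)" using pq by auto
    then have "x = snk G" using inj M(1) nv_ge2 by (auto dest: inj_onD)
    then show False using cut(1) \<open>x \<in> M\<close> by simp
  qed
  assume T: "T \<subseteq> {..<nv G}" "p \<in> T" "q \<notin> T"
  define X where "X = {x. x < nv G \<and> \<pi> x \<in> T}"
  have X: "X \<subseteq> {..<nv G}" by (auto simp: X_def)
  have piX: "\<pi> ` X = T"
  proof
    show "T \<subseteq> \<pi> ` X"
    proof
      fix y assume y: "y \<in> T"
      then have "y \<in> \<pi> ` {..<nv G}" using T(1) img by auto
      then show "y \<in> \<pi> ` X" using y by (auto simp: X_def)
    qed
  qed (auto simp: X_def)
  have "X \<in> st_cuts ?N" using T pq nv_ge2 by (auto simp: st_cuts_def X_def)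
  from max_flow_min_cut(2)[OF wf_query mf this]
  show "cutval (nv G) r (\<pi> ` M) \<le> cutval (nv G) r T"
    using cut(2) val[OF M(1)] val[OF X] piX by simp
qed

definition recorded :: "nat set \<Rightarrow> state \<Rightarrow> state \<Rightarrow> bool" where
  "recorded S \<sigma> \<sigma>' \<longleftrightarrow> (\<forall>x<nv G. \<forall>y<nv G. rarr \<sigma>' ''U'' x y = (if x \<notin> S \<and> y \<in> S
        then min (rarr \<sigma> ''U'' x y) (cutval (nv G) (rarr \<sigma> ''R'') S - (rarr \<sigma> ''R'' y x + rarr \<sigma> ''phi'' y x))
        else rarr \<sigma> ''U'' x y) \<and>
      rarr \<sigma>' ''B'' x y = (if sep S x y
        then max (rarr \<sigma> ''B'' x y) (1 / (1 + cutval (nv G) (rarr \<sigma> ''R'') S)) else rarr \<sigma> ''B'' x y))"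

lemma runs_cutstep:
  assumes rd: "ready \<sigma>" and pq: "nvar \<sigma> ''p'' = p" "nvar \<sigma> ''q'' = q" "p < nv G" "q < nv G" "p \<noteq> q"
    and r0: "\<And>x y. x < nv G \<Longrightarrow> y < nv G \<Longrightarrow> 0 \<le> rarr \<sigma> ''R'' x y"
    and arcs: "\<And>x y. x < nv G \<Longrightarrow> y < nv G \<Longrightarrow> 0 < rarr \<sigma> ''R'' x y \<Longrightarrow> (x, y) \<in> edges G \<or> (y, x) \<in> edges G"
  shows "runs cutstep \<sigma> (48 * (nv G)\<^sup>2) 1 (\<lambda>\<sigma>'. \<exists>S. min_cut (nv G) (rarr \<sigma> ''R'') p q S \<and> recorded S \<sigma> \<sigma>')"
    (is "runs _ _ _ _ ?Q")
proof -
  have "runs cutstep \<sigma> (7 * nv G + (7 * (nv G)\<^sup>2 + (16 * (nv G)\<^sup>2 + ((2 + nv G * 3) + (8 * (nv G)\<^sup>2 + 11 * (nv G)\<^sup>2)))))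
      (0 + (1 + (0 + (0 + (0 + 0))))) ?Q"
    unfolding cutstep_def
  proof (rule runs_Seq[OF runs_relabel[OF rd pq]])
    fix \<sigma>1 assume ag1: "agree (mods relabel) \<sigma> \<sigma>1"
      and P: "bij_betw (\<lambda>x. narr \<sigma>1 ''P'' x 0) {..<nv G} {..<nv G} \<and>
        narr \<sigma>1 ''P'' (src G) 0 = p \<and> narr \<sigma>1 ''P'' (snk G) 0 = q"
    let ?\<pi> = "\<lambda>x. narr \<sigma>1 ''P'' x 0"
    have rd1: "ready \<sigma>1" by (rule ready_agree[OF rd ag1]) (simp add: mods_parts)
    have R1: "rarr \<sigma>1 ''R'' = rarr \<sigma> ''R''" using ag1 by (simp add: agree_def mods_parts)
    have "runs solve \<sigma>1 (7 * (nv G)\<^sup>2) 1 (\<lambda>\<sigma>'. (\<forall>x<nv G. \<forall>y<nv G. rarr \<sigma>' ''A'' x y =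
        rarr \<sigma>1 ''R'' (?\<pi> x) (?\<pi> y)) \<and> rarr \<sigma>' ''H'' = (\<lambda>u v. F (query G (rarr \<sigma>' ''A'')) (u, v)))"
      using P by (intro runs_solve[OF rd1] arcs) (simp_all add: R1)
    then show "runs (Seq solve (Seq reach (Seq transfer (Seq weigh update)))) \<sigma>1
        (7 * (nv G)\<^sup>2 + (16 * (nv G)\<^sup>2 + ((2 + nv G * 3) + (8 * (nv G)\<^sup>2 + 11 * (nv G)\<^sup>2))))
        (1 + (0 + (0 + (0 + 0)))) ?Q"
    proof (rule runs_Seq)
      fix \<sigma>2 assume ag2: "agree (mods solve) \<sigma>1 \<sigma>2"
        and A: "(\<forall>x<nv G. \<forall>y<nv G. rarr \<sigma>2 ''A'' x y = rarr \<sigma>1 ''R'' (?\<pi> x) (?\<pi> y)) \<and>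
          rarr \<sigma>2 ''H'' = (\<lambda>u v. F (query G (rarr \<sigma>2 ''A'')) (u, v))"
      have rd2: "ready \<sigma>2" by (rule ready_agree[OF rd1 ag2]) (simp add: mods_parts)
      show "runs (Seq reach (Seq transfer (Seq weigh update))) \<sigma>2
        (16 * (nv G)\<^sup>2 + ((2 + nv G * 3) + (8 * (nv G)\<^sup>2 + 11 * (nv G)\<^sup>2))) (0 + (0 + (0 + 0))) ?Q"
      proof (rule runs_Seq[OF runs_reach[OF rd2]])
        fix \<sigma>3 assume ag3: "agree (mods reach) \<sigma>2 \<sigma>3"
        let ?M = "{x. x < nv G \<and> 0 < narr \<sigma>3 ''mark'' x 0}"
        assume M: "src G \<in> ?M \<and> closed_under (residual \<sigma>2) ?M \<and>
          (\<forall>T. src G \<in> T \<longrightarrow> closed_under (residual \<sigma>2) T \<longrightarrow> ?M \<subseteq> T)"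
        have rd3: "ready \<sigma>3" by (rule ready_agree[OF rd2 ag3]) (simp add: mods_parts)
        have P3: "narr \<sigma>3 ''P'' = narr \<sigma>1 ''P''" using ag2 ag3 by (simp add: agree_def mods_parts)
        define S where "S = ?\<pi> ` ?M"
        have bij: "bij_betw ?\<pi> {..<nv G} {..<nv G}" and st: "?\<pi> (src G) = p" "?\<pi> (snk G) = q"
          using P by simp_all
        have A': "rarr \<sigma>2 ''A'' x y = rarr \<sigma> ''R'' (?\<pi> x) (?\<pi> y)" if "x < nv G" "y < nv G" for x y
          using A that R1 by simp
        have e: "residual \<sigma>2 x y \<longleftrightarrow> 0 < rarr \<sigma>2 ''A'' x y - F (query G (rarr \<sigma>2 ''A'')) (x, y) +
            F (query G (rarr \<sigma>2 ''A'')) (y, x)" for x y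
          using A by (simp add: residual_def)
        have subM: "?M \<subseteq> {..<nv G}" by auto
        have M1: "src G \<in> ?M" and M2: "closed_under (residual \<sigma>2) ?M"
          and M3: "\<And>T. src G \<in> T \<Longrightarrow> closed_under (residual \<sigma>2) T \<Longrightarrow> ?M \<subseteq> T"
          using M by blast+
        note cut = relabelled_min_cut[OF bij st r0 A' e subM M1 M2 M3, folded S_def]
        have min: "min_cut (nv G) (rarr \<sigma> ''R'') p q S"
          unfolding min_cut_def using cut by blast
        have inj: "inj_on (\<lambda>x. narr \<sigma>3 ''P'' x 0) {..<nv G}" using P P3 by (simp add: bij_betw_def)
        show "runs (Seq transfer (Seq weigh update)) \<sigma>3 ((2 + nv G * 3) + (8 * (nv G)\<^sup>2 + 11 * (nv G)\<^sup>2)) (0 + (0 + 0)) ?Q"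
        proof (rule runs_Seq[OF runs_transfer[OF rd3 inj]])
          fix \<sigma>4 assume ag4: "agree (mods transfer) \<sigma>3 \<sigma>4"
            and tr: "\<forall>x<nv G. narr \<sigma>4 ''S'' (narr \<sigma>3 ''P'' x 0) 0 = narr \<sigma>3 ''mark'' x 0"
          have rd4: "ready \<sigma>4" by (rule ready_agree[OF rd3 ag4]) (simp add: mods_parts)
          have R4: "rarr \<sigma>4 ''R'' = rarr \<sigma> ''R''"
            using ag1 ag2 ag3 ag4 by (simp add: agree_def mods_parts)
          have S4: "{y. y < nv G \<and> 0 < narr \<sigma>4 ''S'' y 0} = S"
          proof -
            have img: "?\<pi> ` {..<nv G} = {..<nv G}" using P by (simp add: bij_betw_def)
            have "{y. y < nv G \<and> 0 < narr \<sigma>4 ''S'' y 0} = {y \<in> ?\<pi> ` {..<nv G}. 0 < narr \<sigma>4 ''S'' y 0}"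
              by (simp add: img)
            also have "\<dots> = S" using tr P3 by (auto simp: S_def)
            finally show ?thesis .
          qed
          show "runs (Seq weigh update) \<sigma>4 (8 * (nv G)\<^sup>2 + 11 * (nv G)\<^sup>2) (0 + 0) ?Q"
          proof (rule runs_Seq[OF runs_weigh[OF rd4]], unfold S4 R4)
            fix \<sigma>5 assume ag5: "agree (mods weigh) \<sigma>4 \<sigma>5"
              and w: "rarr \<sigma>5 ''w'' 0 0 = cutval (nv G) (rarr \<sigma> ''R'') S"
            have rd5: "ready \<sigma>5" by (rule ready_agree[OF rd4 ag5]) (simp add: mods_parts)
            have k5: "narr \<sigma>5 ''S'' = narr \<sigma>4 ''S''" using ag5 by (simp add: agree_def mods_parts)
            have k: "rarr \<sigma>5 ''R'' = rarr \<sigma> ''R''" "rarr \<sigma>5 ''U'' = rarr \<sigma> ''U''"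
              "rarr \<sigma>5 ''B'' = rarr \<sigma> ''B''" "rarr \<sigma>5 ''phi'' = rarr \<sigma> ''phi''"
              using ag1 ag2 ag3 ag4 ag5 by (simp_all add: agree_def mods_parts)
            show "runs update \<sigma>5 (11 * (nv G)\<^sup>2) 0 ?Q"
              using runs_update[OF rd5] unfolding k5 S4 w k
            proof (rule runs_mono)
              fix \<sigma>' :: state
              assume "\<forall>x<nv G. \<forall>y<nv G.
                rarr \<sigma>' ''U'' x y = (if x \<notin> S \<and> y \<in> S then min (rarr \<sigma> ''U'' x y)
                  (cutval (nv G) (rarr \<sigma> ''R'') S - (rarr \<sigma> ''R'' y x + rarr \<sigma> ''phi'' y x)) else rarr \<sigma> ''U'' x y) \<and>
                rarr \<sigma>' ''B'' x y = (if sep S x y then max (rarr \<sigma> ''B'' x y)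
                  (1 / (1 + cutval (nv G) (rarr \<sigma> ''R'') S)) else rarr \<sigma> ''B'' x y)"
              then show "?Q \<sigma>'" using min unfolding recorded_def by blast
            qed simp_all
          qed
        qed
      qed
    qed
  qed
  then show ?thesis
  proof (rule runs_mono)
    \<comment> \<open>With n vertices the steps add up to 42 n^2 + 10 n + 2, and 2 \<le> n gives 48
      n^2.\<close>
    have "2 * nv G \<le> (nv G)\<^sup>2" using nv_ge2 by (simp add: power2_eq_square)
    then show "7 * nv G + (7 * (nv G)\<^sup>2 + (16 * (nv G)\<^sup>2 + ((2 + nv G * 3) + (8 * (nv G)\<^sup>2 + 11 * (nv G)\<^sup>2)))) \<le> 48 * (nv G)\<^sup>2"
      using nv_ge2(1) by linarith
  qed simp_all
qed

section \<open>One round: attaching the vertices in turn\<close>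

definition attached :: "(nat \<Rightarrow> nat \<Rightarrow> real) \<Rightarrow> (nat \<Rightarrow> nat \<Rightarrow> real) \<Rightarrow> nat \<Rightarrow> state \<Rightarrow> bool" where
  "attached \<phi> U v \<sigma> \<longleftrightarrow> (\<exists>D. family_bounds (nv G) \<phi> (cmat G) U D (rarr \<sigma> ''U'') (rarr \<sigma> ''B'') \<and>
     (\<forall>x<v. \<forall>y<v. x \<noteq> y \<longrightarrow> (\<exists>S\<in>D. best (nv G) (quality (nv G) (\<lambda>x y. U x y - \<phi> x y)) S x y)))"

lemma runs_choose_partner:
  assumes v: "nvar \<sigma> ''v'' = v" "0 < v" "v < nv G"
  shows "runs choose_partner \<sigma> (3 + nv G * 4) 0 (\<lambda>\<sigma>'. nvar \<sigma>' ''r'' < v \<and>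
    (\<forall>x<v. rarr \<sigma> ''B'' v (nvar \<sigma>' ''r'') \<le> rarr \<sigma> ''B'' v x))"
proof -
  let ?B = "rarr \<sigma> ''B''"
  let ?c = "Cond (RLess (rget ''B'' ''v'' ''x'') (rget ''B'' ''v'' ''r'')) (NAssign ''r'' (NVar ''x'')) Skip"
  let ?I = "\<lambda>i \<tau>. nvar \<tau> ''r'' < v \<and> (\<forall>x<i. ?B v (nvar \<tau> ''r'') \<le> ?B v x)"
  have "runs choose_partner \<sigma> (1 + (2 + v * (2 + 2))) (0 + v * 0) (?I v)"
    unfolding choose_partner_def
  proof (rule runs_Seq)
    show "runs (NAssign ''r'' zero) \<sigma> 1 0 (\<lambda>\<tau>. nvar \<tau> ''r'' = 0)"
      by (intro runs_loopfree) simp_all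
    fix \<sigma>' assume ag: "agree (mods (NAssign ''r'' zero)) \<sigma> \<sigma>'" and r: "nvar \<sigma>' ''r'' = 0"
    show "runs (For ''x'' ''v'' ?c) \<sigma>' (2 + v * (2 + 2)) (v * 0) (?I v)"
    proof (rule runs_For[where I = ?I])
      show "nvar \<sigma>' ''v'' = v" using v ag by (simp add: agree_def)
      fix i \<tau> assume i: "i < v" "nvar \<tau> ''x'' = i" and ag': "agree (insert ''x'' (mods ?c)) \<sigma>' \<tau>"
        and I: "?I i \<tau>"
      have "rarr \<tau> ''B'' = ?B" "nvar \<tau> ''v'' = v" using ag ag' v by (simp_all add: agree_def)
      then have "?I (Suc i) (sem ?c \<tau>)" using i I by (auto simp: less_Suc_eq)
      then show "runs ?c \<tau> 2 0 (?I (Suc i))" by (intro runs_loopfree) simp_all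
    qed (use r v in auto)
  qed
  then show ?thesis by (rule runs_mono) (use v in auto)
qed

text \<open>Earlier pairs keep their optimal sets because the family only grows; pairs with
  \<open>v\<close> are covered by \<open>best_family_extend\<close>. Both new cuts are computed from
  the same \<open>R\<close> as all earlier ones of the round.\<close>

lemma runs_attach:
  assumes rd: "ready \<sigma>" and v: "nvar \<sigma> ''v'' = v" "0 < v" "v < nv G"
    and \<phi>: "\<phi> \<in> shifted (nv G) \<phi> (cmat G)" and U: "valid_bound (nv G) \<phi> (cmat G) U"
    and phi: "\<And>x y. x < nv G \<Longrightarrow> y < nv G \<Longrightarrow> rarr \<sigma> ''phi'' x y = \<phi> x y"
    and R: "\<And>x y. x < nv G \<Longrightarrow> y < nv G \<Longrightarrow> rarr \<sigma> ''R'' x y = U x y - \<phi> x y"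
    and att: "attached \<phi> U v \<sigma>"
  shows "runs attach \<sigma> (100 * (nv G)\<^sup>2) 2 (attached \<phi> U (Suc v))"
proof -
  let ?r = "\<lambda>x y. U x y - \<phi> x y"
  let ?best = "best (nv G) (quality (nv G) ?r)"
  let ?fam = "family_bounds (nv G) \<phi> (cmat G) U"
  have r0: "0 \<le> ?r x y" if "x < nv G" "y < nv G" for x y
    using U \<phi> that by (simp add: valid_bound_def)
  have arcs: "(x, y) \<in> edges G \<or> (y, x) \<in> edges G" if "x < nv G" "y < nv G" "0 < ?r x y" for x y
  proof -
    \<comment> \<open>The residual capacity is at most the sum of the capacities in both directions,
      so it is positive only along or against an edge.\<close>
    have "U x y \<le> cmat G x y" "\<phi> y x \<le> cmat G y x" "\<phi> x y = - \<phi> y x"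
      using U \<phi> that skewD[of \<phi> x y] by (simp_all add: valid_bound_def shifted_def)
    then have "0 < cmat G x y + cmat G y x" using that by simp
    then show ?thesis by (auto simp: cmat_def split: if_splits)
  qed
  obtain D where D: "?fam D (rarr \<sigma> ''U'') (rarr \<sigma> ''B'')"
    and old: "\<And>x y. x < v \<Longrightarrow> y < v \<Longrightarrow> x \<noteq> y \<Longrightarrow> \<exists>S\<in>D. ?best S x y"
    using att unfolding attached_def by blast
  have cut_step: "runs cutstep \<tau> (48 * (nv G)\<^sup>2) 1 (\<lambda>\<tau>'. \<exists>S. min_cut (nv G) ?r p q S \<and> ?fam (insert S D') (rarr \<tau>' ''U'') (rarr \<tau>' ''B''))"
    if rdt: "ready \<tau>" and pq: "nvar \<tau> ''p'' = p" "nvar \<tau> ''q'' = q" "p < nv G" "q < nv G" "p \<noteq> q"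
      and same: "rarr \<tau> ''R'' = rarr \<sigma> ''R''" "rarr \<tau> ''phi'' = rarr \<sigma> ''phi''"
      and fam: "?fam D' (rarr \<tau> ''U'') (rarr \<tau> ''B'')" for \<tau> p q D'
  proof -
    have cv: "cutval (nv G) (rarr \<sigma> ''R'') S = cutval (nv G) ?r S" if "S \<subseteq> {..<nv G}" for S
      using R by (intro cutval_cong[OF that]) simp
    show ?thesis
    proof (rule runs_mono[OF runs_cutstep[OF rdt pq]])
      show "0 \<le> rarr \<tau> ''R'' x y" if "x < nv G" "y < nv G" for x y
        using r0[OF that] R[OF that] same by simp
      show "(x, y) \<in> edges G \<or> (y, x) \<in> edges G" if "x < nv G" "y < nv G" "0 < rarr \<tau> ''R'' x y" for x y
        using arcs[OF that(1,2)] R[OF that(1,2)] same that by simp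
      fix \<tau>' assume "\<exists>S. min_cut (nv G) (rarr \<tau> ''R'') p q S \<and> recorded S \<tau> \<tau>'"
      then obtain S where min: "min_cut (nv G) (rarr \<tau> ''R'') p q S" and upd: "recorded S \<tau> \<tau>'" by blast
      note S = min_cutD[OF min]
      have "?fam (insert S D') (rarr \<tau>' ''U'') (rarr \<tau>' ''B'')"
        by (rule family_bounds_insert[OF fam \<phi> U S(1)]) (use upd S(1) in \<open>auto simp: recorded_def same cv R phi\<close>)
      moreover have "min_cut (nv G) ?r p q S"
        unfolding min_cut_def
      proof (intro conjI allI impI)
        fix T assume "T \<subseteq> {..<nv G}" "p \<in> T" "q \<notin> T"
        then show "cutval (nv G) ?r S \<le> cutval (nv G) ?r T"
          using S(4)[of T] cv[of T] cv[OF S(1)] same(1) by simp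
      qed (use S in simp_all)
      ultimately show "\<exists>S. min_cut (nv G) ?r p q S \<and> ?fam (insert S D') (rarr \<tau>' ''U'') (rarr \<tau>' ''B'')"
        by blast
    qed simp_all
  qed
  let ?p1 = "Seq (NAssign ''p'' (NVar ''v'')) (NAssign ''q'' (NVar ''r''))"
  let ?p2 = "Seq (NAssign ''p'' (NVar ''r'')) (NAssign ''q'' (NVar ''v''))"
  have "runs attach \<sigma> ((3 + nv G * 4) + (2 + (48 * (nv G)\<^sup>2 + (2 + 48 * (nv G)\<^sup>2)))) (0 + (0 + (1 + (0 + 1))))
      (attached \<phi> U (Suc v))"
    unfolding attach_def
  proof (rule runs_Seq[OF runs_choose_partner[OF v]])
    fix \<sigma>1 assume ag1: "agree (mods choose_partner) \<sigma> \<sigma>1"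
    define u where "u = nvar \<sigma>1 ''r''"
    assume "nvar \<sigma>1 ''r'' < v \<and> (\<forall>x<v. rarr \<sigma> ''B'' v (nvar \<sigma>1 ''r'') \<le> rarr \<sigma> ''B'' v x)"
    then have u: "u < v" "\<And>x. x < v \<Longrightarrow> rarr \<sigma> ''B'' v u \<le> rarr \<sigma> ''B'' v x"
      by (simp_all add: u_def)
    have un: "u < nv G" "v \<noteq> u" "u \<noteq> v" using u v by simp_all
    have m1: "mods choose_partner = {''r'', ''x''}" by (auto simp: choose_partner_def)
    have rd1: "ready \<sigma>1" by (rule ready_agree[OF rd ag1]) (simp add: m1)
    show "runs (Seq ?p1 (Seq cutstep (Seq ?p2 cutstep))) \<sigma>1 (2 + (48 * (nv G)\<^sup>2 + (2 + 48 * (nv G)\<^sup>2))) (0 + (1 + (0 + 1)))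
        (attached \<phi> U (Suc v))"
    proof (rule runs_Seq)
      show "runs ?p1 \<sigma>1 2 0 (\<lambda>\<tau>. nvar \<tau> ''p'' = v \<and> nvar \<tau> ''q'' = u)"
        using ag1 v by (intro runs_loopfree) (simp_all add: agree_def m1 u_def)
      fix \<sigma>2 assume ag2: "agree (mods ?p1) \<sigma>1 \<sigma>2" and pq2: "nvar \<sigma>2 ''p'' = v \<and> nvar \<sigma>2 ''q'' = u"
      have rd2: "ready \<sigma>2" by (rule ready_agree[OF rd1 ag2]) simp
      have k2: "rarr \<sigma>2 ''R'' = rarr \<sigma> ''R''" "rarr \<sigma>2 ''phi'' = rarr \<sigma> ''phi''"
        "rarr \<sigma>2 ''U'' = rarr \<sigma> ''U''" "rarr \<sigma>2 ''B'' = rarr \<sigma> ''B''" "nvar \<sigma>2 ''r'' = u" "nvar \<sigma>2 ''v'' = v"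
        using ag1 ag2 v by (simp_all add: agree_def m1 u_def)
      have "?fam D (rarr \<sigma>2 ''U'') (rarr \<sigma>2 ''B'')" using D by (simp add: k2)
      from cut_step[OF rd2 _ _ v(3) un(1,2) k2(1,2) this] pq2
      have step1: "runs cutstep \<sigma>2 (48 * (nv G)\<^sup>2) 1 (\<lambda>\<tau>'. \<exists>S. min_cut (nv G) ?r v u S \<and> ?fam (insert S D) (rarr \<tau>' ''U'') (rarr \<tau>' ''B''))" by simp
      show "runs (Seq cutstep (Seq ?p2 cutstep)) \<sigma>2 (48 * (nv G)\<^sup>2 + (2 + 48 * (nv G)\<^sup>2)) (1 + (0 + 1))
          (attached \<phi> U (Suc v))"
      proof (rule runs_Seq[OF step1])
        fix \<sigma>3 assume ag3: "agree (mods cutstep) \<sigma>2 \<sigma>3"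
          and "\<exists>S. min_cut (nv G) ?r v u S \<and> ?fam (insert S D) (rarr \<sigma>3 ''U'') (rarr \<sigma>3 ''B'')"
        then obtain S where S: "min_cut (nv G) ?r v u S"
          and fam3: "?fam (insert S D) (rarr \<sigma>3 ''U'') (rarr \<sigma>3 ''B'')" by blast
        have rd3: "ready \<sigma>3" by (rule ready_agree[OF rd2 ag3]) (simp add: mods_cutstep)
        show "runs (Seq ?p2 cutstep) \<sigma>3 (2 + 48 * (nv G)\<^sup>2) (0 + 1) (attached \<phi> U (Suc v))"
        proof (rule runs_Seq)
          show "runs ?p2 \<sigma>3 2 0 (\<lambda>\<tau>. nvar \<tau> ''p'' = u \<and> nvar \<tau> ''q'' = v)"
            using ag3 k2 by (intro runs_loopfree) (simp_all add: agree_def mods_cutstep)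
          fix \<sigma>4 assume ag4: "agree (mods ?p2) \<sigma>3 \<sigma>4" and pq4: "nvar \<sigma>4 ''p'' = u \<and> nvar \<sigma>4 ''q'' = v"
          have rd4: "ready \<sigma>4" by (rule ready_agree[OF rd3 ag4]) simp
          have k4: "rarr \<sigma>4 ''R'' = rarr \<sigma> ''R''" "rarr \<sigma>4 ''phi'' = rarr \<sigma> ''phi''"
            "rarr \<sigma>4 ''U'' = rarr \<sigma>3 ''U''" "rarr \<sigma>4 ''B'' = rarr \<sigma>3 ''B''"
            using ag3 ag4 k2 by (simp_all add: agree_def mods_cutstep)
          have "?fam (insert S D) (rarr \<sigma>4 ''U'') (rarr \<sigma>4 ''B'')" using fam3 by (simp add: k4)
          from cut_step[OF rd4 _ _ un(1) v(3) un(3) k4(1,2) this] pq4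
          have "runs cutstep \<sigma>4 (48 * (nv G)\<^sup>2) 1 (\<lambda>\<tau>'. \<exists>S'. min_cut (nv G) ?r u v S' \<and> ?fam (insert S' (insert S D)) (rarr \<tau>' ''U'') (rarr \<tau>' ''B''))" by simp
          then show "runs cutstep \<sigma>4 (48 * (nv G)\<^sup>2) 1 (attached \<phi> U (Suc v))"
          proof (rule runs_mono)
            fix \<tau> :: state assume "\<exists>S'. min_cut (nv G) ?r u v S' \<and> ?fam (insert S' (insert S D)) (rarr \<tau> ''U'') (rarr \<tau> ''B'')"
            then obtain S' where S': "min_cut (nv G) ?r u v S'"
              and fam: "?fam (insert S' (insert S D)) (rarr \<tau> ''U'') (rarr \<tau> ''B'')" by blast
            let ?D' = "insert S' (insert S D)"
            have "?best S v u \<or> ?best S' v u"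
              by (rule best_of_two[OF _ S S']) (use r0 in simp_all)
            then obtain C where C: "C \<in> ?D'" "?best C v u" by blast
            have Dsub: "D \<subseteq> Pow {..<nv G}" and bv: "best_value (nv G) (quality (nv G) ?r) D (rarr \<sigma> ''B'')"
              using D by (simp_all add: family_bounds_def)
            have pos: "0 < quality (nv G) ?r S" if "S \<subseteq> {..<nv G}" for S
              using cutval_nonneg[OF that, of ?r] r0 by (simp add: quality_def add_pos_nonneg)
            have new: "\<exists>S\<in>?D'. ?best S v x" if "x < v" for x
              by (rule best_family_extend[OF pos Dsub bv old u v(3) _ C that]) auto
            have "\<exists>S\<in>?D'. ?best S x y" if xy: "x < Suc v" "y < Suc v" "x \<noteq> y" for x y
            proof -
              consider "x < v" "y < v" | "x = v" "y < v" | "x < v" "y = v"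
                using xy by (auto simp: less_Suc_eq)
              then show ?thesis
              proof cases
                case 1
                then show ?thesis using old[of x y] xy(3) by blast
              next
                case 2
                then show ?thesis using new by simp
              next
                case 3
                then show ?thesis using new[of x] by (simp add: best_sym[of _ _ _ x])
              qed
            qed
            then show "attached \<phi> U (Suc v) \<tau>" using fam unfolding attached_def by blast
          qed simp_all
        qed
      qed
    qed
  qed
  then show ?thesis
  proof (rule runs_mono)
    have "2 * nv G \<le> (nv G)\<^sup>2" using nv_ge2 by (simp add: power2_eq_square)
    then show "3 + nv G * 4 + (2 + (48 * (nv G)\<^sup>2 + (2 + 48 * (nv G)\<^sup>2))) \<le> 100 * (nv G)\<^sup>2"
      using nv_ge2(1) by linarith
  qed simp_all
qed

lemma runs_tighten:
  assumes rd: "ready \<sigma>"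
    and \<phi>: "\<phi> \<in> shifted (nv G) \<phi> (cmat G)" and U: "valid_bound (nv G) \<phi> (cmat G) (rarr \<sigma> ''U'')"
    and phi: "\<And>x y. x < nv G \<Longrightarrow> y < nv G \<Longrightarrow> rarr \<sigma> ''phi'' x y = \<phi> x y"
  shows "runs tighten \<sigma> (110 * nv G ^ 3) (2 * nv G)
    (\<lambda>\<sigma>'. tightens (nv G) \<phi> (cmat G) (rarr \<sigma> ''U'') (rarr \<sigma>' ''U''))"
proof -
  let ?c = "Seq (rput ''R'' ''x'' ''y'' (RSub (rget ''U'' ''x'' ''y'') (rget ''phi'' ''x'' ''y'')))
    (rput ''B'' ''x'' ''y'' RZero)"
  let ?b = "Cond (NLess zero (NVar ''v'')) attach Skip"
  let ?U = "rarr \<sigma> ''U''"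
  let ?new = "\<lambda>a x y. if a = ''B'' then 0 else if a = ''R'' then ?U x y - rarr \<sigma> ''phi'' x y else rarr \<sigma> a x y"
  have grid: "runs (For ''x'' ''n'' (For ''y'' ''n'' ?c)) \<sigma> (2 + nv G * (4 + nv G * (cost ?c + 2))) 0
    (\<lambda>\<sigma>'. \<forall>a u v. rarr \<sigma>' a u v = (if u < nv G \<and> v < nv G then ?new a u v else rarr \<sigma> a u v) \<and>
      narr \<sigma>' a u v = (if u < nv G \<and> v < nv G then narr \<sigma> a u v else narr \<sigma> a u v))"
  proof (rule runs_grid[where newn = "\<lambda>a u v. narr \<sigma> a u v" and newr = ?new])
    show "nvar \<sigma> ''n'' = nv G" using rd by (simp add: ready_def)
    fix i j and \<tau> :: state assume v: "nvar \<tau> ''x'' = i" "nvar \<tau> ''y'' = j"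
      and same: "\<And>a. rarr \<tau> a i j = rarr \<sigma> a i j" "\<And>a. narr \<tau> a i j = narr \<sigma> a i j"
    show "cells_at (sem ?c \<tau>) = (cells_at \<tau>)((i, j) := (\<lambda>a. narr \<sigma> a i j, \<lambda>a. ?new a i j))"
      using v same by (auto simp: cells_at_def fun_eq_iff upd2_apply)
  qed auto
  have "runs tighten \<sigma> ((2 + nv G * (4 + nv G * (cost ?c + 2))) + (2 + nv G * (Suc (100 * (nv G)\<^sup>2) + 2)))
      (0 + nv G * 2) (attached \<phi> ?U (nv G))"
    unfolding tighten_def
  proof (rule runs_Seq[OF grid])
    fix \<sigma>1 assume ag1: "agree (mods (For ''x'' ''n'' (For ''y'' ''n'' ?c))) \<sigma> \<sigma>1"
      and post: "\<forall>a u v. rarr \<sigma>1 a u v = (if u < nv G \<and> v < nv G then ?new a u v else rarr \<sigma> a u v) \<and>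
        narr \<sigma>1 a u v = (if u < nv G \<and> v < nv G then narr \<sigma> a u v else narr \<sigma> a u v)"
    have B1: "rarr \<sigma>1 ''B'' x y = 0" and R1: "rarr \<sigma>1 ''R'' x y = ?U x y - \<phi> x y"
      if "x < nv G" "y < nv G" for x y
      using post phi that by simp_all
    have rd1: "ready \<sigma>1" by (rule ready_agree[OF rd ag1]) simp
    have k1: "rarr \<sigma>1 ''U'' = ?U" "rarr \<sigma>1 ''phi'' = rarr \<sigma> ''phi''"
      using ag1 by (simp_all add: agree_def)
    show "runs (For ''v'' ''n'' ?b) \<sigma>1 (2 + nv G * (Suc (100 * (nv G)\<^sup>2) + 2)) (nv G * 2) (attached \<phi> ?U (nv G))"
    proof (rule runs_For)
      show "nvar \<sigma>1 ''n'' = nv G" using rd1 by (simp add: ready_def)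
      show "''v'' \<notin> mods ?b" "''n'' \<notin> mods ?b" by (simp_all add: mods_attach mods_cutstep)
      show "attached \<phi> ?U i (\<tau>\<lparr>nvar := (nvar \<tau>)(''v'' := j)\<rparr>) = attached \<phi> ?U i \<tau>" for i \<tau> j
        by (simp add: attached_def)
      show "attached \<phi> ?U 0 \<sigma>1"
        unfolding attached_def
      proof (intro exI conjI)
        show "family_bounds (nv G) \<phi> (cmat G) ?U {} (rarr \<sigma>1 ''U'') (rarr \<sigma>1 ''B'')"
          using U by (simp add: family_bounds_def best_value_def k1 B1)
      qed simp
      fix i \<tau> assume i: "i < nv G" "nvar \<tau> ''v'' = i" and ag: "agree (insert ''v'' (mods ?b)) \<sigma>1 \<tau>"
        and att: "attached \<phi> ?U i \<tau>"
      have rdt: "ready \<tau>" by (rule ready_agree[OF rd1 ag]) (simp add: mods_attach mods_cutstep)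
      have k: "rarr \<tau> ''R'' = rarr \<sigma>1 ''R''" "rarr \<tau> ''phi'' = rarr \<sigma>1 ''phi''"
        using ag by (simp_all add: agree_def mods_attach mods_cutstep)
      show "runs ?b \<tau> (Suc (100 * (nv G)\<^sup>2)) 2 (attached \<phi> ?U (Suc i))"
      proof (rule runs_Cond)
        assume "bval \<tau> (NLess zero (NVar ''v''))"
        then have "0 < i" using i by simp
        then show "runs attach \<tau> (100 * (nv G)\<^sup>2) 2 (attached \<phi> ?U (Suc i))"
          by (intro runs_attach[OF rdt i(2) _ i(1) \<phi> U _ _ att]) (simp_all add: k k1 phi R1)
      next
        assume "\<not> bval \<tau> (NLess zero (NVar ''v''))"
        \<comment> \<open>A single vertex forms no pair, so the invariant passes from 0 to 1 without
          a cut.\<close>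
        then have "i = 0" using i by simp
        then have "attached \<phi> ?U (Suc i) \<tau>" using att by (auto simp: attached_def)
        then have "runs Skip \<tau> 1 0 (attached \<phi> ?U (Suc i))" by (intro runs_loopfree) simp_all
        moreover have "1 \<le> 100 * (nv G)\<^sup>2" using nv_ge2 by simp
        ultimately show "runs Skip \<tau> (100 * (nv G)\<^sup>2) 2 (attached \<phi> ?U (Suc i))"
          by (rule runs_mono) simp_all
      qed
    qed simp
  qed
  then show ?thesis
  proof (rule runs_mono)
    have "2 * (nv G)\<^sup>2 \<le> nv G ^ 3" "2 * nv G \<le> (nv G)\<^sup>2"
      using nv_ge2 by (simp_all add: power2_eq_square power3_eq_cube)
    moreover have "nv G * (Suc (100 * (nv G)\<^sup>2) + 2) = 100 * nv G ^ 3 + 3 * nv G"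
      by (simp add: algebra_simps power2_eq_square power3_eq_cube)
    moreover have "2 + nv G * (4 + nv G * (cost ?c + 2)) \<le> 7 * (nv G)\<^sup>2"
      using grid_cost[of "cost ?c + 2"] by simp
    ultimately show "2 + nv G * (4 + nv G * (cost ?c + 2)) + (2 + nv G * (Suc (100 * (nv G)\<^sup>2) + 2)) \<le> 110 * nv G ^ 3"
      using nv_ge2(1) by linarith
    fix \<sigma>' assume "attached \<phi> ?U (nv G) \<sigma>'"
    then obtain D where D: "family_bounds (nv G) \<phi> (cmat G) ?U D (rarr \<sigma>' ''U'') (rarr \<sigma>' ''B'')"
      and all: "\<And>x y. x < nv G \<Longrightarrow> y < nv G \<Longrightarrow> x \<noteq> y \<Longrightarrow>
        \<exists>S\<in>D. best (nv G) (quality (nv G) (\<lambda>x y. ?U x y - \<phi> x y)) S x y"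
      unfolding attached_def by blast
    show "tightens (nv G) \<phi> (cmat G) ?U (rarr \<sigma>' ''U'')"
      by (rule family_bounds_tightens[OF D \<phi> U all])
  qed simp
qed

section \<open>The initial flow, the output and the whole program\<close>

lemma max_flow_query_cmat: "max_flow G (F (query G (cmat G)))"
proof -
  let ?N = "query G (cmat G)"
  have c: "cap ?N e = cap G e" if "e \<in> edges G" for e
    using that by (cases e) (simp add: query_def cmat_def)
  have E: "edges ?N = edges G"
    using wf by (auto simp: query_def cmat_def wf_network_def split: if_splits)
  \<comment> \<open>The query need not equal \<open>G\<close>, since the capacity functions may
    differ off the edges; flows and their values see only the edges.\<close>
  have fl: "st_flow ?N f \<longleftrightarrow> st_flow G f" "flow_value ?N f = flow_value G f" for f
    using c by (simp_all add: st_flow_def flow_value_def outflow_def inflow_def E)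
  have "max_flow ?N (F ?N)" using flows wf_query by (simp add: max_flow_oracle_def)
  then show ?thesis by (simp add: max_flow_def fl)
qed

lemma runs_init_bounds:
  assumes rd: "ready \<sigma>" and c: "rarr \<sigma> ''c'' = cmat G" and U: "rarr \<sigma> ''U'' = (\<lambda>_ _. 0)"
  shows "runs init_bounds \<sigma> (8 * (nv G)\<^sup>2) 1 (\<lambda>\<sigma>'. rarr \<sigma>' ''U'' = cmat G \<and>
    (\<forall>x<nv G. \<forall>y<nv G. rarr \<sigma>' ''phi'' x y = net (F (query G (cmat G))) x y))"
proof -
  let ?c = "Seq (rput ''U'' ''x'' ''y'' (rget ''c'' ''x'' ''y''))
       (rput ''phi'' ''x'' ''y'' (RSub (rget ''f'' ''x'' ''y'') (rget ''f'' ''y'' ''x'')))"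
  let ?N = "query G (cmat G)"
  have "runs init_bounds \<sigma> (1 + (2 + nv G * (4 + nv G * (cost ?c + 2)))) (1 + 0)
     (\<lambda>\<sigma>'. rarr \<sigma>' ''U'' = cmat G \<and> (\<forall>x<nv G. \<forall>y<nv G. rarr \<sigma>' ''phi'' x y = net (F ?N) x y))"
    unfolding init_bounds_def
  proof (rule runs_Seq)
    have "edges ?N \<subseteq> edges G" by (auto simp: query_def cmat_def split: if_splits)
    moreover have "finite (edges G)"
      by (rule finite_subset[of _ "{..<nv G} \<times> {..<nv G}"]) (use wf in \<open>auto simp: wf_network_def\<close>)
    ultimately have "card (edges ?N) \<le> card (edges G)" by (intro card_mono)
    then show "runs (MaxFlow ''c'' ''f'') \<sigma> 1 1 (\<lambda>\<tau>. rarr \<tau> ''f'' = (\<lambda>u v. F ?N (u, v)))"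
      by (intro runs_MaxFlow) (simp_all add: c)
    fix \<sigma>1 assume ag: "agree (mods (MaxFlow ''c'' ''f'')) \<sigma> \<sigma>1" and f: "rarr \<sigma>1 ''f'' = (\<lambda>u v. F ?N (u, v))"
    let ?new = "\<lambda>a x y. if a = ''phi'' then net (F ?N) x y else if a = ''U'' then cmat G x y else rarr \<sigma>1 a x y"
    have c1: "rarr \<sigma>1 ''c'' = cmat G" using ag c by (simp add: agree_def)
    have "runs (For ''x'' ''n'' (For ''y'' ''n'' ?c)) \<sigma>1 (2 + nv G * (4 + nv G * (cost ?c + 2))) 0
      (\<lambda>\<sigma>'. \<forall>a u v. rarr \<sigma>' a u v = (if u < nv G \<and> v < nv G then ?new a u v else rarr \<sigma>1 a u v) \<and>
        narr \<sigma>' a u v = (if u < nv G \<and> v < nv G then narr \<sigma>1 a u v else narr \<sigma>1 a u v))"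
    proof (rule runs_grid[where newn = "\<lambda>a u v. narr \<sigma>1 a u v" and newr = ?new])
      show "nvar \<sigma>1 ''n'' = nv G" using rd ag by (simp add: ready_def agree_def)
      fix i j \<tau> assume ag': "agree (insert ''x'' (insert ''y'' (mods ?c))) \<sigma>1 \<tau>"
        and v: "nvar \<tau> ''x'' = i" "nvar \<tau> ''y'' = j"
        and same: "\<And>a. rarr \<tau> a i j = rarr \<sigma>1 a i j" "\<And>a. narr \<tau> a i j = narr \<sigma>1 a i j"
      have "rarr \<tau> ''c'' = cmat G" "rarr \<tau> ''f'' = (\<lambda>u v. F ?N (u, v))"
        using ag' c1 f by (simp_all add: agree_def)
      then show "cells_at (sem ?c \<tau>) = (cells_at \<tau>)((i, j) := (\<lambda>a. narr \<sigma>1 a i j, \<lambda>a. ?new a i j))"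
        using v same c1 f by (auto simp: cells_at_def fun_eq_iff upd2_apply net_def)
    qed auto
    then show "runs (For ''x'' ''n'' (For ''y'' ''n'' ?c)) \<sigma>1 (2 + nv G * (4 + nv G * (cost ?c + 2))) 0
      (\<lambda>\<sigma>'. rarr \<sigma>' ''U'' = cmat G \<and> (\<forall>x<nv G. \<forall>y<nv G. rarr \<sigma>' ''phi'' x y = net (F ?N) x y))"
    proof (rule runs_mono)
      fix \<sigma>' :: state
      assume post: "\<forall>a u v. rarr \<sigma>' a u v = (if u < nv G \<and> v < nv G then ?new a u v else rarr \<sigma>1 a u v) \<and>
        narr \<sigma>' a u v = (if u < nv G \<and> v < nv G then narr \<sigma>1 a u v else narr \<sigma>1 a u v)"
      \<comment> \<open>The initial zeros outside the vertex range make \<open>U\<close> equal to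
        \<open>cmat G\<close> as a function, so that it can be substituted in
        \<open>tightens\<close>.\<close>
      have "rarr \<sigma>1 ''U'' = (\<lambda>_ _. 0)" using ag U by (simp add: agree_def)
      moreover have "cmat G x y = 0" if "\<not> (x < nv G \<and> y < nv G)" for x y
        using wf that by (auto simp: cmat_def wf_network_def)
      ultimately have "rarr \<sigma>' ''U'' x y = cmat G x y" for x y using post by simp
      then show "rarr \<sigma>' ''U'' = cmat G \<and> (\<forall>x<nv G. \<forall>y<nv G. rarr \<sigma>' ''phi'' x y = net (F ?N) x y)"
        using post by (simp add: fun_eq_iff)
    qed simp_all
  qed
  then show ?thesis
  proof (rule runs_mono)
    have "1 \<le> (nv G)\<^sup>2" using nv_ge2 by simp
    then show "1 + (2 + nv G * (4 + nv G * (cost ?c + 2))) \<le> 8 * (nv G)\<^sup>2"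
      using grid_cost[of "cost ?c + 2"] by simp
  qed simp_all
qed

lemma runs_report:
  assumes rd: "ready \<sigma>"
  shows "runs report \<sigma> (7 * (nv G)\<^sup>2) 0 (\<lambda>\<sigma>'. \<forall>x<nv G. \<forall>y<nv G.
    narr \<sigma>' ''vital'' x y = (if rarr \<sigma> ''U'' y x < 0 then 1 else narr \<sigma> ''vital'' x y))"
proof -
  let ?c = "Cond (RLess (rget ''U'' ''y'' ''x'') RZero) (NSet ''vital'' (NVar ''x'') (NVar ''y'') (NConst 1)) Skip"
  let ?new = "\<lambda>a x y. if a = ''vital'' \<and> rarr \<sigma> ''U'' y x < 0 then 1 else narr \<sigma> a x y"
  have "runs report \<sigma> (2 + nv G * (4 + nv G * (cost ?c + 2))) 0
    (\<lambda>\<sigma>'. \<forall>a u v. rarr \<sigma>' a u v = (if u < nv G \<and> v < nv G then rarr \<sigma> a u v else rarr \<sigma> a u v) \<and>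
      narr \<sigma>' a u v = (if u < nv G \<and> v < nv G then ?new a u v else narr \<sigma> a u v))"
    unfolding report_def
  proof (rule runs_grid[where newr = "\<lambda>a u v. rarr \<sigma> a u v" and newn = ?new])
    show "nvar \<sigma> ''n'' = nv G" using rd by (simp add: ready_def)
    fix i j \<tau> assume ag: "agree (insert ''x'' (insert ''y'' (mods ?c))) \<sigma> \<tau>"
      and v: "nvar \<tau> ''x'' = i" "nvar \<tau> ''y'' = j"
      and same: "\<And>a. rarr \<tau> a i j = rarr \<sigma> a i j" "\<And>a. narr \<tau> a i j = narr \<sigma> a i j"
    have "rarr \<tau> ''U'' = rarr \<sigma> ''U''" using ag by (simp add: agree_def)
    then show "cells_at (sem ?c \<tau>) = (cells_at \<tau>)((i, j) := (\<lambda>a. ?new a i j, \<lambda>a. rarr \<sigma> a i j))"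
      using v same by (auto simp: cells_at_def fun_eq_iff upd2_apply)
  qed auto
  then show ?thesis
    by (rule runs_mono) (use grid_cost[of "cost ?c + 2"] in simp_all)
qed

text \<open>One initial flow and at most \<open>2 * nv G\<close> in each of two rounds make at most
  \<open>5 * nv G\<close>; the two rounds also dominate the time.\<close>

lemma runs_find_vital:
  "runs find_vital (initial_state G) (230 * nv G ^ 3) (5 * nv G) (\<lambda>\<sigma>. output_edges G \<sigma> = vital_edges G)"
proof -
  let ?f = "F (query G (cmat G))"
  let ?n = "nv G"
  let ?tight = "tightens ?n (net ?f) (cmat G)"
  have mf: "max_flow G ?f" by (rule max_flow_query_cmat)
  have \<phi>: "net ?f \<in> shifted ?n (net ?f) (cmat G)" by (rule max_flow_shifted[OF wf mf])
  have rd: "ready (initial_state G)" by (simp add: ready_def initial_state_def)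
  have c: "rarr (initial_state G) ''c'' = cmat G" and z: "rarr (initial_state G) ''U'' = (\<lambda>_ _. 0)"
    by (simp_all add: initial_state_def cmat_def fun_eq_iff)
  have "runs find_vital (initial_state G)
      (8 * ?n\<^sup>2 + (110 * ?n ^ 3 + (110 * ?n ^ 3 + 7 * ?n\<^sup>2))) (1 + (2 * ?n + (2 * ?n + 0)))
      (\<lambda>\<sigma>. output_edges G \<sigma> = vital_edges G)"
    unfolding find_vital_def
  proof (rule runs_Seq[OF runs_init_bounds[OF rd c z]])
    fix \<sigma>1 assume ag1: "agree (mods init_bounds) (initial_state G) \<sigma>1"
      and 1: "rarr \<sigma>1 ''U'' = cmat G \<and> (\<forall>x<?n. \<forall>y<?n. rarr \<sigma>1 ''phi'' x y = net ?f x y)"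
    let ?U1 = "rarr \<sigma>1 ''U''"
    have ms: "mods init_bounds = {''f'', ''x'', ''y'', ''U'', ''phi''}" by (auto simp: init_bounds_def)
    have rd1: "ready \<sigma>1" by (rule ready_agree[OF rd ag1]) (simp add: ms)
    have vb1: "valid_bound ?n (net ?f) (cmat G) ?U1"
      using 1 by (simp add: valid_bound_refl)
    show "runs (Seq tighten (Seq tighten report)) \<sigma>1 (110 * ?n ^ 3 + (110 * ?n ^ 3 + 7 * ?n\<^sup>2)) (2 * ?n + (2 * ?n + 0))
        (\<lambda>\<sigma>. output_edges G \<sigma> = vital_edges G)"
    proof (rule runs_Seq[OF runs_tighten[OF rd1 \<phi> vb1]])
      fix \<sigma>2 assume ag2: "agree (mods tighten) \<sigma>1 \<sigma>2" and T1: "?tight ?U1 (rarr \<sigma>2 ''U'')"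
      let ?U2 = "rarr \<sigma>2 ''U''"
      have rd2: "ready \<sigma>2"
        by (rule ready_agree[OF rd1 ag2]) (simp add: mods_tighten mods_attach mods_cutstep)
      have vb2: "valid_bound ?n (net ?f) (cmat G) ?U2" using T1 by (simp add: tightens_def)
      have phi2: "rarr \<sigma>2 ''phi'' x y = net ?f x y" if "x < ?n" "y < ?n" for x y
        using 1 that ag2 by (simp add: agree_def mods_tighten mods_attach mods_cutstep)
      show "runs (Seq tighten report) \<sigma>2 (110 * ?n ^ 3 + 7 * ?n\<^sup>2) (2 * ?n + 0) (\<lambda>\<sigma>. output_edges G \<sigma> = vital_edges G)"
      proof (rule runs_Seq[OF runs_tighten[OF rd2 \<phi> vb2 phi2]])
        fix \<sigma>3 assume ag3: "agree (mods tighten) \<sigma>2 \<sigma>3" and T2: "?tight ?U2 (rarr \<sigma>3 ''U'')"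
        have rd3: "ready \<sigma>3"
          by (rule ready_agree[OF rd2 ag3]) (simp add: mods_tighten mods_attach mods_cutstep)
        have vit: "narr \<sigma>3 ''vital'' = (\<lambda>_ _. 0)"
          using ag1 ag2 ag3 by (simp add: agree_def ms mods_tighten mods_attach mods_cutstep initial_state_def)
        show "runs report \<sigma>3 (7 * ?n\<^sup>2) 0 (\<lambda>\<sigma>. output_edges G \<sigma> = vital_edges G)"
          using runs_report[OF rd3]
        proof (rule runs_mono)
          fix \<sigma>4 :: state assume 4: "\<forall>x<?n. \<forall>y<?n. narr \<sigma>4 ''vital'' x y =
            (if rarr \<sigma>3 ''U'' y x < 0 then 1 else narr \<sigma>3 ''vital'' x y)"
          have T1': "?tight (cmat G) ?U2" using T1 1 by simp
          have iff: "narr \<sigma>4 ''vital'' x y = 1 \<longleftrightarrow> (x, y) \<in> vital_edges G" if "x < ?n" "y < ?n" for x y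
            using 4 that vit vital_edge_iff_bound[OF flows wf mf T1' T2 that] by simp
          have "vital_edges G \<subseteq> {..<?n} \<times> {..<?n}"
            using wf by (auto simp: vital_edges_def wf_network_def)
          then show "output_edges G \<sigma>4 = vital_edges G"
            using iff by (auto simp: output_edges_def)
        qed simp_all
      qed
    qed (use 1 in simp)
  qed
  then show ?thesis
  proof (rule runs_mono)
    have "2 * ?n\<^sup>2 \<le> ?n ^ 3"
      using nv_ge2 by (simp add: power2_eq_square power3_eq_cube)
    then show "8 * ?n\<^sup>2 + (110 * ?n ^ 3 + (110 * ?n ^ 3 + 7 * ?n\<^sup>2)) \<le> 230 * ?n ^ 3" by linarith
    show "1 + (2 * ?n + (2 * ?n + 0)) \<le> 5 * ?n" using nv_ge2(1) by linarith
  qed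
qed

end

theorem theorem3:
  shows "\<exists>(P :: com) (K :: nat). \<forall>F G. max_flow_oracle F \<and> wf_network G \<longrightarrow>
    (\<exists>k qs \<sigma>. exec F G P (initial_state G) k qs \<sigma> \<and>
       output_edges G \<sigma> = vital_edges G \<and>
       length qs \<le> K * nv G \<and>
       (\<forall>q\<in>set qs. card (edges q) \<le> K * (nv G + card (edges G))) \<and>
       k \<le> K * nv G ^ 3)"
proof (rule exI[of _ find_vital], rule exI[of _ 230], intro allI impI)
  fix F G assume "max_flow_oracle F \<and> wf_network G"
  then interpret machine F G by unfold_locales auto
  obtain k qs \<sigma> where *: "exec F G find_vital (initial_state G) k qs \<sigma>" "k \<le> 230 * nv G ^ 3"
      "length qs \<le> 5 * nv G" "output_edges G \<sigma> = vital_edges G"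
      "\<forall>q\<in>set qs. card (edges q) \<le> 2 * (nv G + card (edges G))"
    using runs_find_vital unfolding runs_def by blast
  \<comment> \<open>One constant has to serve all three bounds; the running time dictates
    it.\<close>
  have "\<forall>q\<in>set qs. card (edges q) \<le> 230 * (nv G + card (edges G))"
    using *(5) by (meson le_trans mult_le_mono1 numeral_le_iff semiring_norm)
  then show "\<exists>k qs \<sigma>. exec F G find_vital (initial_state G) k qs \<sigma> \<and>
       output_edges G \<sigma> = vital_edges G \<and> length qs \<le> 230 * nv G \<and>
       (\<forall>q\<in>set qs. card (edges q) \<le> 230 * (nv G + card (edges G))) \<and> k \<le> 230 * nv G ^ 3"
    using * by (intro exI[of _ k] exI[of _ qs] exI[of _ \<sigma>]) auto
qed

end
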